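(* Let $\vec n=(n_1,\dots,n_r)$ and let $\mathbb{P}^{\vec n}=\mathbb{P}^{n_1}\times\cdots\times\mathbb{P}^{n_r}$ be the product of projective spaces over a field $\Bbbk$. If $\Delta$ is a pure and balanced simplicial complex on the vertex set $X_{\vec n}=\{x_{i,j}\mid 1\le i\le r,\ 0\le j\le n_i\}$ corresponding to $\mathbb{P}^{\vec n}$, then $\Delta$ is virtually Cohen--Macaulay.
   Context: Setting: $r\ge 1$, $n_i\ge 0$ are integers, $|\vec n|=n_1+\cdots+n_r$, and $S=\Bbbk[x_{i,j}\mid 1\le i\le r,\ 0\le j\le n_i]$ is the Cox ring of $\mathbb{P}^{\vec n}$ over the field $\Bbbk$, with the $\mathbb{Z}^r$-grading $\deg(x_{i,j})=\mathbf{e}_i$ (the $i$-th standard basis vector). The irrelevant ideal is $B=\bigcap_{i=1}^r\langle x_{i,0},\dots,x_{i,n_i}\rangle$. Each $\mathbb{Z}^r$-graded $S$-module $M$ has an associated quasi-coherent sheaf $\widetilde M$ on $\mathbb{P}^{\vec n}$, and for a homogeneous ideal $I$, $V(I)\subseteq\mathbb{P}^{\vec n}$ denotes its variety. Simplicial complexes: a simplicial complex $\Delta$ on $X_{\vec n}$ is a nonempty collection of subsets of $X_{\vec n}$ (not every element of $X_{\vec n}$ need be a vertex of $\Delta$) closed under taking subsets. Facets are maximal faces; $\Delta$ is pure if all facets have the same dimension. $I_\Delta\subseteq S$ denotes the Stanley--Reisner ideal of $\Delta$ (generated by the squarefree monomials corresponding to non-faces), and $\Bbbk[\Delta]=S/I_\Delta$.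 The $i$-th component is the vertex set $\{x_{i,0},\dots,x_{i,n_i}\}$. A facet is balanced if it contains exactly one vertex from every component; $\Delta$ is balanced if all of its facets are balanced. Virtual resolutions: for a homogeneous ideal $I\subseteq S$, a virtual resolution of $S/I$ is a complex $F_\bullet=[F_0\leftarrow F_1\leftarrow\cdots\leftarrow F_k\leftarrow 0]$ of finitely generated $\mathbb{Z}^r$-graded free $S$-modules (with degree-preserving maps) such that the associated complex of sheaves $\widetilde{F_\bullet}$ is a locally free resolution of the sheaf $(S/I)^\sim$ on $\mathbb{P}^{\vec n}$. Its length is $k$. Virtually Cohen--Macaulay: $\Delta$ is $B$-saturated if $I_\Delta:B^\infty=I_\Delta$, where $I:B^\infty=\bigcup_{k>0}(I:B^k)$. Put $\operatorname{codim} I_\Delta=|\vec n|-\dim V(I_\Delta)$. A $B$-saturated simplicial complex $\Delta$ on $X_{\vec n}$ is virtually Cohen--Macaulay if there exists a virtual resolution of $\Bbbk[\Delta]$ of length $\operatorname{codim}(I_\Delta)$. *)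

theory Defs
  imports
    "HOL-Analysis.Abstract_Topology"
    "HOL-Library.Extended_Real"
    "HOL-Library.FuncSet"
    "HOL-Library.Poly_Mapping"
    "HOL-Algebra.Module"
    "HOL-Algebra.QuotRing"
    "HOL-Algebra.Ideal_Product"
begin

section \<open>The Cox ring of a product of projective spaces\<close>

text \<open>
  The vector \<open>(n\<^sub>1, \<dots>, n\<^sub>r)\<close> is given by \<open>r :: nat\<close> and \<open>n :: nat \<Rightarrow> nat\<close>; only the values
  \<open>n i\<close> with \<open>1 \<le> i \<le> r\<close> matter. The variable \<open>x\<^sub>i\<^sub>,\<^sub>j\<close> and the corresponding vertex are both
  represented by the pair \<open>(i, j)\<close>.
\<close>

definition vertices :: "nat \<Rightarrow> (nat \<Rightarrow> nat) \<Rightarrow> (nat \<times> nat) set"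
  where "vertices r n = (SIGMA i:{1..r}. {0..n i})"

type_synonym monom = "(nat \<times> nat) \<Rightarrow>\<^sub>0 nat"
type_synonym 'k cox_poly = "monom \<Rightarrow>\<^sub>0 'k"

definition poly_vars :: "'k::zero cox_poly \<Rightarrow> (nat \<times> nat) set"
  where "poly_vars p = (\<Union>m\<in>Poly_Mapping.keys p. Poly_Mapping.keys m)"

definition cox_ring :: "nat \<Rightarrow> (nat \<Rightarrow> nat) \<Rightarrow> 'k::field cox_poly ring"
  where "cox_ring r n =
    \<lparr>carrier = {p. poly_vars p \<subseteq> vertices r n}, mult = (*), one = 1, zero = 0, add = (+)\<rparr>"

definition var :: "nat \<times> nat \<Rightarrow> 'k::field cox_poly"
  where "var v = Poly_Mapping.single (Poly_Mapping.single v 1) 1"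

text \<open>\<open>\<int>\<^sup>r\<close>, as the functions on \<^typ>\<open>nat\<close> vanishing outside \<open>{1..r}\<close>.\<close>

definition multidegrees :: "nat \<Rightarrow> (nat \<Rightarrow> int) set"
  where "multidegrees r = {d. \<forall>i. i \<notin> {1..r} \<longrightarrow> d i = 0}"

definition monom_degree :: "monom \<Rightarrow> nat \<Rightarrow> int"
  where "monom_degree m i = (\<Sum>v | v \<in> Poly_Mapping.keys m \<and> fst v = i. int (Poly_Mapping.lookup m v))"

definition hom_part :: "nat \<Rightarrow> (nat \<Rightarrow> nat) \<Rightarrow> (nat \<Rightarrow> int) \<Rightarrow> 'k::field cox_poly set"
  where "hom_part r n d =
    {p \<in> carrier (cox_ring r n). \<forall>m\<in>Poly_Mapping.keys p. monom_degree m = d}"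

definition homogeneous_ideal :: "nat \<Rightarrow> (nat \<Rightarrow> nat) \<Rightarrow> 'k::field cox_poly set \<Rightarrow> bool"
  where "homogeneous_ideal r n I \<longleftrightarrow>
    ideal I (cox_ring r n) \<and> genideal (cox_ring r n) (I \<inter> (\<Union>d. hom_part r n d)) = I"

definition irrelevant_ideal :: "nat \<Rightarrow> (nat \<Rightarrow> nat) \<Rightarrow> 'k::field cox_poly set"
  where "irrelevant_ideal r n = (\<Inter>i\<in>{1..r}. genideal (cox_ring r n) {var (i, j) | j. j \<le> n i})"

definition ideal_quotient :: "('a, 'm) ring_scheme \<Rightarrow> 'a set \<Rightarrow> 'a set \<Rightarrow> 'a set"
  where "ideal_quotient R I J = {a \<in> carrier R. \<forall>b\<in>J. a \<otimes>\<^bsub>R\<^esub> b \<in> I}"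

primrec ideal_power :: "('a, 'm) ring_scheme \<Rightarrow> 'a set \<Rightarrow> nat \<Rightarrow> 'a set"
  where
    "ideal_power R J 0 = carrier R"
  | "ideal_power R J (Suc k) = ideal_prod R (ideal_power R J k) J"

definition saturation :: "('a, 'm) ring_scheme \<Rightarrow> 'a set \<Rightarrow> 'a set \<Rightarrow> 'a set"
  where "saturation R I J = (\<Union>k\<in>{0<..}. ideal_quotient R I (ideal_power R J k))"


section \<open>The product of projective spaces as a topological space\<close>

text \<open>
  The product of projective spaces, as a scheme, is presented as the multigraded Proj of its Cox ring: on the affine chart
  \<open>x\<^sub>1\<^sub>,\<^sub>j\<^sub>1 \<cdots> x\<^sub>r\<^sub>,\<^sub>j\<^sub>r \<noteq> 0\<close>, the localization of \<open>S\<close> is a Laurent polynomial ring in \<open>r\<close> variables over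
  its degree-zero part, so the points of the chart are exactly the homogeneous primes of \<open>S\<close>
  containing none of these \<open>r\<close> variables.
\<close>

definition multiproj :: "nat \<Rightarrow> (nat \<Rightarrow> nat) \<Rightarrow> 'k::field cox_poly set set"
  where "multiproj r n =
    {P. primeideal P (cox_ring r n) \<and> homogeneous_ideal r n P \<and> \<not> irrelevant_ideal r n \<subseteq> P}"

definition zariski :: "nat \<Rightarrow> (nat \<Rightarrow> nat) \<Rightarrow> 'k::field cox_poly set topology"
  where "zariski r n =
    topology_generated_by {{P \<in> multiproj r n. f \<notin> P} | f. \<exists>d. f \<in> hom_part r n d}"

definition vanishing_locus :: "nat \<Rightarrow> (nat \<Rightarrow> nat) \<Rightarrow> 'k::field cox_poly set \<Rightarrow> 'k cox_poly set set"
  where "vanishing_locus r n I = {P \<in> multiproj r n. I \<subseteq> P}"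

definition irreducible_closedin :: "'a topology \<Rightarrow> 'a set \<Rightarrow> bool"
  where "irreducible_closedin T Z \<longleftrightarrow> closedin T Z \<and> Z \<noteq> {} \<and>
    (\<forall>A B. closedin T A \<longrightarrow> closedin T B \<longrightarrow> Z \<subseteq> A \<union> B \<longrightarrow> Z \<subseteq> A \<or> Z \<subseteq> B)"

text \<open>Krull dimension; the empty space has dimension \<open>-\<infinity>\<close>.\<close>

definition krull_dim :: "'a topology \<Rightarrow> ereal"
  where "krull_dim T = Sup {ereal (real k) | k. \<exists>Z :: nat \<Rightarrow> 'a set.
    (\<forall>i\<le>k. irreducible_closedin T (Z i)) \<and> (\<forall>i<k. Z i \<subset> Z (Suc i))}"

definition codim :: "nat \<Rightarrow> (nat \<Rightarrow> nat) \<Rightarrow> 'k::field cox_poly set \<Rightarrow> ereal"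
  where "codim r n I =
    ereal (real (\<Sum>i=1..r. n i)) - krull_dim (subtopology (zariski r n) (vanishing_locus r n I))"


section \<open>Graded modules\<close>

text \<open>
  As usual for \<^typ>\<open>('a, 'b) module\<close>, the fields \<^const>\<open>mult\<close> and \<^const>\<open>one\<close> of a module carry no
  information. The \<open>d\<close>-th graded piece of \<open>M\<close> is \<open>grade M d\<close>.
\<close>

record ('a, 'b) gmodule = "('a, 'b) module" +
  grade :: "(nat \<Rightarrow> int) \<Rightarrow> 'b set"

definition ring_gmodule :: "nat \<Rightarrow> (nat \<Rightarrow> nat) \<Rightarrow> ('k::field cox_poly, 'k cox_poly) gmodule"
  where "ring_gmodule r n =
    \<lparr>carrier = carrier (cox_ring r n), mult = (*), one = 1, zero = 0, add = (+),
     smult = (*), grade = hom_part r n\<rparr>"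

definition quotient_gmodule ::
    "nat \<Rightarrow> (nat \<Rightarrow> nat) \<Rightarrow> 'k::field cox_poly set \<Rightarrow> ('k cox_poly, 'k cox_poly set) gmodule"
  where "quotient_gmodule r n I =
    (let S = cox_ring r n; Q = S Quot I in
      \<lparr>carrier = carrier Q, mult = mult Q, one = one Q, zero = zero Q, add = add Q,
       smult = (\<lambda>a X. (I +>\<^bsub>S\<^esub> a) \<otimes>\<^bsub>Q\<^esub> X),
       grade = (\<lambda>d. (\<lambda>f. I +>\<^bsub>S\<^esub> f) ` hom_part r n d)\<rparr>)"

text \<open>
  For \<open>a = [a\<^sub>0, \<dots>, a\<^sub>t\<^sub>-\<^sub>1]\<close>, the free module \<open>S(-a\<^sub>0) \<oplus> \<dots> \<oplus> S(-a\<^sub>t\<^sub>-\<^sub>1)\<close>, whose \<open>j\<close>-th basis vector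
  has degree \<open>a\<^sub>j\<close>. Up to degree-preserving isomorphism these are all the finitely generated graded
  free \<open>S\<close>-modules.
\<close>

definition free_gmodule ::
    "nat \<Rightarrow> (nat \<Rightarrow> nat) \<Rightarrow> (nat \<Rightarrow> int) list \<Rightarrow> ('k::field cox_poly, nat \<Rightarrow> 'k cox_poly) gmodule"
  where "free_gmodule r n a =
    (let C = {v. (\<forall>j<length a. v j \<in> carrier (cox_ring r n)) \<and> (\<forall>j\<ge>length a. v j = 0)} in
      \<lparr>carrier = C, mult = undefined, one = undefined, zero = (\<lambda>j. 0), add = (\<lambda>v w j. v j + w j),
       smult = (\<lambda>p v j. p * v j),
       grade = (\<lambda>d. {v \<in> C. \<forall>j<length a. v j \<in> hom_part r n (\<lambda>i. d i - (a ! j) i)})\<rparr>)"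

definition graded_hom ::
    "nat \<Rightarrow> (nat \<Rightarrow> nat) \<Rightarrow> ('k::field cox_poly, 'b) gmodule \<Rightarrow> ('k cox_poly, 'c) gmodule \<Rightarrow> ('b \<Rightarrow> 'c) set"
  where "graded_hom r n M N =
    {h \<in> carrier M \<rightarrow> carrier N.
      (\<forall>x\<in>carrier M. \<forall>y\<in>carrier M. h (x \<oplus>\<^bsub>M\<^esub> y) = h x \<oplus>\<^bsub>N\<^esub> h y) \<and>
      (\<forall>p\<in>carrier (cox_ring r n). \<forall>x\<in>carrier M. h (p \<odot>\<^bsub>M\<^esub> x) = p \<odot>\<^bsub>N\<^esub> h x) \<and>
      (\<forall>d\<in>multidegrees r. h ` grade M d \<subseteq> grade N d)}"


section \<open>The sheaf associated with a graded module\<close>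

text \<open>
  The stalk of \<open>M\<^sup>~\<close> at \<open>P\<close> is the homogeneous localization \<open>M\<^sub>(\<^sub>P\<^sub>)\<close>, the degree-zero part of the
  localization of \<open>M\<close> at the homogeneous elements outside \<open>P\<close>. A fraction \<open>m/f\<close> is represented by
  its equivalence class of pairs \<open>(m', f')\<close>.
\<close>

definition fraction ::
    "nat \<Rightarrow> (nat \<Rightarrow> nat) \<Rightarrow> ('k::field cox_poly, 'b) gmodule \<Rightarrow> 'k cox_poly set \<Rightarrow> 'b \<Rightarrow> 'k cox_poly
      \<Rightarrow> ('b \<times> 'k cox_poly) set"
  where "fraction r n M P m f =
    {(m', f'). \<exists>d\<in>multidegrees r. m' \<in> grade M d \<and> f' \<in> hom_part r n d - P \<and>
      (\<exists>e\<in>multidegrees r. \<exists>u\<in>hom_part r n e - P. u \<odot>\<^bsub>M\<^esub> (f' \<odot>\<^bsub>M\<^esub> m) = u \<odot>\<^bsub>M\<^esub> (f \<odot>\<^bsub>M\<^esub> m'))}"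

definition stalk ::
    "nat \<Rightarrow> (nat \<Rightarrow> nat) \<Rightarrow> ('k::field cox_poly, 'b) gmodule \<Rightarrow> 'k cox_poly set \<Rightarrow> ('b \<times> 'k cox_poly) set set"
  where "stalk r n M P =
    {fraction r n M P m f | m f. \<exists>d\<in>multidegrees r. m \<in> grade M d \<and> f \<in> hom_part r n d - P}"

definition stalk_add ::
    "nat \<Rightarrow> (nat \<Rightarrow> nat) \<Rightarrow> ('k::field cox_poly, 'b) gmodule \<Rightarrow> 'k cox_poly set
      \<Rightarrow> ('b \<times> 'k cox_poly) set \<Rightarrow> ('b \<times> 'k cox_poly) set \<Rightarrow> ('b \<times> 'k cox_poly) set"
  where "stalk_add r n M P A B =
    (\<Union>(m, f)\<in>A. \<Union>(m', f')\<in>B. fraction r n M P ((f' \<odot>\<^bsub>M\<^esub> m) \<oplus>\<^bsub>M\<^esub> (f \<odot>\<^bsub>M\<^esub> m')) (f * f'))"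

definition stalk_smult ::
    "nat \<Rightarrow> (nat \<Rightarrow> nat) \<Rightarrow> ('k::field cox_poly, 'b) gmodule \<Rightarrow> 'k cox_poly set
      \<Rightarrow> ('k cox_poly \<times> 'k cox_poly) set \<Rightarrow> ('b \<times> 'k cox_poly) set \<Rightarrow> ('b \<times> 'k cox_poly) set"
  where "stalk_smult r n M P A B = (\<Union>(p, g)\<in>A. \<Union>(m, f)\<in>B. fraction r n M P (p \<odot>\<^bsub>M\<^esub> m) (g * f))"

text \<open>
  Sections of \<open>M\<^sup>~\<close> over \<open>U\<close>: families of germs that are locally given by a single fraction. All
  sections are functions restricted to \<open>U\<close> in the sense of \<^const>\<open>extensional\<close>.
\<close>

type_synonym ('k, 'b) sheaf_section = "'k cox_poly set \<Rightarrow> ('b \<times> 'k cox_poly) set"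

definition sections ::
    "nat \<Rightarrow> (nat \<Rightarrow> nat) \<Rightarrow> ('k::field cox_poly, 'b) gmodule \<Rightarrow> 'k cox_poly set set
      \<Rightarrow> ('k, 'b) sheaf_section set"
  where "sections r n M U =
    {s \<in> (\<Pi>\<^sub>E P\<in>U. stalk r n M P). \<forall>P\<in>U. \<exists>V. openin (zariski r n) V \<and> P \<in> V \<and> V \<subseteq> U \<and>
      (\<exists>d\<in>multidegrees r. \<exists>m\<in>grade M d. \<exists>f\<in>hom_part r n d.
        \<forall>Q\<in>V. f \<notin> Q \<and> s Q = fraction r n M Q m f)}"

definition zero_section ::
    "nat \<Rightarrow> (nat \<Rightarrow> nat) \<Rightarrow> ('k::field cox_poly, 'b) gmodule \<Rightarrow> 'k cox_poly set set
      \<Rightarrow> ('k, 'b) sheaf_section"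
  where "zero_section r n M U = (\<lambda>P\<in>U. fraction r n M P \<zero>\<^bsub>M\<^esub> 1)"

text \<open>
  A morphism of sheaves is given by its components on the open sets. The structure sheaf is the
  sheaf of \<^const>\<open>ring_gmodule\<close>, and linearity is over its sections.
\<close>

type_synonym ('k, 'b, 'c) sheaf_map =
  "'k cox_poly set set \<Rightarrow> ('k, 'b) sheaf_section \<Rightarrow> ('k, 'c) sheaf_section"

definition sheaf_hom ::
    "nat \<Rightarrow> (nat \<Rightarrow> nat) \<Rightarrow> ('k::field cox_poly, 'b) gmodule \<Rightarrow> ('k cox_poly, 'c) gmodule
      \<Rightarrow> ('k, 'b, 'c) sheaf_map set"
  where "sheaf_hom r n M N =
    {\<phi>. \<forall>U. openin (zariski r n) U \<longrightarrow>
      \<phi> U \<in> sections r n M U \<rightarrow> sections r n N U \<and>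
      (\<forall>s\<in>sections r n M U. \<forall>t\<in>sections r n M U.
        \<phi> U (\<lambda>P\<in>U. stalk_add r n M P (s P) (t P)) = (\<lambda>P\<in>U. stalk_add r n N P (\<phi> U s P) (\<phi> U t P))) \<and>
      (\<forall>a\<in>sections r n (ring_gmodule r n) U. \<forall>s\<in>sections r n M U.
        \<phi> U (\<lambda>P\<in>U. stalk_smult r n M P (a P) (s P)) = (\<lambda>P\<in>U. stalk_smult r n N P (a P) (\<phi> U s P))) \<and>
      (\<forall>V. openin (zariski r n) V \<longrightarrow> V \<subseteq> U \<longrightarrow>
        (\<forall>s\<in>sections r n M U. \<phi> V (restrict s V) = restrict (\<phi> U s) V))}"

text \<open>The morphism \<open>M\<^sup>~ \<rightarrow> N\<^sup>~\<close>, \<open>m/f \<mapsto> h(m)/f\<close>, associated with a degree-preserving map \<open>h\<close>.\<close>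

definition induced_map ::
    "nat \<Rightarrow> (nat \<Rightarrow> nat) \<Rightarrow> ('k::field cox_poly, 'c) gmodule \<Rightarrow> ('b \<Rightarrow> 'c) \<Rightarrow> ('k, 'b, 'c) sheaf_map"
  where "induced_map r n N h = (\<lambda>U s. \<lambda>P\<in>U. \<Union>(m, f)\<in>s P. fraction r n N P (h m) f)"

definition in_sheaf_image ::
    "nat \<Rightarrow> (nat \<Rightarrow> nat) \<Rightarrow> ('k::field cox_poly, 'b) gmodule \<Rightarrow> ('k, 'b, 'c) sheaf_map
      \<Rightarrow> 'k cox_poly set set \<Rightarrow> ('k, 'c) sheaf_section \<Rightarrow> bool"
  where "in_sheaf_image r n M \<phi> U t \<longleftrightarrow>
    (\<forall>P\<in>U. \<exists>V. openin (zariski r n) V \<and> P \<in> V \<and> V \<subseteq> U \<and>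
      (\<exists>s\<in>sections r n M V. \<phi> V s = restrict t V))"

text \<open>Exactness of \<open>M\<^sup>~ \<rightarrow> N\<^sup>~ \<rightarrow> L\<^sup>~\<close> at \<open>N\<^sup>~\<close>: the image sheaf equals the kernel sheaf.\<close>

definition sheaf_exact ::
    "nat \<Rightarrow> (nat \<Rightarrow> nat) \<Rightarrow> ('k::field cox_poly, 'b) gmodule \<Rightarrow> ('k cox_poly, 'c) gmodule
      \<Rightarrow> ('k cox_poly, 'd) gmodule \<Rightarrow> ('k, 'b, 'c) sheaf_map \<Rightarrow> ('k, 'c, 'd) sheaf_map \<Rightarrow> bool"
  where "sheaf_exact r n M N L \<phi> \<psi> \<longleftrightarrow>
    (\<forall>U. openin (zariski r n) U \<longrightarrow>
      (\<forall>t\<in>sections r n N U. in_sheaf_image r n M \<phi> U t \<longleftrightarrow> \<psi> U t = zero_section r n L U))"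

definition sheaf_surjective ::
    "nat \<Rightarrow> (nat \<Rightarrow> nat) \<Rightarrow> ('k::field cox_poly, 'b) gmodule \<Rightarrow> ('k cox_poly, 'c) gmodule
      \<Rightarrow> ('k, 'b, 'c) sheaf_map \<Rightarrow> bool"
  where "sheaf_surjective r n M N \<phi> \<longleftrightarrow>
    (\<forall>U. openin (zariski r n) U \<longrightarrow> (\<forall>t\<in>sections r n N U. in_sheaf_image r n M \<phi> U t))"


section \<open>Virtual resolutions\<close>

text \<open>
  The complex \<open>F\<^sub>0 \<leftarrow> F\<^sub>1 \<leftarrow> \<dots> \<leftarrow> F\<^sub>k \<leftarrow> 0\<close> is given by the lists \<open>a i\<close> of degrees of the generators of
  \<open>F\<^sub>i\<close>, empty for \<open>i > k\<close>, and by the maps \<open>h i :: F\<^sub>i\<^sub>+\<^sub>1 \<rightarrow> F\<^sub>i\<close>. The augmentation \<open>\<epsilon>\<close> is only required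
  to be a morphism of sheaves; it need not come from a map of modules \<open>F\<^sub>0 \<rightarrow> S/I\<close>. Since
  \<open>F\<^sub>k\<^sub>+\<^sub>1 = 0\<close>, exactness at \<open>F\<^sub>k\<^sup>~\<close> includes injectivity.
\<close>

definition virtual_resolution ::
    "nat \<Rightarrow> (nat \<Rightarrow> nat) \<Rightarrow> 'k::field cox_poly set \<Rightarrow> nat \<Rightarrow> (nat \<Rightarrow> (nat \<Rightarrow> int) list)
      \<Rightarrow> (nat \<Rightarrow> (nat \<Rightarrow> 'k cox_poly) \<Rightarrow> (nat \<Rightarrow> 'k cox_poly)) \<Rightarrow> bool"
  where "virtual_resolution r n I k a h \<longleftrightarrow>
    (let F = (\<lambda>i. free_gmodule r n (a i)) in
      (\<forall>i. set (a i) \<subseteq> multidegrees r) \<and> (\<forall>i>k. a i = []) \<and>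
      (\<forall>i. h i \<in> graded_hom r n (F (Suc i)) (F i)) \<and>
      (\<forall>i. \<forall>x\<in>carrier (F (Suc (Suc i))). h i (h (Suc i) x) = \<zero>\<^bsub>F i\<^esub>) \<and>
      (\<forall>i. sheaf_exact r n (F (Suc (Suc i))) (F (Suc i)) (F i)
        (induced_map r n (F (Suc i)) (h (Suc i))) (induced_map r n (F i) (h i))) \<and>
      (\<exists>\<epsilon>\<in>sheaf_hom r n (F 0) (quotient_gmodule r n I).
        sheaf_exact r n (F 1) (F 0) (quotient_gmodule r n I) (induced_map r n (F 0) (h 0)) \<epsilon> \<and>
        sheaf_surjective r n (F 0) (quotient_gmodule r n I) \<epsilon>))"


section \<open>Simplicial complexes\<close>

definition simplicial_complex :: "'v set \<Rightarrow> 'v set set \<Rightarrow> bool"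
  where "simplicial_complex X \<Delta> \<longleftrightarrow>
    \<Delta> \<noteq> {} \<and> \<Delta> \<subseteq> Pow X \<and> (\<forall>A\<in>\<Delta>. \<forall>A'. A' \<subseteq> A \<longrightarrow> A' \<in> \<Delta>)"

definition facets :: "'v set set \<Rightarrow> 'v set set"
  where "facets \<Delta> = {A \<in> \<Delta>. \<forall>A'\<in>\<Delta>. A \<subseteq> A' \<longrightarrow> A' = A}"

definition face_dim :: "'v set \<Rightarrow> int"
  where "face_dim A = int (card A) - 1"

definition pure_complex :: "'v set set \<Rightarrow> bool"
  where "pure_complex \<Delta> \<longleftrightarrow> (\<forall>A\<in>facets \<Delta>. \<forall>A'\<in>facets \<Delta>. face_dim A = face_dim A')"

definition balanced_complex :: "nat \<Rightarrow> (nat \<times> nat) set set \<Rightarrow> bool"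
  where "balanced_complex r \<Delta> \<longleftrightarrow> (\<forall>A\<in>facets \<Delta>. \<forall>i\<in>{1..r}. \<exists>!j. (i, j) \<in> A)"

definition stanley_reisner_ideal ::
    "nat \<Rightarrow> (nat \<Rightarrow> nat) \<Rightarrow> (nat \<times> nat) set set \<Rightarrow> 'k::field cox_poly set"
  where "stanley_reisner_ideal r n \<Delta> =
    genideal (cox_ring r n) {\<Prod>v\<in>A. var v | A. A \<subseteq> vertices r n \<and> A \<notin> \<Delta>}"

definition B_saturated :: "'k::field itself \<Rightarrow> nat \<Rightarrow> (nat \<Rightarrow> nat) \<Rightarrow> (nat \<times> nat) set set \<Rightarrow> bool"
  where "B_saturated k r n \<Delta> \<longleftrightarrow>
    (let I = stanley_reisner_ideal r n \<Delta> :: 'k cox_poly set in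
      saturation (cox_ring r n) I (irrelevant_ideal r n) = I)"

definition virtually_Cohen_Macaulay ::
    "'k::field itself \<Rightarrow> nat \<Rightarrow> (nat \<Rightarrow> nat) \<Rightarrow> (nat \<times> nat) set set \<Rightarrow> bool"
  where "virtually_Cohen_Macaulay k r n \<Delta> \<longleftrightarrow> B_saturated k r n \<Delta> \<and>
    (let I = stanley_reisner_ideal r n \<Delta> :: 'k cox_poly set in
      \<exists>l a h. ereal (real l) = codim r n I \<and> virtual_resolution r n I l a h)"

end

theory Submission
  imports Defs "HOL-Library.Product_Lexorder"
begin

text \<open>
  Let \<open>I\<close> be the Stanley--Reisner ideal and write \<open>x\<^sup>A\<close> for the product of the variables in \<open>A\<close>.
  Every facet \<open>F\<close> has one vertex in each component, so the linear space that \<open>F\<close> defines is a single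
  torus-fixed point, with prime ideal \<open>P\<^sub>F\<close> generated by the variables outside \<open>F\<close>. Hence the
  vanishing locus of \<open>I\<close> is a finite discrete set of points (\<open>vanishing_locus_eq\<close>), the codimension
  is \<open>n\<^sub>1 + \<cdots> + n\<^sub>r\<close> (\<open>codim_nonface_ideal\<close>), and a virtual resolution of that length is required.

  As the structure sheaf of these points is the direct sum of their residue sheaves, one expects the
  direct sum of the Koszul resolutions of the \<open>S/P\<^sub>F\<close> to do. Each of them has length
  \<open>n\<^sub>1 + \<cdots> + n\<^sub>r\<close>, the number of variables outside \<open>F\<close>. To obtain the augmentation from a map of
  modules, the summand of \<open>F\<close> is twisted by the degree of \<open>x\<^sup>F\<close> and its generator is sent to \<open>x\<^sup>F\<close>.
  In \<open>S/I\<close> the annihilator of \<open>x\<^sup>F\<close> is \<open>P\<^sub>F\<close>, and multiples of \<open>x\<^sup>F\<close> and \<open>x\<^sup>G\<close> for different facets share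
  no monomials. So \<open>\<Oplus>\<^sub>F S/P\<^sub>F\<close> embeds into \<open>S/I\<close>, and the twisted sum of Koszul complexes resolves its
  image as a module. The cokernel is killed by all \<open>x\<^sup>G\<close> with \<open>G\<close> a transversal of the components,
  because such a \<open>G\<close> is a facet or a non-face. One of these monomials is nonzero at each point, so the
  sheaf of the cokernel is zero. This is \<open>virtual_resolution_nonface_ideal\<close>.

  Three general facts support the argument. The Stanley--Reisner ideal is described by the supports
  of monomials (\<open>stanley_reisner_ideal_eq\<close>), which also gives saturation. Graded maps that are exact in
  every degree, or surjective up to multiplication by elements not vanishing at a given point, induce
  exact and surjective maps of sheaves (\<open>sheaf_exact_induced_map\<close>, \<open>sheaf_surjective_induced_map\<close>).
  And the Koszul complex of variables is contracted by an explicit homotopy on coefficients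
  (\<open>koszul_d_koszul_lift\<close>).
\<close>

abbreviation lookup :: "('a \<Rightarrow>\<^sub>0 'b::zero) \<Rightarrow> 'a \<Rightarrow> 'b" where "lookup \<equiv> Poly_Mapping.lookup"
abbreviation keys :: "('a \<Rightarrow>\<^sub>0 'b::zero) \<Rightarrow> 'a set" where "keys \<equiv> Poly_Mapping.keys"
abbreviation single :: "'a \<Rightarrow> 'b::zero \<Rightarrow> 'a \<Rightarrow>\<^sub>0 'b" where "single \<equiv> Poly_Mapping.single"

section \<open>Monomials and their multidegrees\<close>

lemma keys_monom_add: "keys (m + m' :: monom) = keys m \<union> keys m'"
  by (auto simp: in_keys_iff lookup_add)

lemma monom_degree_eq_sum:
  assumes "finite A" "keys m \<subseteq> A"
  shows "monom_degree m i = (\<Sum>v | v \<in> A \<and> fst v = i. int (lookup m v))"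
  unfolding monom_degree_def
  by (rule sum.mono_neutral_left) (use assms in \<open>auto simp: in_keys_iff\<close>)

lemma monom_degree_add: "monom_degree (m + m') = (\<lambda>i. monom_degree m i + monom_degree m' i)"
proof
  fix i
  let ?A = "keys m \<union> keys m'"
  have "monom_degree k i = (\<Sum>v | v \<in> ?A \<and> fst v = i. int (lookup k v))"
    if "k \<in> {m, m', m + m'}" for k
    using that by (intro monom_degree_eq_sum) (auto simp: keys_monom_add)
  then show "monom_degree (m + m') i = monom_degree m i + monom_degree m' i"
    by (simp add: lookup_add sum.distrib)
qed

lemma monom_degree_zero [simp]: "monom_degree 0 = (\<lambda>i. 0)"
  by (auto simp: monom_degree_def)

lemma monom_degree_in_multidegrees:
  assumes "keys m \<subseteq> vertices r n"
  shows "monom_degree m \<in> multidegrees r"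
proof -
  have no_var: "{v. v \<in> keys m \<and> fst v = i} = {}" if "i \<notin> {1..r}" for i
    using assms that by (auto simp: vertices_def)
  have "monom_degree m i = 0" if "i \<notin> {1..r}" for i
    unfolding monom_degree_def no_var[OF that] by simp
  then show ?thesis
    by (auto simp: multidegrees_def)
qed

lemma multidegrees_add:
  "d \<in> multidegrees r \<Longrightarrow> e \<in> multidegrees r \<Longrightarrow> (\<lambda>i. d i + e i) \<in> multidegrees r"
  by (auto simp: multidegrees_def)

lemma multidegrees_zero [simp]: "(\<lambda>i. 0) \<in> multidegrees r"
  by (auto simp: multidegrees_def)

lemma finite_vertices [simp]: "finite (vertices r n)"
  by (auto simp: vertices_def)

definition sqfree_monom :: "(nat \<times> nat) set \<Rightarrow> monom"
  where "sqfree_monom A = (\<Sum>v\<in>A. single v 1)"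

lemma lookup_sqfree_monom:
  "finite A \<Longrightarrow> lookup (sqfree_monom A) v = (if v \<in> A then 1 else 0)"
  by (auto simp: sqfree_monom_def lookup_sum lookup_single when_def)

lemma keys_sqfree_monom [simp]: "finite A \<Longrightarrow> keys (sqfree_monom A) = A"
  by (auto simp: in_keys_iff lookup_sqfree_monom split: if_splits)

lemma sqfree_monom_insert:
  "finite A \<Longrightarrow> v \<notin> A \<Longrightarrow> sqfree_monom (insert v A) = single v 1 + sqfree_monom A"
  by (simp add: sqfree_monom_def)

lemma monom_diff_add:
  "(\<And>v. lookup m v \<le> lookup k v) \<Longrightarrow> m + (k - m) = (k :: monom)"
  by (intro poly_mapping_eqI) (simp add: lookup_add lookup_minus)


section \<open>Coefficients of polynomials\<close>

lemma lookup_mult_nonzero: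
  assumes "lookup (p * q) k \<noteq> 0"
  obtains m m' where "k = m + m'" "lookup p m \<noteq> 0" "lookup q m' \<noteq> 0"
proof -
  have "k \<in> keys (p * q)"
    using assms by (simp add: in_keys_iff)
  then show ?thesis
    using keys_mult[of p q] that unfolding in_keys_iff[symmetric] by blast
qed

lemma lookup_add_nonzero:
  "lookup (p + q) k \<noteq> 0 \<Longrightarrow> lookup p k \<noteq> 0 \<or> lookup q k \<noteq> (0::'b::monoid_add)"
  by (auto simp: lookup_add)

lemma lookup_single_mult:
  fixes p :: "monom \<Rightarrow>\<^sub>0 'k::semiring_0"
  shows "lookup (single m c * p) k =
    (if \<forall>v. lookup m v \<le> lookup k v then c * lookup p (k - m) else 0)"
proof -
  have *: "lookup (single m c * p) k = c * (Sum_any (\<lambda>q. lookup p q when k = m + q))"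
    by (simp add: lookup_mult lookup_single when_mult)
  show ?thesis
  proof (cases "\<forall>v. lookup m v \<le> lookup k v")
    case True
    then have "k = m + q \<longleftrightarrow> q = k - m" for q
      using monom_diff_add[of m k] by auto
    with True show ?thesis
      by (simp add: *)
  next
    case False
    then have "k \<noteq> m + q" for q
      by (auto simp: lookup_add)
    then have "lookup (single m c * p) k = 0"
      by (simp add: *)
    with False show ?thesis
      by argo
  qed
qed

lemma lookup_single_mult_add [simp]:
  fixes p :: "monom \<Rightarrow>\<^sub>0 'k::semiring_0"
  shows "lookup (single m c * p) (m + k) = c * lookup p k"
  by (simp add: lookup_single_mult lookup_add)

lemma sum_single_lookup: "(\<Sum>m\<in>keys p. single m (lookup p m)) = p"
proof (rule poly_mapping_eqI)
  fix k
  show "lookup (\<Sum>m\<in>keys p. single m (lookup p m)) k = lookup p k"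
    by (cases "k \<in> keys p") (auto simp: lookup_sum lookup_single when_def not_in_keys_iff_lookup_eq_zero)
qed

lemma prod_var: "finite A \<Longrightarrow> (\<Prod>v\<in>A. var v) = single (sqfree_monom A) 1"
proof (induction A rule: finite_induct)
  case empty
  then show ?case
    by (simp add: sqfree_monom_def)
next
  case (insert v A)
  then show ?case
    by (simp add: sqfree_monom_insert mult_single var_def)
qed


section \<open>The Cox ring\<close>

lemma cox_ring_simps [simp]:
  "mult (cox_ring r n) = (*)" "add (cox_ring r n) = (+)"
  "one (cox_ring r n) = 1" "zero (cox_ring r n) = 0"
  by (auto simp: cox_ring_def)

lemma cox_carrier_iff:
  "p \<in> carrier (cox_ring r n) \<longleftrightarrow> (\<forall>m. lookup p m \<noteq> 0 \<longrightarrow> keys m \<subseteq> vertices r n)"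
  by (simp add: cox_ring_def poly_vars_def UN_subset_iff Ball_def) (simp only: in_keys_iff)

lemma hom_part_iff:
  "p \<in> hom_part r n d \<longleftrightarrow>
    (\<forall>m. lookup p m \<noteq> 0 \<longrightarrow> keys m \<subseteq> vertices r n \<and> monom_degree m = d)"
  by (auto simp: hom_part_def cox_carrier_iff in_keys_iff)

lemma hom_part_carrier: "p \<in> hom_part r n d \<Longrightarrow> p \<in> carrier (cox_ring r n)"
  by (simp add: hom_part_def)

lemma cox_mult_closed:
  "p \<in> carrier (cox_ring r n) \<Longrightarrow> q \<in> carrier (cox_ring r n) \<Longrightarrow> p * q \<in> carrier (cox_ring r n)"
  unfolding cox_carrier_iff by (fastforce elim!: lookup_mult_nonzero simp: keys_monom_add)

lemma cox_add_closed:
  "p \<in> carrier (cox_ring r n) \<Longrightarrow> q \<in> carrier (cox_ring r n) \<Longrightarrow> p + q \<in> carrier (cox_ring r n)"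
  unfolding cox_carrier_iff by (blast dest: lookup_add_nonzero)

lemma cox_uminus_closed: "p \<in> carrier (cox_ring r n) \<Longrightarrow> - p \<in> carrier (cox_ring r n)"
  by (auto simp: cox_carrier_iff)

lemma cox_zero_closed: "0 \<in> carrier (cox_ring r n)"
  by (auto simp: cox_carrier_iff)

lemma cox_one_closed: "1 \<in> carrier (cox_ring r n)"
  by (auto simp: cox_carrier_iff lookup_one)

lemma cox_sum_closed:
  "(\<And>x. x \<in> A \<Longrightarrow> f x \<in> carrier (cox_ring r n)) \<Longrightarrow> sum f A \<in> carrier (cox_ring r n)"
  by (induction A rule: infinite_finite_induct) (auto intro: cox_add_closed cox_zero_closed)

lemma single_in_carrier: "keys m \<subseteq> vertices r n \<Longrightarrow> single m c \<in> carrier (cox_ring r n)"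
  by (auto simp: cox_carrier_iff lookup_single when_def)

lemma var_in_carrier: "v \<in> vertices r n \<Longrightarrow> var v \<in> carrier (cox_ring r n)"
  unfolding var_def by (rule single_in_carrier) auto

lemma cring_cox_ring: "cring (cox_ring r n)"
proof (rule cringI)
  show "abelian_group (cox_ring r n)"
  proof (rule abelian_groupI)
    show "\<exists>y\<in>carrier (cox_ring r n). y \<oplus>\<^bsub>cox_ring r n\<^esub> x = \<zero>\<^bsub>cox_ring r n\<^esub>"
      if "x \<in> carrier (cox_ring r n)" for x
      using cox_uminus_closed[OF that] by (intro bexI[of _ "- x"]) auto
  qed (auto simp: cox_add_closed cox_zero_closed add_ac)
  show "comm_monoid (cox_ring r n)"
    by unfold_locales (auto simp: cox_mult_closed cox_one_closed mult_ac)
qed (auto simp: distrib_right)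

interpretation cox: cring "cox_ring r n"
  by (rule cring_cox_ring)

lemma cox_a_inv: "p \<in> carrier (cox_ring r n) \<Longrightarrow> \<ominus>\<^bsub>cox_ring r n\<^esub> p = - p"
  by (rule cox.minus_equality) (auto intro: cox_uminus_closed)

lemma hom_part_zero [simp]: "0 \<in> hom_part r n d"
  by (auto simp: hom_part_iff)

lemma hom_part_one [simp]: "1 \<in> hom_part r n (\<lambda>i. 0)"
  by (auto simp: hom_part_iff lookup_one)

lemma hom_part_add: "p \<in> hom_part r n d \<Longrightarrow> q \<in> hom_part r n d \<Longrightarrow> p + q \<in> hom_part r n d"
  unfolding hom_part_iff by (blast dest: lookup_add_nonzero)

lemma hom_part_mult:
  assumes "p \<in> hom_part r n d" "q \<in> hom_part r n e"
  shows "p * q \<in> hom_part r n (\<lambda>i. d i + e i)"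
  unfolding hom_part_iff
proof (intro allI impI)
  fix k assume "lookup (p * q) k \<noteq> 0"
  then obtain m m' where "k = m + m'" "lookup p m \<noteq> 0" "lookup q m' \<noteq> 0"
    by (rule lookup_mult_nonzero)
  with assms show "keys k \<subseteq> vertices r n \<and> monom_degree k = (\<lambda>i. d i + e i)"
    by (auto simp: hom_part_iff keys_monom_add monom_degree_add)
qed

lemma hom_part_sum:
  "(\<And>x. x \<in> A \<Longrightarrow> f x \<in> hom_part r n d) \<Longrightarrow> sum f A \<in> hom_part r n d"
  by (induction A rule: infinite_finite_induct) (auto intro: hom_part_add)

lemma single_in_hom_part:
  "keys m \<subseteq> vertices r n \<Longrightarrow> single m c \<in> hom_part r n (monom_degree m)"
  by (auto simp: hom_part_iff lookup_single when_def)

lemma ideal_sum_closed: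
  assumes "ideal I (cox_ring r n)" "\<And>x. x \<in> A \<Longrightarrow> f x \<in> I"
  shows "sum f A \<in> I"
proof -
  interpret ideal I "cox_ring r n" by fact
  show ?thesis
    using assms(2)
    by (induction A rule: infinite_finite_induct) (use zero_closed a_closed in auto)
qed

lemma ideal_cox_ringI:
  assumes "I \<subseteq> carrier (cox_ring r n)" "0 \<in> I"
    and "\<And>p q. p \<in> I \<Longrightarrow> q \<in> I \<Longrightarrow> p + q \<in> I"
    and "\<And>p q. p \<in> I \<Longrightarrow> q \<in> carrier (cox_ring r n) \<Longrightarrow> q * p \<in> I"
  shows "ideal I (cox_ring r n)"
proof (rule idealI)
  show "ring (cox_ring r n)"
    by (rule cox.ring_axioms)
  have inv: "\<ominus>\<^bsub>cox_ring r n\<^esub> p \<in> I" if "p \<in> I" for p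
    using cox_a_inv[of p r n] assms(1) that assms(4)[OF that cox_uminus_closed[OF cox_one_closed]] by auto
  show "subgroup I (add_monoid (cox_ring r n))"
    using assms(1-3) inv[unfolded a_inv_def] by (intro subgroup.intro) auto
qed (use assms in \<open>auto simp: mult.commute\<close>)


section \<open>Stanley--Reisner ideals\<close>

text \<open>
  The Stanley--Reisner ideal as seen on coefficients: membership only depends on the supports of
  the monomials that occur. For the simplex \<open>\<Delta> = Pow F\<close> it is the prime ideal generated by the
  variables outside \<open>F\<close>.
\<close>

definition nonface_ideal :: "nat \<Rightarrow> (nat \<Rightarrow> nat) \<Rightarrow> (nat \<times> nat) set set \<Rightarrow> 'k::field cox_poly set"
  where "nonface_ideal r n \<Delta> =
    {p \<in> carrier (cox_ring r n). \<forall>m. lookup p m \<noteq> 0 \<longrightarrow> keys m \<notin> \<Delta>}"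

lemma ideal_nonface_ideal:
  assumes "\<And>A A'. A \<in> \<Delta> \<Longrightarrow> A' \<subseteq> A \<Longrightarrow> A' \<in> \<Delta>"
  shows "ideal (nonface_ideal r n \<Delta>) (cox_ring r n)"
proof (rule ideal_cox_ringI)
  show "p + q \<in> nonface_ideal r n \<Delta>" if "p \<in> nonface_ideal r n \<Delta>" "q \<in> nonface_ideal r n \<Delta>" for p q
    using that unfolding nonface_ideal_def by (blast intro: cox_add_closed dest: lookup_add_nonzero)
  show "q * p \<in> nonface_ideal r n \<Delta>"
    if "p \<in> nonface_ideal r n \<Delta>" "q \<in> carrier (cox_ring r n)" for p q
  proof -
    have "keys k \<notin> \<Delta>" if k: "lookup (q * p) k \<noteq> 0" for k
    proof -
      obtain m m' where "k = m + m'" "lookup q m \<noteq> 0" "lookup p m' \<noteq> 0"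
        using k by (rule lookup_mult_nonzero)
      with \<open>p \<in> _\<close> have "keys m' \<notin> \<Delta>" "keys m' \<subseteq> keys k"
        by (auto simp: nonface_ideal_def keys_monom_add)
      with assms show ?thesis
        by blast
    qed
    with that show ?thesis
      by (auto simp: nonface_ideal_def intro: cox_mult_closed)
  qed
qed (auto simp: nonface_ideal_def cox_zero_closed)

lemma nonface_ideal_antimono: "\<Delta>' \<subseteq> \<Delta>'' \<Longrightarrow> nonface_ideal r n \<Delta>'' \<subseteq> nonface_ideal r n \<Delta>'"
  by (auto simp: nonface_ideal_def)

text \<open>
  A monomial whose support \<open>A\<close> is a non-face is a multiple of the generator \<open>\<Prod>v\<in>A. x\<^sub>v\<close>; conversely a
  multiple of a generator only involves monomials whose support contains a non-face.
\<close>

lemma stanley_reisner_ideal_eq: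
  assumes "\<And>A A'. A \<in> \<Delta> \<Longrightarrow> A' \<subseteq> A \<Longrightarrow> A' \<in> \<Delta>"
  shows "stanley_reisner_ideal r n \<Delta> = (nonface_ideal r n \<Delta> :: 'k::field cox_poly set)"
    (is "?I = ?N")
proof
  let ?G = "{\<Prod>v\<in>A. var v | A. A \<subseteq> vertices r n \<and> A \<notin> \<Delta>} :: 'k cox_poly set"
  have fin: "finite A" if "A \<subseteq> vertices r n" for A
    using that finite_subset finite_vertices by blast
  have G: "?G \<subseteq> ?N"
  proof
    fix p :: "'k cox_poly" assume "p \<in> ?G"
    then obtain A where A: "A \<subseteq> vertices r n" "A \<notin> \<Delta>" "p = (\<Prod>v\<in>A. var v)"
      by blast
    then have p: "p = single (sqfree_monom A) 1"
      using prod_var fin by blast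
    show "p \<in> ?N"
      using A(1,2) fin[OF A(1)] by (auto simp: p nonface_ideal_def cox_carrier_iff lookup_single when_def)
  qed
  show "?I \<subseteq> ?N"
    unfolding stanley_reisner_ideal_def
    by (rule cox.genideal_minimal[OF ideal_nonface_ideal G]) (use assms in blast)
  show "?N \<subseteq> ?I"
  proof
    fix p :: "'k cox_poly" assume p: "p \<in> ?N"
    have GC: "?G \<subseteq> carrier (cox_ring r n)"
      using G by (auto simp: nonface_ideal_def)
    have I: "ideal ?I (cox_ring r n)"
      unfolding stanley_reisner_ideal_def by (rule cox.genideal_ideal[OF GC])
    interpret I: ideal ?I "cox_ring r n" by (fact I)
    have "single m (lookup p m) \<in> ?I" if "m \<in> keys p" for m
    proof -
      let ?A = "keys m"
      have A: "?A \<subseteq> vertices r n" "?A \<notin> \<Delta>"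
        using that p by (auto simp: nonface_ideal_def cox_carrier_iff in_keys_iff)
      have le: "lookup (sqfree_monom ?A) v \<le> lookup m v" for v
        by (auto simp: lookup_sqfree_monom in_keys_iff)
      have "single m (lookup p m) = single (m - sqfree_monom ?A) (lookup p m) * (\<Prod>v\<in>?A. var v)"
        using monom_diff_add[OF le] by (simp add: prod_var mult_single add.commute)
      moreover have "(\<Prod>v\<in>?A. var v) \<in> ?I"
        unfolding stanley_reisner_ideal_def using cox.genideal_self[OF GC] A by blast
      moreover have "keys (m - sqfree_monom ?A) \<subseteq> vertices r n"
        using A(1) by (auto simp: in_keys_iff lookup_minus)
      ultimately show ?thesis
        using I.I_l_closed[OF _ single_in_carrier, of "\<Prod>v\<in>?A. var v"] by simp
    qed
    then have "(\<Sum>m\<in>keys p. single m (lookup p m)) \<in> ?I"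
      by (intro ideal_sum_closed[OF I])
    then show "p \<in> ?I"
      by (simp add: sum_single_lookup)
  qed
qed


section \<open>Primes of the Cox ring\<close>

lemma ideal_nonface_ideal_Pow: "ideal (nonface_ideal r n (Pow F)) (cox_ring r n)"
  by (rule ideal_nonface_ideal) auto

text \<open>
  The quotient is the polynomial ring on the variables of \<open>F\<close>, a domain. Concretely, deleting all
  monomials that involve a variable outside \<open>F\<close> picks a representative \<open>tr p\<close> of the class of \<open>p\<close>,
  and \<open>tr p * tr q\<close> again involves only variables of \<open>F\<close>, so it lies in the ideal only if it is
  zero. That polynomials have no zero divisors rests on the linear order of the monomials, which is
  induced by the lexicographic order of the index pairs.
\<close>

lemma nonface_ideal_Pow_prime:
  assumes "F \<subseteq> vertices r n"
  shows "primeideal (nonface_ideal r n (Pow F) :: 'k::field cox_poly set) (cox_ring r n)"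
    (is "primeideal ?N _")
proof (rule primeidealI[OF ideal_nonface_ideal_Pow cring_cox_ring])
  have "(1 :: 'k cox_poly) \<notin> ?N"
    by (auto simp: nonface_ideal_def lookup_one)
  then show "carrier (cox_ring r n) \<noteq> ?N"
    using cox_one_closed by metis
next
  fix p q :: "'k cox_poly"
  assume p: "p \<in> carrier (cox_ring r n)" and q: "q \<in> carrier (cox_ring r n)"
    and pq: "p \<otimes>\<^bsub>cox_ring r n\<^esub> q \<in> ?N"
  interpret N: ideal ?N "cox_ring r n"
    by (rule ideal_nonface_ideal_Pow)
  define tr where "tr p = (\<Sum>m\<in>{m \<in> keys p. keys m \<subseteq> F}. single m (lookup p m))"
    for p :: "'k cox_poly"
  have lookup_tr: "lookup (tr p) m = (if keys m \<subseteq> F then lookup p m else 0)" for p m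
    by (auto simp: tr_def lookup_sum lookup_single when_def not_in_keys_iff_lookup_eq_zero
        intro!: sum.neutral)
  have tr_closed: "tr p \<in> carrier (cox_ring r n)" for p
  proof -
    have "keys m \<subseteq> vertices r n" if "lookup (tr p) m \<noteq> 0" for m
    proof (cases "keys m \<subseteq> F")
      case True
      with assms show ?thesis by (rule order_trans[rotated])
    next
      case False
      with that show ?thesis by (simp add: lookup_tr)
    qed
    then show ?thesis
      unfolding cox_carrier_iff by blast
  qed
  have mem_iff: "p \<in> ?N \<longleftrightarrow> tr p = 0" if "p \<in> carrier (cox_ring r n)" for p
  proof
    show "tr p = 0" if "p \<in> ?N"
    proof (rule poly_mapping_eqI)
      fix m
      have "lookup p m \<noteq> 0 \<Longrightarrow> keys m \<notin> Pow F"
        using that unfolding nonface_ideal_def by blast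
      then show "lookup (tr p) m = lookup 0 m"
        by (cases "lookup p m = 0") (simp_all add: lookup_tr)
    qed
    show "p \<in> ?N" if "tr p = 0"
    proof -
      have "keys m \<notin> Pow F" if m: "lookup p m \<noteq> 0" for m
        using lookup_tr[of p m] m \<open>tr p = 0\<close> by (auto split: if_splits)
      then show ?thesis
        using \<open>p \<in> carrier _\<close> unfolding nonface_ideal_def by blast
    qed
  qed
  have diff: "p - tr p \<in> ?N" if "p \<in> carrier (cox_ring r n)" for p
  proof -
    have "p - tr p \<in> carrier (cox_ring r n)"
      using cox_add_closed[OF that cox_uminus_closed[OF tr_closed]] by simp
    moreover have "keys m \<notin> Pow F" if m: "lookup (p - tr p) m \<noteq> 0" for m
      using m lookup_tr[of p m] unfolding lookup_minus by (metis PowD diff_self)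
    ultimately show ?thesis
      unfolding nonface_ideal_def by blast
  qed
  have eq: "tr p * tr q = p * q + (- 1) * (q * (p - tr p) + tr p * (q - tr q))"
    by (simp add: algebra_simps)
  have "q * (p - tr p) + tr p * (q - tr q) \<in> ?N"
    using N.a_closed[OF N.I_l_closed[OF diff[OF p] q] N.I_l_closed[OF diff[OF q] tr_closed]] by simp
  then have "(- 1) * (q * (p - tr p) + tr p * (q - tr q)) \<in> ?N"
    using N.I_l_closed[OF _ cox_uminus_closed[OF cox_one_closed]] by (simp only: cox_ring_simps)
  then have tt: "tr p * tr q \<in> ?N"
    unfolding eq using N.a_closed pq by (simp only: cox_ring_simps)
  have "tr p * tr q = 0"
  proof (rule poly_mapping_eqI, rule ccontr)
    fix k assume "lookup (tr p * tr q) k \<noteq> lookup 0 k"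
    then have k: "lookup (tr p * tr q) k \<noteq> 0"
      by simp
    then obtain m m' where "k = m + m'" "lookup (tr p) m \<noteq> 0" "lookup (tr q) m' \<noteq> 0"
      by (rule lookup_mult_nonzero)
    then have "keys k \<subseteq> F"
      unfolding lookup_tr by (metis keys_monom_add Un_least)
    with tt k show False
      unfolding nonface_ideal_def by blast
  qed
  then have "tr p = 0 \<or> tr q = 0"
    by simp
  then show "p \<in> ?N \<or> q \<in> ?N"
    using mem_iff p q by blast
qed

lemma homogeneous_nonface_ideal_Pow:
  "homogeneous_ideal r n (nonface_ideal r n (Pow F) :: 'k::field cox_poly set)"
proof -
  let ?N = "nonface_ideal r n (Pow F) :: 'k cox_poly set"
  let ?G = "?N \<inter> (\<Union>d. hom_part r n d)"
  have GC: "?G \<subseteq> carrier (cox_ring r n)"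
    by (auto simp: hom_part_def)
  have "p \<in> genideal (cox_ring r n) ?G" if "p \<in> ?N" for p
  proof -
    have "single m (lookup p m) \<in> genideal (cox_ring r n) ?G" if "m \<in> keys p" for m
    proof -
      have "keys m \<subseteq> vertices r n" "keys m \<notin> Pow F"
        using that \<open>p \<in> ?N\<close> by (simp_all add: nonface_ideal_def cox_carrier_iff in_keys_iff)
      then have "single m (lookup p m) \<in> hom_part r n (monom_degree m)"
        "single m (lookup p m) \<in> ?N"
        by (simp_all add: single_in_hom_part nonface_ideal_def single_in_carrier lookup_single when_def)
      then have "single m (lookup p m) \<in> ?G"
        by blast
      then show ?thesis
        using cox.genideal_self[OF GC] by blast
    qed
    then have "(\<Sum>m\<in>keys p. single m (lookup p m)) \<in> genideal (cox_ring r n) ?G"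
      by (intro ideal_sum_closed[OF cox.genideal_ideal[OF GC]])
    then show ?thesis
      by (simp add: sum_single_lookup)
  qed
  moreover have "genideal (cox_ring r n) ?G \<subseteq> ?N"
    by (rule cox.genideal_minimal[OF ideal_nonface_ideal_Pow]) blast
  ultimately show ?thesis
    unfolding homogeneous_ideal_def using ideal_nonface_ideal_Pow by blast
qed

lemma prime_notin_mult:
  assumes "primeideal P (cox_ring r n)" "p \<in> carrier (cox_ring r n) - P" "q \<in> carrier (cox_ring r n) - P"
  shows "p * q \<notin> P"
  using primeideal.I_prime[OF assms(1), of p q] assms(2,3) by auto

lemma prime_one_notin:
  assumes "primeideal P (cox_ring r n)"
  shows "1 \<notin> P"
  using ideal.one_imp_carrier[OF primeideal.axioms(1)[OF assms]] primeideal.I_notcarr[OF assms]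
  by auto

lemma monom_notin_prime:
  fixes P :: "'k::field cox_poly set"
  assumes P: "primeideal P (cox_ring r n)" and m: "keys m \<subseteq> vertices r n"
    and var: "\<And>v. v \<in> keys m \<Longrightarrow> var v \<notin> P"
  shows "single m 1 \<notin> P"
proof -
  have pow: "single (single v k) 1 \<in> carrier (cox_ring r n) - P" if "v \<in> keys m" for v k
  proof (induction k)
    case 0
    then show ?case
      using prime_one_notin[OF P] cox_one_closed by simp
  next
    case (Suc k)
    have v: "var v \<in> carrier (cox_ring r n) - P"
      using var m that var_in_carrier by blast
    have "single (single v (Suc k)) 1 = var v * single (single v k) (1::'k)"
      by (simp add: var_def mult_single flip: single_add)
    then show ?case
      using prime_notin_mult[OF P v Suc] cox_mult_closed v Suc by auto
  qed
  have "single (\<Sum>v\<in>A. single v (lookup m v)) 1 \<in> carrier (cox_ring r n) - P"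
    if "finite A" "A \<subseteq> keys m" for A
    using that
  proof (induction A rule: finite_induct)
    case empty
    then show ?case
      using prime_one_notin[OF P] cox_one_closed by simp
  next
    case (insert v A)
    let ?s = "\<Sum>v\<in>A. single v (lookup m v)"
    have A: "single ?s (1::'k) \<in> carrier (cox_ring r n) - P"
      using insert by blast
    have v: "single (single v (lookup m v)) (1::'k) \<in> carrier (cox_ring r n) - P"
      using pow insert.prems by blast
    have "single (\<Sum>v\<in>insert v A. single v (lookup m v)) 1
        = single (single v (lookup m v)) 1 * single ?s (1::'k)"
      using insert.hyps by (simp add: mult_single)
    then show ?case
      using prime_notin_mult[OF P v A] cox_mult_closed v A by auto
  qed
  from this[of "keys m"] show ?thesis
    by (simp add: sum_single_lookup)
qed


section \<open>Transversals and the irrelevant ideal\<close>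

text \<open>
  The faces that a balanced complex can have as facets. As points they are the torus-fixed points
  of the product of projective spaces, and the monomials \<open>x\<^sup>G\<close> of the transversals \<open>G\<close> are the
  products \<open>x\<^sub>1\<^sub>,\<^sub>j\<^sub>1 \<cdots> x\<^sub>r\<^sub>,\<^sub>j\<^sub>r\<close> that define the standard affine charts.
\<close>

definition transversal :: "nat \<Rightarrow> (nat \<Rightarrow> nat) \<Rightarrow> (nat \<times> nat) set \<Rightarrow> bool"
  where "transversal r n G \<longleftrightarrow> G \<subseteq> vertices r n \<and> (\<forall>i\<in>{1..r}. \<exists>!j. (i, j) \<in> G)"

lemma transversal_finite: "transversal r n G \<Longrightarrow> finite G"
  unfolding transversal_def using finite_subset finite_vertices by blast

lemma transversal_subset_eq:
  assumes "transversal r n F" "transversal r n G" "F \<subseteq> G"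
  shows "F = G"
proof
  show "G \<subseteq> F"
  proof
    fix v assume "v \<in> G"
    then obtain i j where v: "v = (i, j)" "i \<in> {1..r}"
      using assms(2) by (cases v) (auto simp: transversal_def vertices_def)
    then obtain j' where "(i, j') \<in> F"
      using assms(1) unfolding transversal_def by blast
    moreover from this have "j' = j"
      using assms(2,3) \<open>v \<in> G\<close> v unfolding transversal_def by blast
    ultimately show "v \<in> F"
      using v by simp
  qed
qed fact

lemma card_transversal:
  assumes "transversal r n G"
  shows "card G = r"
proof -
  have "bij_betw fst G {1..r}"
    unfolding bij_betw_def
  proof
    show "inj_on fst G"
    proof (rule inj_onI)
      fix v w assume "v \<in> G" "w \<in> G" "fst v = fst w"
      moreover have "fst v \<in> {1..r}"
        using assms \<open>v \<in> G\<close> by (auto simp: transversal_def vertices_def)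
      ultimately show "v = w"
        using assms unfolding transversal_def by (metis prod.collapse)
    qed
    show "fst ` G = {1..r}"
    proof
      show "fst ` G \<subseteq> {1..r}"
        using assms by (auto simp: transversal_def vertices_def)
      show "{1..r} \<subseteq> fst ` G"
        using assms unfolding transversal_def by (metis fst_conv imageI subsetI)
    qed
  qed
  then show ?thesis
    by (simp add: bij_betw_same_card)
qed

lemma transversal_monom_in_irrelevant_ideal:
  assumes "transversal r n G"
  shows "(single (sqfree_monom G) 1 :: 'k::field cox_poly) \<in> irrelevant_ideal r n"
  unfolding irrelevant_ideal_def
proof
  fix i assume i: "i \<in> {1..r}"
  let ?V = "{var (i, j) | j. j \<le> n i} :: 'k cox_poly set"
  obtain j where j: "(i, j) \<in> G"
    using assms i unfolding transversal_def by blast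
  have V: "?V \<subseteq> carrier (cox_ring r n)"
    using i by (auto intro!: var_in_carrier simp: vertices_def)
  have G: "finite G" "G \<subseteq> vertices r n"
    using assms transversal_finite by (auto simp: transversal_def)
  have "single (sqfree_monom G) 1 = (single (sqfree_monom (G - {(i, j)})) 1 * var (i, j) :: 'k cox_poly)"
    using sqfree_monom_insert[of "G - {(i, j)}" "(i, j)"] j G
    by (simp add: insert_absorb var_def mult_single add.commute)
  moreover have "var (i, j) \<in> genideal (cox_ring r n) ?V"
  proof -
    have "j \<le> n i"
      using j G(2) by (auto simp: vertices_def)
    then show ?thesis
      using cox.genideal_self[OF V] by blast
  qed
  moreover have "(single (sqfree_monom (G - {(i, j)})) 1 :: 'k cox_poly) \<in> carrier (cox_ring r n)"
    using G by (intro single_in_carrier) auto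
  ultimately show "single (sqfree_monom G) 1 \<in> genideal (cox_ring r n) ?V"
    using ideal.I_l_closed[OF cox.genideal_ideal[OF V]] by fastforce
qed

lemma irrelevant_ideal_subset_carrier:
  assumes "r \<ge> 1"
  shows "irrelevant_ideal r n \<subseteq> (carrier (cox_ring r n) :: 'k::field cox_poly set)"
proof -
  let ?J = "\<lambda>i. genideal (cox_ring r n) {var (i, j) | j. j \<le> n i} :: 'k cox_poly set"
  have "?J 1 \<subseteq> carrier (cox_ring r n)"
    by (rule cox.genideal_minimal[OF cox.oneideal])
      (use assms in \<open>auto intro!: var_in_carrier simp: vertices_def\<close>)
  then show ?thesis
    using assms INF_lower2[of 1 "{1..r}" ?J] by (simp add: irrelevant_ideal_def)
qed

text \<open>
  Every point lies in a standard chart: if all variables of one component vanished at \<open>P\<close>, then \<open>P\<close>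
  would contain the irrelevant ideal.
\<close>

lemma multiproj_transversal:
  fixes P :: "'k::field cox_poly set"
  assumes "P \<in> multiproj r n"
  obtains G where "transversal r n G" "\<And>v. v \<in> G \<Longrightarrow> var v \<notin> P"
    "single (sqfree_monom G) 1 \<notin> P"
proof -
  have P: "primeideal P (cox_ring r n)" and B: "\<not> irrelevant_ideal r n \<subseteq> P"
    using assms by (auto simp: multiproj_def)
  have "\<exists>j\<le>n i. var (i, j) \<notin> P" if "i \<in> {1..r}" for i
  proof (rule ccontr)
    assume "\<not> (\<exists>j\<le>n i. var (i, j) \<notin> P)"
    then have "genideal (cox_ring r n) {var (i, j) | j. j \<le> n i} \<subseteq> P"
      by (intro cox.genideal_minimal primeideal.axioms(1)[OF P]) auto
    with B that show False
      unfolding irrelevant_ideal_def by blast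
  qed
  then obtain j where j: "\<And>i. i \<in> {1..r} \<Longrightarrow> j i \<le> n i \<and> var (i, j i) \<notin> P"
    by metis
  let ?G = "(\<lambda>i. (i, j i)) ` {1..r}"
  have tr: "transversal r n ?G"
    using j by (auto simp: transversal_def vertices_def)
  have var: "var v \<notin> P" if "v \<in> ?G" for v
    using that j by auto
  have "single (sqfree_monom ?G) 1 \<notin> P"
    using tr var by (intro monom_notin_prime[OF P]) (auto simp: transversal_def)
  with tr var show ?thesis
    by (intro that)
qed

lemma transversal_monom_in_facet_ideal_iff:
  assumes "transversal r n G" "transversal r n F"
  shows "(single (sqfree_monom G) 1 :: 'k::field cox_poly) \<in> nonface_ideal r n (Pow F) \<longleftrightarrow> G \<noteq> F"
proof -
  have "single (sqfree_monom G) 1 \<in> carrier (cox_ring r n)"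
    using assms(1) transversal_finite[OF assms(1)]
    by (intro single_in_carrier) (auto simp: transversal_def)
  moreover have "\<not> G \<subseteq> F \<longleftrightarrow> G \<noteq> F"
    using transversal_subset_eq[OF assms] by blast
  ultimately show ?thesis
    using transversal_finite[OF assms(1)]
    by (auto simp: nonface_ideal_def lookup_single when_def)
qed

text \<open>
  In every degree the polynomial ring on the variables of a transversal \<open>G\<close> is at most
  one-dimensional: each degree component sees exactly one variable of \<open>G\<close>, so the degree of a
  monomial determines its exponents.
\<close>

lemma transversal_degree_unique:
  assumes "transversal r n G" "keys m \<subseteq> G" "keys m' \<subseteq> G" "monom_degree m = monom_degree m'"
  shows "m = m'"
proof (rule poly_mapping_eqI)
  fix v
  show "lookup m v = lookup m' v"
  proof (cases "v \<in> G")
    case True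
    obtain i j where v: "v = (i, j)"
      by (cases v)
    have "i \<in> {1..r}"
      using assms(1) True v by (auto simp: transversal_def vertices_def)
    then have "\<exists>!j. (i, j) \<in> G"
      using assms(1) unfolding transversal_def by blast
    then have "{w. w \<in> G \<and> fst w = i} = {v}"
      using True v by auto
    then have "int (lookup k v) = monom_degree k i" if "keys k \<subseteq> G" for k
      using monom_degree_eq_sum[OF transversal_finite[OF assms(1)] that, of i] by simp
    with assms show ?thesis
      by (metis of_nat_eq_iff)
  next
    case False
    with assms(2,3) have "v \<notin> keys m" "v \<notin> keys m'"
      by auto
    then show ?thesis
      by (simp add: not_in_keys_iff_lookup_eq_zero)
  qed
qed


section \<open>Balanced complexes and their points\<close>

locale balanced_simplicial_complex =
  fixes r :: nat and n :: "nat \<Rightarrow> nat" and \<Delta> :: "(nat \<times> nat) set set"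
  assumes r_pos: "r \<ge> 1"
    and complex: "simplicial_complex (vertices r n) \<Delta>"
    and balanced: "balanced_complex r \<Delta>"
begin

lemma face_subset: "A \<in> \<Delta> \<Longrightarrow> A' \<subseteq> A \<Longrightarrow> A' \<in> \<Delta>"
  using complex by (auto simp: simplicial_complex_def)

lemma stanley_reisner_eq: "stanley_reisner_ideal r n \<Delta> = nonface_ideal r n \<Delta>"
  by (rule stanley_reisner_ideal_eq) (rule face_subset)

lemma ideal_nonface: "ideal (nonface_ideal r n \<Delta>) (cox_ring r n)"
  by (rule ideal_nonface_ideal) (rule face_subset)

lemma finite_complex: "finite \<Delta>"
  using complex finite_subset[of \<Delta> "Pow (vertices r n)"] by (simp add: simplicial_complex_def)

lemma finite_facets: "finite (facets \<Delta>)"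
  using finite_complex by (auto simp: facets_def)

lemma face_in_facet:
  assumes "A \<in> \<Delta>"
  obtains F where "F \<in> facets \<Delta>" "A \<subseteq> F"
proof -
  obtain F where "F \<in> \<Delta>" "A \<subseteq> F" "\<forall>A'\<in>\<Delta>. F \<subseteq> A' \<longrightarrow> F = A'"
    using finite_has_maximal2[OF finite_complex assms] by blast
  then show ?thesis
    by (intro that[of F]) (auto simp: facets_def)
qed

lemma facets_nonempty: "facets \<Delta> \<noteq> {}"
proof -
  obtain A where "A \<in> \<Delta>"
    using complex by (auto simp: simplicial_complex_def)
  then obtain F where "F \<in> facets \<Delta>"
    by (rule face_in_facet)
  then show ?thesis
    by blast
qed

lemma facet_face: "F \<in> facets \<Delta> \<Longrightarrow> F \<in> \<Delta>"
  by (simp add: facets_def)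

lemma facet_transversal:
  assumes "F \<in> facets \<Delta>"
  shows "transversal r n F"
proof -
  have "F \<subseteq> vertices r n"
    using complex facet_face[OF assms] unfolding simplicial_complex_def by blast
  then show ?thesis
    using balanced assms unfolding transversal_def balanced_complex_def by blast
qed

lemma transversal_face_facet:
  assumes "transversal r n G" "G \<in> \<Delta>"
  shows "G \<in> facets \<Delta>"
  using face_in_facet[OF assms(2)] facet_transversal transversal_subset_eq[OF assms(1)] by metis

text \<open>
  If \<open>p\<close> has a monomial supported on a face, choose a facet \<open>F\<close> containing that face. As \<open>F\<close> is a
  transversal, \<open>x\<^sup>F\<close> lies in the irrelevant ideal, and multiplying by a power of it moves the monomial
  to one supported inside \<open>F\<close>, which still does not lie in the Stanley--Reisner ideal.
\<close>

lemma saturated: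
  "saturation (cox_ring r n) (nonface_ideal r n \<Delta>) (irrelevant_ideal r n)
    = (nonface_ideal r n \<Delta> :: 'k::field cox_poly set)" (is "saturation ?S ?I ?B = ?I")
proof
  have power_carrier: "ideal_power ?S ?B k \<subseteq> carrier ?S" for k
  proof (induction k)
    case (Suc k)
    have "p \<in> carrier ?S" if "p \<in> ideal_prod ?S (ideal_power ?S ?B k) ?B" for p
      using that
    proof induction
      case (prod i j)
      then show ?case
        using Suc irrelevant_ideal_subset_carrier[OF r_pos] by (auto intro!: cox_mult_closed)
    qed (auto intro: cox_add_closed)
    then show ?case
      by auto
  qed simp
  show "?I \<subseteq> saturation ?S ?I ?B"
  proof
    fix p assume p: "p \<in> ?I"
    then have "p * b \<in> ?I" if "b \<in> ideal_power ?S ?B 1" for b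
      using ideal.I_r_closed[OF ideal_nonface p, of b] power_carrier[of 1] that by auto
    moreover have "p \<in> carrier ?S"
      using p by (simp add: nonface_ideal_def)
    ultimately show "p \<in> saturation ?S ?I ?B"
      unfolding saturation_def ideal_quotient_def by (intro UN_I[of 1]) auto
  qed
  show "saturation ?S ?I ?B \<subseteq> ?I"
  proof
    fix p assume "p \<in> saturation ?S ?I ?B"
    then obtain k where p: "p \<in> carrier ?S" and pk: "\<And>b. b \<in> ideal_power ?S ?B k \<Longrightarrow> p * b \<in> ?I"
      unfolding saturation_def ideal_quotient_def by auto
    have "keys m \<notin> \<Delta>" if m: "lookup p m \<noteq> 0" for m
    proof
      assume "keys m \<in> \<Delta>"
      then obtain F where F: "F \<in> facets \<Delta>" "keys m \<subseteq> F"
        by (rule face_in_facet)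
      let ?x = "sqfree_monom F"
      have "\<exists>m'. keys m' \<subseteq> F \<and> single m' 1 \<in> ideal_power ?S ?B k"
      proof (induction k)
        case 0
        then show ?case
          using cox_one_closed by (intro exI[of _ 0]) simp
      next
        case (Suc k)
        then obtain m' where m': "keys m' \<subseteq> F" "single m' 1 \<in> ideal_power ?S ?B k"
          by blast
        have "single m' 1 * single ?x 1 \<in> ideal_power ?S ?B (Suc k)"
          using ideal_prod.prod[OF m'(2)
              transversal_monom_in_irrelevant_ideal[OF facet_transversal[OF F(1)]], of ?S] by simp
        then show ?case
          using m'(1) transversal_finite[OF facet_transversal[OF F(1)]]
          by (intro exI[of _ "m' + ?x"]) (simp add: mult_single keys_monom_add)
      qed
      then obtain m' where m': "keys m' \<subseteq> F" "single m' 1 \<in> ideal_power ?S ?B k"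
        by blast
      have "lookup (p * single m' 1) (m' + m) \<noteq> 0"
        using m by (simp add: mult.commute[of p])
      moreover have "keys (m' + m) \<in> \<Delta>"
        using F m' facet_face face_subset by (simp add: keys_monom_add) blast
      ultimately show False
        using pk[OF m'(2)] by (auto simp: nonface_ideal_def)
    qed
    with p show "p \<in> ?I"
      by (simp add: nonface_ideal_def)
  qed
qed

text \<open>
  A point \<open>P\<close> of the vanishing locus lies in the chart of some transversal \<open>G\<close>, and \<open>x\<^sup>G \<notin> P\<close> forces
  \<open>G\<close> to be a face, hence a facet. For \<open>v \<notin> G\<close> the set \<open>insert v G\<close> is a non-face, so
  \<open>x\<^sub>v x\<^sup>G \<in> P\<close> and \<open>x\<^sub>v \<in> P\<close>. Thus \<open>P\<close> contains the ideal of the torus-fixed point \<open>G\<close>. It is not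
  larger: modulo that ideal a homogeneous polynomial is a scalar multiple of one monomial in the
  variables of \<open>G\<close>, and such monomials are not in \<open>P\<close>.
\<close>

lemma vanishing_locus_eq:
  "vanishing_locus r n (nonface_ideal r n \<Delta> :: 'k::field cox_poly set)
    = (\<lambda>F. nonface_ideal r n (Pow F)) ` facets \<Delta>" (is "?V = ?R")
proof
  let ?x = "\<lambda>G. single (sqfree_monom G) 1 :: 'k cox_poly"
  show "?R \<subseteq> ?V"
  proof
    fix P :: "'k cox_poly set" assume "P \<in> ?R"
    then obtain F where F: "F \<in> facets \<Delta>" and P: "P = nonface_ideal r n (Pow F)"
      by blast
    have tr: "transversal r n F"
      using F by (rule facet_transversal)
    have "?x F \<notin> P"
      using transversal_monom_in_facet_ideal_iff[OF tr tr] P by simp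
    then have "\<not> irrelevant_ideal r n \<subseteq> P"
      using transversal_monom_in_irrelevant_ideal[OF tr] by blast
    moreover have "nonface_ideal r n \<Delta> \<subseteq> P"
      unfolding P using facet_face[OF F] face_subset by (intro nonface_ideal_antimono) blast
    ultimately show "P \<in> ?V"
      using nonface_ideal_Pow_prime homogeneous_nonface_ideal_Pow tr
      unfolding P vanishing_locus_def multiproj_def transversal_def by blast
  qed
  show "?V \<subseteq> ?R"
  proof
    fix P :: "'k cox_poly set" assume "P \<in> ?V"
    then have mP: "P \<in> multiproj r n" and IP: "nonface_ideal r n \<Delta> \<subseteq> P"
      by (auto simp: vanishing_locus_def)
    then have prime: "primeideal P (cox_ring r n)" and hom: "homogeneous_ideal r n P"
      by (auto simp: multiproj_def)
    interpret P: primeideal P "cox_ring r n" by (fact prime)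
    obtain G where tr: "transversal r n G" and varG: "\<And>v. v \<in> G \<Longrightarrow> var v \<notin> P" and xG: "?x G \<notin> P"
      using multiproj_transversal[OF mP] by metis
    have finG: "finite G" and GV: "G \<subseteq> vertices r n"
      using tr transversal_finite by (auto simp: transversal_def)
    have sq_nonface: "?x A \<in> P" if "A \<subseteq> vertices r n" "A \<notin> \<Delta>" for A
    proof -
      have "finite A"
        using that finite_subset finite_vertices by blast
      then have "?x A \<in> nonface_ideal r n \<Delta>"
        using that by (auto simp: nonface_ideal_def single_in_carrier lookup_single when_def)
      then show ?thesis
        using IP by blast
    qed
    then have "G \<in> \<Delta>"
      using GV xG by blast
    then have facet: "G \<in> facets \<Delta>"
      using transversal_face_facet tr by blast
    have var_in: "var v \<in> P" if v: "v \<in> vertices r n" "v \<notin> G" for v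
    proof (rule ccontr)
      assume "var v \<notin> P"
      then have "?x (insert v G) \<notin> P"
        using varG GV v finG by (intro monom_notin_prime[OF prime]) auto
      moreover have "insert v G \<notin> \<Delta>"
        using facet v unfolding facets_def by blast
      ultimately show False
        using sq_nonface v GV by blast
    qed
    have sub: "nonface_ideal r n (Pow G) \<subseteq> P"
    proof
      fix p :: "'k cox_poly" assume p: "p \<in> nonface_ideal r n (Pow G)"
      have "single m (lookup p m) \<in> P" if m: "m \<in> keys p" for m
      proof -
        have mV: "keys m \<subseteq> vertices r n" and "\<not> keys m \<subseteq> G"
          using p m by (simp_all add: nonface_ideal_def cox_carrier_iff in_keys_iff)
        then obtain v where v: "v \<in> keys m" "v \<notin> G"
          by blast
        have le: "lookup (single v 1) w \<le> lookup m w" for w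
          using v(1) by (auto simp: lookup_single when_def in_keys_iff)
        have "single m (lookup p m) = single (m - single v 1) (lookup p m) * var v"
          using monom_diff_add[OF le] by (simp add: var_def mult_single add.commute)
        moreover have "keys (m - single v 1) \<subseteq> vertices r n"
          using mV by (auto simp: in_keys_iff lookup_minus)
        moreover have "var v \<in> P"
          using var_in v mV by blast
        ultimately show ?thesis
          using P.I_l_closed[OF _ single_in_carrier, of "var v" "m - single v 1"] by simp
      qed
      then have "(\<Sum>m\<in>keys p. single m (lookup p m)) \<in> P"
        by (intro ideal_sum_closed[OF P.is_ideal])
      then show "p \<in> P"
        by (simp add: sum_single_lookup)
    qed
    have "P \<inter> (\<Union>d. hom_part r n d) \<subseteq> nonface_ideal r n (Pow G)"
    proof
      fix f assume "f \<in> P \<inter> (\<Union>d. hom_part r n d)"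
      then obtain d where f: "f \<in> P" "f \<in> hom_part r n d"
        by blast
      have "\<not> keys m \<subseteq> G" if m: "lookup f m \<noteq> 0" for m
      proof
        assume mG: "keys m \<subseteq> G"
        define c where "c = lookup f m"
        have c: "c \<noteq> 0"
          using m by (simp add: c_def)
        \<comment> \<open>After scaling \<open>f\<close> so that \<open>m\<close> has coefficient 1, the term at \<open>m\<close> is removed; no other
        monomial of \<open>f\<close> is supported on \<open>G\<close>.\<close>
        let ?g = "single 0 (inverse c) * f - single m 1"
        have lookup_g: "lookup ?g k = (if k = m then 0 else inverse c * lookup f k)" for k
          using c by (simp add: lookup_minus lookup_single_mult lookup_single when_def c_def)
        have "?g \<in> nonface_ideal r n (Pow G)"
          unfolding nonface_ideal_def cox_carrier_iff
        proof (intro CollectI conjI allI impI)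
          fix k assume "lookup ?g k \<noteq> 0"
          then have k: "k \<noteq> m" "lookup f k \<noteq> 0"
            by (auto simp: lookup_g split: if_splits)
          then show "keys k \<subseteq> vertices r n"
            using f(2) by (auto simp: hom_part_iff)
          have "monom_degree k = monom_degree m"
            using f(2) k(2) m by (auto simp: hom_part_iff)
          then show "keys k \<notin> Pow G"
            using transversal_degree_unique[OF tr _ mG] k(1) by blast
        qed
        then have "?g \<in> P"
          using sub by blast
        moreover have "single 0 (inverse c) * f \<in> P"
          using P.I_l_closed[OF f(1) single_in_carrier[of 0]] by simp
        ultimately have "single 0 (inverse c) * f + (- 1) * ?g \<in> P"
          using P.a_closed P.I_l_closed[OF _ cox_uminus_closed[OF cox_one_closed]]
          by (simp only: cox_ring_simps)
        then have "single m 1 \<in> P"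
          by simp
        moreover have "single m 1 \<notin> P"
          using mG GV varG by (intro monom_notin_prime[OF prime]) auto
        ultimately show False
          by blast
      qed
      then show "f \<in> nonface_ideal r n (Pow G)"
        using hom_part_carrier[OF f(2)] by (simp add: nonface_ideal_def)
    qed
    then have "P \<subseteq> nonface_ideal r n (Pow G)"
      using hom cox.genideal_minimal[OF ideal_nonface_ideal_Pow]
      unfolding homogeneous_ideal_def by metis
    with sub facet show "P \<in> ?R"
      by blast
  qed
qed

end


section \<open>Codimension\<close>

text \<open>
  In a discrete space the irreducible closed sets are the points, so chains have length 0.
\<close>

lemma krull_dim_discrete:
  assumes "X \<noteq> {}"
  shows "krull_dim (discrete_topology X) = 0"
proof -
  let ?T = "discrete_topology X"
  have irreducible: "irreducible_closedin ?T Z \<longleftrightarrow> (\<exists>x\<in>X. Z = {x})" for Z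
  proof
    assume Z: "irreducible_closedin ?T Z"
    then obtain x where x: "x \<in> Z"
      by (auto simp: irreducible_closedin_def)
    have "Z \<subseteq> X"
      using Z by (simp add: irreducible_closedin_def)
    moreover have "Z \<subseteq> {x} \<or> Z \<subseteq> Z - {x}"
      using Z x \<open>Z \<subseteq> X\<close> unfolding irreducible_closedin_def
      by (elim conjE allE[of _ "{x}"] allE[of _ "Z - {x}"]) auto
    ultimately show "\<exists>x\<in>X. Z = {x}"
      using x by blast
  qed (auto simp: irreducible_closedin_def)
  have "{ereal (real k) | k. \<exists>Z. (\<forall>i\<le>k. irreducible_closedin ?T (Z i)) \<and> (\<forall>i<k. Z i \<subset> Z (Suc i))} = {0}"
    (is "?L = _")
  proof
    obtain x where "x \<in> X"
      using assms by blast
    then have "0 \<in> ?L"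
      by (intro CollectI exI[of _ 0] conjI exI[of _ "\<lambda>_. {x}"]) (auto simp: irreducible)
    then show "{0} \<subseteq> ?L"
      by blast
    show "?L \<subseteq> {0}"
    proof
      fix a assume "a \<in> ?L"
      then obtain k Z where a: "a = ereal (real k)"
        and Z: "\<forall>i\<le>k. irreducible_closedin ?T (Z i)" "\<forall>i<k. Z i \<subset> Z (Suc i)"
        by blast
      have "k = 0"
      proof (rule ccontr)
        assume "k \<noteq> 0"
        then have "Z 0 \<subset> Z 1" "irreducible_closedin ?T (Z 0)" "irreducible_closedin ?T (Z 1)"
          using Z by auto
        then show False
          by (auto simp: irreducible)
      qed
      then show "a \<in> {0}"
        using a by (simp add: zero_ereal_def)
    qed
  qed
  then show ?thesis
    unfolding krull_dim_def by simp
qed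

lemma topspace_zariski: "topspace (zariski r n :: 'k::field cox_poly set topology) = multiproj r n"
proof -
  let ?D = "\<lambda>f. {P \<in> multiproj r n. f \<notin> P} :: 'k cox_poly set set"
  have "?D 1 = multiproj r n"
    using prime_one_notin by (auto simp: multiproj_def)
  moreover have "?D 1 \<in> {?D f | f. \<exists>d. f \<in> hom_part r n d}"
    using hom_part_one[of r n] by blast
  ultimately have "multiproj r n \<in> {?D f | f. \<exists>d. f \<in> hom_part r n d}"
    by simp
  then show ?thesis
    unfolding zariski_def topology_generated_by_topspace by blast
qed

lemma openin_zariski_basic:
  "f \<in> hom_part r n d \<Longrightarrow> openin (zariski r n) {P \<in> multiproj r n. f \<notin> P}"
  unfolding zariski_def by (rule topology_generated_by_Basis) blast

context balanced_simplicial_complex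
begin

text \<open>
  The open set \<open>x\<^sup>F \<noteq> 0\<close> meets the vanishing locus in the single point given by the facet \<open>F\<close>. So
  the locus is discrete and of dimension 0; it is nonempty because there is a facet.
\<close>

lemma codim_nonface_ideal:
  "codim r n (nonface_ideal r n \<Delta> :: 'k::field cox_poly set) = ereal (real (\<Sum>i=1..r. n i))"
proof -
  let ?V = "vanishing_locus r n (nonface_ideal r n \<Delta>) :: 'k cox_poly set set"
  let ?T = "subtopology (zariski r n) ?V"
  have top: "topspace ?T = ?V"
    by (auto simp: topspace_zariski vanishing_locus_def)
  have "openin ?T {P}" if PV: "P \<in> ?V" for P
  proof -
    obtain F where F: "F \<in> facets \<Delta>" and P: "P = nonface_ideal r n (Pow F)"
      using PV unfolding vanishing_locus_eq by blast
    let ?x = "single (sqfree_monom F) 1 :: 'k cox_poly"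
    have tr: "transversal r n F"
      using F by (rule facet_transversal)
    have in_iff: "?x \<notin> nonface_ideal r n (Pow G) \<longleftrightarrow> G = F" if "G \<in> facets \<Delta>" for G
      using transversal_monom_in_facet_ideal_iff[OF tr facet_transversal[OF that]] by auto
    have "?x \<in> hom_part r n (monom_degree (sqfree_monom F))"
      using tr transversal_finite[OF tr] by (intro single_in_hom_part) (auto simp: transversal_def)
    then have "openin (zariski r n) {P \<in> multiproj r n. ?x \<notin> P}"
      by (rule openin_zariski_basic)
    moreover have "{P} = {P \<in> multiproj r n. ?x \<notin> P} \<inter> ?V"
    proof -
      have "{P} = {P \<in> ?V. ?x \<notin> P}"
        unfolding vanishing_locus_eq using in_iff F P by blast
      then show ?thesis
        unfolding vanishing_locus_def by blast
    qed
    ultimately show ?thesis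
      unfolding openin_subtopology by blast
  qed
  then have "discrete_topology ?V = ?T"
    using top unfolding discrete_topology_unique by blast
  moreover have "?V \<noteq> {}"
    unfolding vanishing_locus_eq using facets_nonempty by blast
  ultimately show ?thesis
    unfolding codim_def using krull_dim_discrete by (metis ereal_minus(7) diff_zero)
qed

end


section \<open>Graded modules and homogeneous localization\<close>

text \<open>
  The condition on sums and multiples is what makes fractions \<open>m/f\<close> with \<open>m\<close> and \<open>f\<close> of equal degree
  closed under the operations of the homogeneous localization.
\<close>

locale graded_module = module "cox_ring r n" M
  for r :: nat and n :: "nat \<Rightarrow> nat" and M :: "('k::field cox_poly, 'b) gmodule" (structure) +
  assumes grade_carrier: "grade M d \<subseteq> carrier M"
    and zero_grade: "\<zero>\<^bsub>M\<^esub> \<in> grade M d"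
    and add_grade: "x \<in> grade M d \<Longrightarrow> y \<in> grade M d \<Longrightarrow> x \<oplus>\<^bsub>M\<^esub> y \<in> grade M d"
    and smult_grade: "p \<in> hom_part r n e \<Longrightarrow> x \<in> grade M d \<Longrightarrow> p \<odot>\<^bsub>M\<^esub> x \<in> grade M (\<lambda>i. d i + e i)"
begin

lemma smult_smult:
  "p \<in> carrier (cox_ring r n) \<Longrightarrow> q \<in> carrier (cox_ring r n) \<Longrightarrow> x \<in> carrier M \<Longrightarrow>
    p \<odot>\<^bsub>M\<^esub> (q \<odot>\<^bsub>M\<^esub> x) = (p * q) \<odot>\<^bsub>M\<^esub> x"
  using smult_assoc1 by simp

end

definition frac_valid ::
    "nat \<Rightarrow> (nat \<Rightarrow> nat) \<Rightarrow> ('k::field cox_poly, 'b) gmodule \<Rightarrow> 'k cox_poly set \<Rightarrow> 'b \<Rightarrow> 'k cox_poly \<Rightarrow> bool"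
  where "frac_valid r n M P m f \<longleftrightarrow> (\<exists>d\<in>multidegrees r. m \<in> grade M d \<and> f \<in> hom_part r n d - P)"

definition frac_eq ::
    "nat \<Rightarrow> (nat \<Rightarrow> nat) \<Rightarrow> ('k::field cox_poly, 'b) gmodule \<Rightarrow> 'k cox_poly set
      \<Rightarrow> 'b \<Rightarrow> 'k cox_poly \<Rightarrow> 'b \<Rightarrow> 'k cox_poly \<Rightarrow> bool"
  where "frac_eq r n M P m f m' f' \<longleftrightarrow>
    (\<exists>e\<in>multidegrees r. \<exists>u\<in>hom_part r n e - P. u \<odot>\<^bsub>M\<^esub> (f' \<odot>\<^bsub>M\<^esub> m) = u \<odot>\<^bsub>M\<^esub> (f \<odot>\<^bsub>M\<^esub> m'))"

text \<open>
  Splitting the definition into a condition on one representative and a relation between two of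
  them turns well-definedness of the operations on stalks into statements about \<^const>\<open>frac_eq\<close>.
\<close>

lemma fraction_eq_Collect:
  "fraction r n M P m f = {(m', f'). frac_valid r n M P m' f' \<and> frac_eq r n M P m f m' f'}"
  unfolding fraction_def frac_valid_def frac_eq_def by (simp only: conj_assoc[symmetric] bex_simps)

lemma stalk_iff: "A \<in> stalk r n M P \<longleftrightarrow> (\<exists>m f. frac_valid r n M P m f \<and> A = fraction r n M P m f)"
  unfolding stalk_def frac_valid_def by blast

lemma hom_part_notin_mult:
  assumes "primeideal P (cox_ring r n)" "p \<in> hom_part r n d - P" "q \<in> hom_part r n e - P"
  shows "p * q \<in> hom_part r n (\<lambda>i. d i + e i) - P"
proof -
  have "p \<in> carrier (cox_ring r n) - P" "q \<in> carrier (cox_ring r n) - P"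
    using assms(2,3) hom_part_carrier by blast+
  then show ?thesis
    using prime_notin_mult[OF assms(1)] hom_part_mult[of p r n d q e] assms(2,3) by simp
qed

locale graded_module_at_prime = graded_module r n M
  for r :: nat and n :: "nat \<Rightarrow> nat" and M :: "('k::field cox_poly, 'b) gmodule" (structure)
    and P :: "'k cox_poly set" +
  assumes prime: "primeideal P (cox_ring r n)"
begin

lemma frac_validD:
  assumes "frac_valid r n M P m f"
  shows "m \<in> carrier M" "f \<in> carrier (cox_ring r n)"
  using assms grade_carrier hom_part_carrier unfolding frac_valid_def by blast+

lemma frac_eqI:
  assumes "u \<in> hom_part r n e - P" "e \<in> multidegrees r"
    and "frac_valid r n M P m f" "frac_valid r n M P m' f'"
    and "(u * f') \<odot>\<^bsub>M\<^esub> m = (u * f) \<odot>\<^bsub>M\<^esub> m'"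
  shows "frac_eq r n M P m f m' f'"
proof -
  have "u \<in> carrier (cox_ring r n)"
    using assms(1) hom_part_carrier by blast
  then have "u \<odot>\<^bsub>M\<^esub> (f' \<odot>\<^bsub>M\<^esub> m) = u \<odot>\<^bsub>M\<^esub> (f \<odot>\<^bsub>M\<^esub> m')"
    using assms(5) smult_smult frac_validD[OF assms(3)] frac_validD[OF assms(4)] by simp
  then show ?thesis
    unfolding frac_eq_def using assms(1,2) by blast
qed

lemma frac_eqE:
  assumes "frac_eq r n M P m f m' f'" "frac_valid r n M P m f" "frac_valid r n M P m' f'"
  obtains u e where "u \<in> hom_part r n e - P" "e \<in> multidegrees r" "u \<in> carrier (cox_ring r n)"
    "(u * f') \<odot>\<^bsub>M\<^esub> m = (u * f) \<odot>\<^bsub>M\<^esub> m'"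
proof -
  obtain u e where u: "u \<in> hom_part r n e - P" "e \<in> multidegrees r"
    "u \<odot>\<^bsub>M\<^esub> (f' \<odot>\<^bsub>M\<^esub> m) = u \<odot>\<^bsub>M\<^esub> (f \<odot>\<^bsub>M\<^esub> m')"
    using assms(1) unfolding frac_eq_def by blast
  moreover from u have "u \<in> carrier (cox_ring r n)"
    using hom_part_carrier by blast
  ultimately show ?thesis
    using that smult_smult frac_validD[OF assms(2)] frac_validD[OF assms(3)] by simp
qed

lemma one_in_hom_part_minus: "1 \<in> hom_part r n (\<lambda>i. 0) - P"
  using prime_one_notin[OF prime] by simp

lemma frac_eq_refl: "frac_valid r n M P m f \<Longrightarrow> frac_eq r n M P m f m f"
  by (rule frac_eqI[OF one_in_hom_part_minus]) simp_all

lemma frac_eq_sym: "frac_eq r n M P m f m' f' \<Longrightarrow> frac_eq r n M P m' f' m f"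
  unfolding frac_eq_def by metis

lemma frac_eq_trans:
  assumes eq1: "frac_eq r n M P m1 f1 m2 f2" and eq2: "frac_eq r n M P m2 f2 m3 f3"
    and v1: "frac_valid r n M P m1 f1" and v2: "frac_valid r n M P m2 f2"
    and v3: "frac_valid r n M P m3 f3"
  shows "frac_eq r n M P m1 f1 m3 f3"
proof -
  obtain u e where u: "u \<in> hom_part r n e - P" "e \<in> multidegrees r" "u \<in> carrier (cox_ring r n)"
    and u_eq: "(u * f2) \<odot>\<^bsub>M\<^esub> m1 = (u * f1) \<odot>\<^bsub>M\<^esub> m2"
    using frac_eqE[OF eq1 v1 v2] .
  obtain w e' where w: "w \<in> hom_part r n e' - P" "e' \<in> multidegrees r" "w \<in> carrier (cox_ring r n)"
    and w_eq: "(w * f3) \<odot>\<^bsub>M\<^esub> m2 = (w * f2) \<odot>\<^bsub>M\<^esub> m3"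
    using frac_eqE[OF eq2 v2 v3] .
  obtain d where d: "d \<in> multidegrees r" "f2 \<in> hom_part r n d - P"
    using v2 unfolding frac_valid_def by blast
  note carr = frac_validD[OF v1] frac_validD[OF v2] frac_validD[OF v3] u(3) w(3)
  have "(w * f3) \<odot>\<^bsub>M\<^esub> ((u * f2) \<odot>\<^bsub>M\<^esub> m1) = (u * f1) \<odot>\<^bsub>M\<^esub> ((w * f3) \<odot>\<^bsub>M\<^esub> m2)"
    unfolding u_eq using carr by (simp add: smult_smult cox_mult_closed mult_ac)
  then have "(w * f3 * (u * f2)) \<odot>\<^bsub>M\<^esub> m1 = (u * f1 * (w * f2)) \<odot>\<^bsub>M\<^esub> m3"
    unfolding w_eq using carr by (simp add: smult_smult cox_mult_closed)
  then have "((u * w * f2) * f3) \<odot>\<^bsub>M\<^esub> m1 = ((u * w * f2) * f1) \<odot>\<^bsub>M\<^esub> m3"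
    by (simp add: mult_ac)
  then show ?thesis
    by (rule frac_eqI[OF hom_part_notin_mult[OF prime hom_part_notin_mult[OF prime u(1) w(1)] d(2)]
          multidegrees_add[OF multidegrees_add[OF u(2) w(2)] d(1)] v1 v3])
qed

lemma fraction_eq_iff:
  assumes v1: "frac_valid r n M P m1 f1" and v2: "frac_valid r n M P m2 f2"
  shows "fraction r n M P m1 f1 = fraction r n M P m2 f2 \<longleftrightarrow> frac_eq r n M P m1 f1 m2 f2"
proof
  assume "fraction r n M P m1 f1 = fraction r n M P m2 f2"
  moreover have "(m2, f2) \<in> fraction r n M P m2 f2"
    unfolding fraction_eq_Collect using v2 frac_eq_refl by blast
  ultimately show "frac_eq r n M P m1 f1 m2 f2"
    unfolding fraction_eq_Collect by blast
next
  assume eq: "frac_eq r n M P m1 f1 m2 f2"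
  have "frac_eq r n M P m1 f1 m f \<longleftrightarrow> frac_eq r n M P m2 f2 m f" if "frac_valid r n M P m f" for m f
    using frac_eq_trans[OF eq _ v1 v2 that] frac_eq_trans[OF frac_eq_sym[OF eq] _ v2 v1 that] by blast
  then show "fraction r n M P m1 f1 = fraction r n M P m2 f2"
    unfolding fraction_eq_Collect by blast
qed

lemma fraction_self: "frac_valid r n M P m f \<Longrightarrow> (m, f) \<in> fraction r n M P m f"
  unfolding fraction_eq_Collect using frac_eq_refl by blast

lemma in_fractionD:
  assumes "(m', f') \<in> fraction r n M P m f"
  shows "frac_valid r n M P m' f'" "frac_eq r n M P m f m' f'"
  using assms unfolding fraction_eq_Collect by blast+

lemma fraction_cancel:
  assumes v: "frac_valid r n M P m f" and u: "u \<in> hom_part r n e - P" "e \<in> multidegrees r"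
  shows "frac_valid r n M P (u \<odot>\<^bsub>M\<^esub> m) (u * f)"
    and "fraction r n M P (u \<odot>\<^bsub>M\<^esub> m) (u * f) = fraction r n M P m f"
proof -
  obtain d where d: "d \<in> multidegrees r" "m \<in> grade M d" "f \<in> hom_part r n d - P"
    using v unfolding frac_valid_def by blast
  have "u * f \<in> hom_part r n (\<lambda>i. d i + e i) - P"
    using hom_part_notin_mult[OF prime d(3) u(1)] by (simp add: mult.commute)
  then show v': "frac_valid r n M P (u \<odot>\<^bsub>M\<^esub> m) (u * f)"
    unfolding frac_valid_def using smult_grade u d multidegrees_add[OF d(1) u(2)] by blast
  have uc: "u \<in> carrier (cox_ring r n)"
    using u hom_part_carrier by blast
  have "frac_eq r n M P (u \<odot>\<^bsub>M\<^esub> m) (u * f) m f"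
    by (rule frac_eqI[OF one_in_hom_part_minus _ v' v])
      (use frac_validD[OF v] uc in \<open>simp_all add: smult_smult mult.commute\<close>)
  then show "fraction r n M P (u \<odot>\<^bsub>M\<^esub> m) (u * f) = fraction r n M P m f"
    using fraction_eq_iff v v' by blast
qed

lemma zero_fraction:
  assumes "f \<in> hom_part r n d - P" "d \<in> multidegrees r"
  shows "frac_valid r n M P \<zero>\<^bsub>M\<^esub> f" "fraction r n M P \<zero>\<^bsub>M\<^esub> f = fraction r n M P \<zero>\<^bsub>M\<^esub> 1"
proof -
  show v: "frac_valid r n M P \<zero>\<^bsub>M\<^esub> f"
    unfolding frac_valid_def using assms zero_grade by blast
  have v1: "frac_valid r n M P \<zero>\<^bsub>M\<^esub> 1"
    unfolding frac_valid_def using one_in_hom_part_minus multidegrees_zero zero_grade by blast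
  have "frac_eq r n M P \<zero>\<^bsub>M\<^esub> f \<zero>\<^bsub>M\<^esub> 1"
    by (rule frac_eqI[OF one_in_hom_part_minus _ v v1])
      (use frac_validD(2)[OF v] frac_validD(2)[OF v1] in \<open>simp_all add: smult_r_null\<close>)
  then show "fraction r n M P \<zero>\<^bsub>M\<^esub> f = fraction r n M P \<zero>\<^bsub>M\<^esub> 1"
    using fraction_eq_iff v v1 by blast
qed

lemma stalk_add_fraction:
  assumes v: "frac_valid r n M P m f" and v': "frac_valid r n M P m' f'"
  shows "frac_valid r n M P ((f' \<odot>\<^bsub>M\<^esub> m) \<oplus>\<^bsub>M\<^esub> (f \<odot>\<^bsub>M\<^esub> m')) (f * f')"
    and "stalk_add r n M P (fraction r n M P m f) (fraction r n M P m' f')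
      = fraction r n M P ((f' \<odot>\<^bsub>M\<^esub> m) \<oplus>\<^bsub>M\<^esub> (f \<odot>\<^bsub>M\<^esub> m')) (f * f')"
proof -
  have valid: "frac_valid r n M P ((f' \<odot>\<^bsub>M\<^esub> m) \<oplus>\<^bsub>M\<^esub> (f \<odot>\<^bsub>M\<^esub> m')) (f * f')"
    if mf: "frac_valid r n M P m f" and mf': "frac_valid r n M P m' f'" for m f m' f'
  proof -
    obtain d where d: "d \<in> multidegrees r" "m \<in> grade M d" "f \<in> hom_part r n d - P"
      using mf unfolding frac_valid_def by blast
    obtain e where e: "e \<in> multidegrees r" "m' \<in> grade M e" "f' \<in> hom_part r n e - P"
      using mf' unfolding frac_valid_def by blast
    have "f' \<odot>\<^bsub>M\<^esub> m \<in> grade M (\<lambda>i. d i + e i)"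
      using smult_grade d e by blast
    moreover have "f \<odot>\<^bsub>M\<^esub> m' \<in> grade M (\<lambda>i. d i + e i)"
      using smult_grade[of f d m' e] d e by (simp add: add.commute)
    ultimately show ?thesis
      unfolding frac_valid_def
      using add_grade hom_part_notin_mult[OF prime d(3) e(3)] multidegrees_add[OF d(1) e(1)] by blast
  qed
  show "frac_valid r n M P ((f' \<odot>\<^bsub>M\<^esub> m) \<oplus>\<^bsub>M\<^esub> (f \<odot>\<^bsub>M\<^esub> m')) (f * f')"
    by (rule valid[OF v v'])
  have eq: "fraction r n M P ((f2' \<odot>\<^bsub>M\<^esub> m2) \<oplus>\<^bsub>M\<^esub> (f2 \<odot>\<^bsub>M\<^esub> m2')) (f2 * f2')
      = fraction r n M P ((f' \<odot>\<^bsub>M\<^esub> m) \<oplus>\<^bsub>M\<^esub> (f \<odot>\<^bsub>M\<^esub> m')) (f * f')"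
    if in2: "(m2, f2) \<in> fraction r n M P m f" and in2': "(m2', f2') \<in> fraction r n M P m' f'"
    for m2 f2 m2' f2'
  proof -
    note v2 = in_fractionD(1)[OF in2] and v2' = in_fractionD(1)[OF in2']
    obtain u e where u: "u \<in> hom_part r n e - P" "e \<in> multidegrees r" "u \<in> carrier (cox_ring r n)"
      and u_eq: "(u * f2) \<odot>\<^bsub>M\<^esub> m = (u * f) \<odot>\<^bsub>M\<^esub> m2"
      using frac_eqE[OF in_fractionD(2)[OF in2] v v2] .
    obtain w e' where w: "w \<in> hom_part r n e' - P" "e' \<in> multidegrees r" "w \<in> carrier (cox_ring r n)"
      and w_eq: "(w * f2') \<odot>\<^bsub>M\<^esub> m' = (w * f') \<odot>\<^bsub>M\<^esub> m2'"
      using frac_eqE[OF in_fractionD(2)[OF in2'] v' v2'] .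
    note carr = frac_validD[OF v] frac_validD[OF v'] frac_validD[OF v2] frac_validD[OF v2']
      u(3) w(3)
    have 1: "(u * w * (f2 * f2') * f') \<odot>\<^bsub>M\<^esub> m = (u * w * (f * f') * f2') \<odot>\<^bsub>M\<^esub> m2"
      using arg_cong[OF u_eq, of "\<lambda>x. (w * f' * f2') \<odot>\<^bsub>M\<^esub> x"] carr by (simp add: smult_smult cox_mult_closed mult_ac)
    have 2: "(u * w * (f2 * f2') * f) \<odot>\<^bsub>M\<^esub> m' = (u * w * (f * f') * f2) \<odot>\<^bsub>M\<^esub> m2'"
      using arg_cong[OF w_eq, of "\<lambda>x. (u * f * f2) \<odot>\<^bsub>M\<^esub> x"] carr by (simp add: smult_smult cox_mult_closed mult_ac)
    have "(u * w * (f2 * f2')) \<odot>\<^bsub>M\<^esub> ((f' \<odot>\<^bsub>M\<^esub> m) \<oplus>\<^bsub>M\<^esub> (f \<odot>\<^bsub>M\<^esub> m'))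
      = (u * w * (f * f')) \<odot>\<^bsub>M\<^esub> ((f2' \<odot>\<^bsub>M\<^esub> m2) \<oplus>\<^bsub>M\<^esub> (f2 \<odot>\<^bsub>M\<^esub> m2'))"
      using 1 2 carr by (simp add: smult_r_distr smult_smult cox_mult_closed)
    then have "frac_eq r n M P ((f' \<odot>\<^bsub>M\<^esub> m) \<oplus>\<^bsub>M\<^esub> (f \<odot>\<^bsub>M\<^esub> m')) (f * f')
        ((f2' \<odot>\<^bsub>M\<^esub> m2) \<oplus>\<^bsub>M\<^esub> (f2 \<odot>\<^bsub>M\<^esub> m2')) (f2 * f2')"
      by (rule frac_eqI[OF hom_part_notin_mult[OF prime u(1) w(1)] multidegrees_add[OF u(2) w(2)]
            valid[OF v v'] valid[OF v2 v2']])
    then show ?thesis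
      using fraction_eq_iff[OF valid[OF v v'] valid[OF v2 v2']] by simp
  qed
  show "stalk_add r n M P (fraction r n M P m f) (fraction r n M P m' f')
      = fraction r n M P ((f' \<odot>\<^bsub>M\<^esub> m) \<oplus>\<^bsub>M\<^esub> (f \<odot>\<^bsub>M\<^esub> m')) (f * f')"
    unfolding stalk_add_def
    by (rule UN_constant_eq[OF fraction_self[OF v]], clarify,
        rule UN_constant_eq[OF fraction_self[OF v']], clarify, rule eq)
qed

end

lemma graded_module_ring: "graded_module r n (ring_gmodule r n :: ('k::field cox_poly, 'k cox_poly) gmodule)"
proof -
  let ?R = "ring_gmodule r n :: ('k cox_poly, 'k cox_poly) gmodule"
  have simps: "carrier ?R = carrier (cox_ring r n)" "add ?R = (+)" "zero ?R = 0" "smult ?R = (*)"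
    "grade ?R = hom_part r n"
    by (simp_all add: ring_gmodule_def)
  have "module (cox_ring r n) ?R"
  proof (rule moduleI[OF cring_cox_ring])
    show "abelian_group ?R"
    proof (rule abelian_groupI)
      show "\<exists>y\<in>carrier ?R. y \<oplus>\<^bsub>?R\<^esub> x = \<zero>\<^bsub>?R\<^esub>" if "x \<in> carrier ?R" for x
        using cox_uminus_closed that by (intro bexI[of _ "- x"]) (auto simp: simps)
    qed (auto simp: simps cox_add_closed cox_zero_closed add_ac)
  qed (auto simp: simps cox_mult_closed distrib_right distrib_left mult_ac)
  moreover have "p * x \<in> hom_part r n (\<lambda>i. d i + e i)"
    if "p \<in> hom_part r n e" "x \<in> hom_part r n d" for p x :: "'k cox_poly" and d e
    using hom_part_mult[OF that(2,1)] by (simp add: mult.commute)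
  ultimately show ?thesis
    by (intro graded_module.intro graded_module_axioms.intro)
      (auto simp: simps hom_part_add hom_part_carrier)
qed

lemma (in graded_module_at_prime) stalk_smult_fraction:
  assumes vp: "frac_valid r n (ring_gmodule r n) P p g" and v: "frac_valid r n M P m f"
  shows "frac_valid r n M P (p \<odot>\<^bsub>M\<^esub> m) (g * f)"
    and "stalk_smult r n M P (fraction r n (ring_gmodule r n) P p g) (fraction r n M P m f)
      = fraction r n M P (p \<odot>\<^bsub>M\<^esub> m) (g * f)"
proof -
  let ?R = "ring_gmodule r n :: ('k cox_poly, 'k cox_poly) gmodule"
  interpret R: graded_module_at_prime r n ?R P
    using graded_module_ring prime by (intro graded_module_at_prime.intro graded_module_at_prime_axioms.intro)
  have simps: "carrier ?R = carrier (cox_ring r n)" "smult ?R = (*)" "grade ?R = hom_part r n"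
    by (simp_all add: ring_gmodule_def)
  have valid: "frac_valid r n M P (p \<odot>\<^bsub>M\<^esub> m) (g * f)"
    if pg: "frac_valid r n ?R P p g" and mf: "frac_valid r n M P m f" for p g m f
  proof -
    obtain d where d: "d \<in> multidegrees r" "p \<in> hom_part r n d" "g \<in> hom_part r n d - P"
      using pg unfolding frac_valid_def simps by blast
    obtain e where e: "e \<in> multidegrees r" "m \<in> grade M e" "f \<in> hom_part r n e - P"
      using mf unfolding frac_valid_def by blast
    have "p \<odot>\<^bsub>M\<^esub> m \<in> grade M (\<lambda>i. d i + e i)"
      using smult_grade[OF d(2) e(2)] by (simp add: add.commute)
    then show ?thesis
      unfolding frac_valid_def
      using hom_part_notin_mult[OF prime d(3) e(3)] multidegrees_add[OF d(1) e(1)] by blast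
  qed
  show "frac_valid r n M P (p \<odot>\<^bsub>M\<^esub> m) (g * f)"
    by (rule valid[OF vp v])
  have eq: "fraction r n M P (p2 \<odot>\<^bsub>M\<^esub> m2) (g2 * f2) = fraction r n M P (p \<odot>\<^bsub>M\<^esub> m) (g * f)"
    if inp: "(p2, g2) \<in> fraction r n ?R P p g" and in2: "(m2, f2) \<in> fraction r n M P m f"
    for p2 g2 m2 f2
  proof -
    note vp2 = R.in_fractionD(1)[OF inp] and v2 = in_fractionD(1)[OF in2]
    obtain u e where u: "u \<in> hom_part r n e - P" "e \<in> multidegrees r" "u \<in> carrier (cox_ring r n)"
      and u_eq: "u * g2 * p = u * g * p2"
      using R.frac_eqE[OF R.in_fractionD(2)[OF inp] vp vp2] unfolding simps by metis
    obtain w e' where w: "w \<in> hom_part r n e' - P" "e' \<in> multidegrees r" "w \<in> carrier (cox_ring r n)"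
      and w_eq: "(w * f2) \<odot>\<^bsub>M\<^esub> m = (w * f) \<odot>\<^bsub>M\<^esub> m2"
      using frac_eqE[OF in_fractionD(2)[OF in2] v v2] .
    note carr = R.frac_validD[OF vp, unfolded simps] R.frac_validD[OF vp2, unfolded simps]
      frac_validD[OF v] frac_validD[OF v2] u(3) w(3)
    have "(u * w * (g2 * f2)) \<odot>\<^bsub>M\<^esub> (p \<odot>\<^bsub>M\<^esub> m) = (u * g2 * p) \<odot>\<^bsub>M\<^esub> ((w * f2) \<odot>\<^bsub>M\<^esub> m)"
      using carr by (simp add: smult_smult cox_mult_closed mult_ac)
    also have "\<dots> = (u * g * p2) \<odot>\<^bsub>M\<^esub> ((w * f) \<odot>\<^bsub>M\<^esub> m2)"
      unfolding u_eq w_eq ..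
    also have "\<dots> = (u * w * (g * f)) \<odot>\<^bsub>M\<^esub> (p2 \<odot>\<^bsub>M\<^esub> m2)"
      using carr by (simp add: smult_smult cox_mult_closed mult_ac)
    finally have "frac_eq r n M P (p \<odot>\<^bsub>M\<^esub> m) (g * f) (p2 \<odot>\<^bsub>M\<^esub> m2) (g2 * f2)"
      by (rule frac_eqI[OF hom_part_notin_mult[OF prime u(1) w(1)] multidegrees_add[OF u(2) w(2)]
            valid[OF vp v] valid[OF vp2 v2]])
    then show ?thesis
      using fraction_eq_iff[OF valid[OF vp v] valid[OF vp2 v2]] by simp
  qed
  show "stalk_smult r n M P (fraction r n ?R P p g) (fraction r n M P m f)
      = fraction r n M P (p \<odot>\<^bsub>M\<^esub> m) (g * f)"
    unfolding stalk_smult_def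
    by (rule UN_constant_eq[OF R.fraction_self[OF vp]], clarify,
        rule UN_constant_eq[OF fraction_self[OF v]], clarify, rule eq)
qed


section \<open>Morphisms of sheaves induced by graded homomorphisms\<close>

lemma graded_homD:
  assumes "h \<in> graded_hom r n M N"
  shows "x \<in> carrier M \<Longrightarrow> h x \<in> carrier N"
    and "x \<in> carrier M \<Longrightarrow> y \<in> carrier M \<Longrightarrow> h (x \<oplus>\<^bsub>M\<^esub> y) = h x \<oplus>\<^bsub>N\<^esub> h y"
    and "p \<in> carrier (cox_ring r n) \<Longrightarrow> x \<in> carrier M \<Longrightarrow> h (p \<odot>\<^bsub>M\<^esub> x) = p \<odot>\<^bsub>N\<^esub> h x"
    and "d \<in> multidegrees r \<Longrightarrow> x \<in> grade M d \<Longrightarrow> h x \<in> grade N d"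
  using assms unfolding graded_hom_def by blast+

locale graded_hom_at_prime =
  M: graded_module_at_prime r n M P + N: graded_module_at_prime r n N P
  for r n and M :: "('k::field cox_poly, 'b) gmodule" and N :: "('k cox_poly, 'c) gmodule"
    and P :: "'k cox_poly set" +
  fixes h :: "'b \<Rightarrow> 'c"
  assumes hom: "h \<in> graded_hom r n M N"
begin

lemma frac_valid_image: "frac_valid r n M P m f \<Longrightarrow> frac_valid r n N P (h m) f"
  unfolding frac_valid_def using graded_homD(4)[OF hom] by blast

text \<open>
  The union over all representatives is a device for applying \<open>h\<close> to an equivalence class; all
  its members coincide.
\<close>

lemma image_fraction:
  assumes v: "frac_valid r n M P m f"
  shows "(\<Union>(m', f')\<in>fraction r n M P m f. fraction r n N P (h m') f') = fraction r n N P (h m) f"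
proof (rule UN_constant_eq[OF M.fraction_self[OF v]], clarify)
  fix m' f' assume in': "(m', f') \<in> fraction r n M P m f"
  note v' = M.in_fractionD(1)[OF in']
  obtain u e where u: "u \<in> hom_part r n e - P" "e \<in> multidegrees r" "u \<in> carrier (cox_ring r n)"
    and u_eq: "(u * f') \<odot>\<^bsub>M\<^esub> m = (u * f) \<odot>\<^bsub>M\<^esub> m'"
    using M.frac_eqE[OF M.in_fractionD(2)[OF in'] v v'] .
  have "(u * f') \<odot>\<^bsub>N\<^esub> h m = (u * f) \<odot>\<^bsub>N\<^esub> h m'"
    using arg_cong[OF u_eq, of h] M.frac_validD[OF v] M.frac_validD[OF v'] u(3)
    by (simp add: graded_homD(3)[OF hom] cox_mult_closed)
  then have "frac_eq r n N P (h m) f (h m') f'"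
    using N.frac_eqI[OF u(1,2)] frac_valid_image v v' by blast
  then show "fraction r n N P (h m') f' = fraction r n N P (h m) f"
    using N.fraction_eq_iff frac_valid_image v v' by blast
qed

end

lemma openin_zariski_prime:
  "openin (zariski r n) U \<Longrightarrow> P \<in> U \<Longrightarrow> primeideal P (cox_ring r n)"
  using openin_subset[of "zariski r n" U] unfolding topspace_zariski multiproj_def by blast

lemma graded_hom_at_openin:
  assumes "graded_module r n M" "graded_module r n N" "h \<in> graded_hom r n M N"
    and "openin (zariski r n) U" "P \<in> U"
  shows "graded_hom_at_prime r n M N P h"
  using assms openin_zariski_prime[OF assms(4,5)]
  by (intro graded_hom_at_prime.intro graded_module_at_prime.intro
      graded_module_at_prime_axioms.intro graded_hom_at_prime_axioms.intro)

lemma section_germ: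
  assumes "s \<in> sections r n M U" "P \<in> U"
  obtains m f where "frac_valid r n M P m f" "s P = fraction r n M P m f"
proof -
  have "s P \<in> stalk r n M P"
    using assms unfolding sections_def by (auto simp: PiE_def)
  then show ?thesis
    using that unfolding stalk_iff by blast
qed

lemma section_local:
  assumes "s \<in> sections r n M U" "P \<in> U"
  obtains V d m f where "openin (zariski r n) V" "P \<in> V" "V \<subseteq> U" "d \<in> multidegrees r"
    "m \<in> grade M d" "f \<in> hom_part r n d" "\<And>Q. Q \<in> V \<Longrightarrow> f \<notin> Q"
    "\<And>Q. Q \<in> V \<Longrightarrow> s Q = fraction r n M Q m f"
proof -
  have "\<exists>V. openin (zariski r n) V \<and> P \<in> V \<and> V \<subseteq> U \<and>
      (\<exists>d\<in>multidegrees r. \<exists>m\<in>grade M d. \<exists>f\<in>hom_part r n d.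
        \<forall>Q\<in>V. f \<notin> Q \<and> s Q = fraction r n M Q m f)"
    using assms unfolding sections_def by blast
  then obtain V where V: "openin (zariski r n) V" "P \<in> V" "V \<subseteq> U"
    and "\<exists>d\<in>multidegrees r. \<exists>m\<in>grade M d. \<exists>f\<in>hom_part r n d.
        \<forall>Q\<in>V. f \<notin> Q \<and> s Q = fraction r n M Q m f"
    by (elim exE conjE)
  then obtain d m f where d: "d \<in> multidegrees r" "m \<in> grade M d" "f \<in> hom_part r n d"
    and f: "\<forall>Q\<in>V. f \<notin> Q \<and> s Q = fraction r n M Q m f"
    by (elim bexE)
  show ?thesis
    by (rule that[OF V d]) (use f in simp_all)
qed

lemma sectionI:
  assumes "s \<in> extensional U"
    and "\<And>P. P \<in> U \<Longrightarrow> \<exists>V. openin (zariski r n) V \<and> P \<in> V \<and> V \<subseteq> U \<and>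
      (\<exists>d\<in>multidegrees r. \<exists>m\<in>grade M d. \<exists>f\<in>hom_part r n d.
        \<forall>Q\<in>V. f \<notin> Q \<and> s Q = fraction r n M Q m f)"
  shows "s \<in> sections r n M U"
proof -
  have "s P \<in> stalk r n M P" if "P \<in> U" for P
    using assms(2)[OF that] unfolding stalk_iff frac_valid_def by blast
  then show ?thesis
    using assms unfolding sections_def by (simp add: PiE_def)
qed

lemma fraction_section:
  assumes "openin (zariski r n) V" "d \<in> multidegrees r" "m \<in> grade M d" "f \<in> hom_part r n d"
    and "\<And>Q. Q \<in> V \<Longrightarrow> f \<notin> Q"
  shows "(\<lambda>Q\<in>V. fraction r n M Q m f) \<in> sections r n M V"
proof (rule sectionI)
  fix P assume "P \<in> V"
  then show "\<exists>W. openin (zariski r n) W \<and> P \<in> W \<and> W \<subseteq> V \<and>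
      (\<exists>d\<in>multidegrees r. \<exists>m'\<in>grade M d. \<exists>f'\<in>hom_part r n d.
        \<forall>Q\<in>W. f' \<notin> Q \<and> (\<lambda>Q\<in>V. fraction r n M Q m f) Q = fraction r n M Q m' f')"
    using assms by (intro exI[of _ V]) auto
qed simp

lemma induced_map_germ:
  assumes "graded_module r n M" "graded_module r n N" "h \<in> graded_hom r n M N"
    and "openin (zariski r n) U" "P \<in> U"
    and "s P = fraction r n M P m f" "frac_valid r n M P m f"
  shows "induced_map r n N h U s P = fraction r n N P (h m) f"
proof -
  interpret graded_hom_at_prime r n M N P h
    by (rule graded_hom_at_openin) (use assms in auto)
  show ?thesis
    using image_fraction[OF assms(7)] assms(5,6) by (simp add: induced_map_def)
qed

lemma induced_map_in_sections:
  assumes M: "graded_module r n M" and N: "graded_module r n N" and h: "h \<in> graded_hom r n M N"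
    and U: "openin (zariski r n) U" and s: "s \<in> sections r n M U"
  shows "induced_map r n N h U s \<in> sections r n N U"
proof (rule sectionI)
  show "induced_map r n N h U s \<in> extensional U"
    by (simp add: induced_map_def)
  fix P assume "P \<in> U"
  then obtain V d m f where V: "openin (zariski r n) V" "P \<in> V" "V \<subseteq> U" and d: "d \<in> multidegrees r"
    "m \<in> grade M d" "f \<in> hom_part r n d" and f: "\<And>Q. Q \<in> V \<Longrightarrow> f \<notin> Q"
    and s': "\<And>Q. Q \<in> V \<Longrightarrow> s Q = fraction r n M Q m f"
    using section_local[OF s] by metis
  have "f \<notin> Q \<and> induced_map r n N h U s Q = fraction r n N Q (h m) f" if "Q \<in> V" for Q
  proof
    show "f \<notin> Q"
      using f that .
    have "frac_valid r n M Q m f"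
      using f that d unfolding frac_valid_def by blast
    then show "induced_map r n N h U s Q = fraction r n N Q (h m) f"
      using induced_map_germ[where s = s, OF M N h U subsetD[OF V(3) that] s'[OF that]] by blast
  qed
  moreover have "h m \<in> grade N d"
    using graded_homD(4)[OF h d(1,2)] .
  ultimately show "\<exists>V. openin (zariski r n) V \<and> P \<in> V \<and> V \<subseteq> U \<and>
      (\<exists>d\<in>multidegrees r. \<exists>m\<in>grade N d. \<exists>f\<in>hom_part r n d.
        \<forall>Q\<in>V. f \<notin> Q \<and> induced_map r n N h U s Q = fraction r n N Q m f)"
    by (intro exI[of _ V] conjI V bexI[of _ d] bexI[of _ "h m"] bexI[of _ f] ballI) (use d in simp_all)
qed

lemma induced_map_sheaf_hom:
  fixes M :: "('k::field cox_poly, 'b) gmodule" and N :: "('k cox_poly, 'c) gmodule"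
  assumes M: "graded_module r n M" and N: "graded_module r n N" and h: "h \<in> graded_hom r n M N"
  shows "induced_map r n N h \<in> sheaf_hom r n M N"
  unfolding sheaf_hom_def
proof (intro CollectI allI impI conjI ballI funcsetI)
  fix U :: "'k cox_poly set set" assume U: "openin (zariski r n) U"
  let ?h = "induced_map r n N h"
  show "?h U s \<in> sections r n N U" if "s \<in> sections r n M U" for s
    by (rule induced_map_in_sections[OF M N h U that])
  show "?h U (\<lambda>P\<in>U. stalk_add r n M P (s P) (t P)) = (\<lambda>P\<in>U. stalk_add r n N P (?h U s P) (?h U t P))"
    if s: "s \<in> sections r n M U" and t: "t \<in> sections r n M U" for s t
  proof
    fix P
    let ?st = "\<lambda>P\<in>U. stalk_add r n M P (s P) (t P)"
    show "?h U ?st P = (\<lambda>P\<in>U. stalk_add r n N P (?h U s P) (?h U t P)) P"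
    proof (cases "P \<in> U")
      case True
      interpret graded_hom_at_prime r n M N P h
        by (rule graded_hom_at_openin) (use M N h U True in auto)
      obtain m f where m: "frac_valid r n M P m f" "s P = fraction r n M P m f"
        using section_germ[OF s True] .
      obtain m' f' where m': "frac_valid r n M P m' f'" "t P = fraction r n M P m' f'"
        using section_germ[OF t True] .
      have st: "?st P = fraction r n M P ((f' \<odot>\<^bsub>M\<^esub> m) \<oplus>\<^bsub>M\<^esub> (f \<odot>\<^bsub>M\<^esub> m')) (f * f')"
        using True m m' M.stalk_add_fraction(2) by simp
      have "?h U ?st P = fraction r n N P (h ((f' \<odot>\<^bsub>M\<^esub> m) \<oplus>\<^bsub>M\<^esub> (f \<odot>\<^bsub>M\<^esub> m'))) (f * f')"
        by (rule induced_map_germ[where s = ?st, OF M N h U True st M.stalk_add_fraction(1)[OF m(1) m'(1)]])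
      also have "h ((f' \<odot>\<^bsub>M\<^esub> m) \<oplus>\<^bsub>M\<^esub> (f \<odot>\<^bsub>M\<^esub> m')) = (f' \<odot>\<^bsub>N\<^esub> h m) \<oplus>\<^bsub>N\<^esub> (f \<odot>\<^bsub>N\<^esub> h m')"
        using M.frac_validD[OF m(1)] M.frac_validD[OF m'(1)] by (simp add: graded_homD[OF h])
      also have "fraction r n N P \<dots> (f * f') = stalk_add r n N P (?h U s P) (?h U t P)"
        unfolding induced_map_germ[where s = s, OF M N h U True m(2,1)]
          induced_map_germ[where s = t, OF M N h U True m'(2,1)]
        by (rule N.stalk_add_fraction(2)[OF frac_valid_image[OF m(1)] frac_valid_image[OF m'(1)], symmetric])
      also have "\<dots> = (\<lambda>P\<in>U. stalk_add r n N P (?h U s P) (?h U t P)) P"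
        using True by simp
      finally show ?thesis .
    qed (simp add: induced_map_def)
  qed
  show "?h U (\<lambda>P\<in>U. stalk_smult r n M P (a P) (s P)) = (\<lambda>P\<in>U. stalk_smult r n N P (a P) (?h U s P))"
    if a: "a \<in> sections r n (ring_gmodule r n) U" and s: "s \<in> sections r n M U" for a s
  proof
    fix P
    let ?as = "\<lambda>P\<in>U. stalk_smult r n M P (a P) (s P)"
    show "?h U ?as P = (\<lambda>P\<in>U. stalk_smult r n N P (a P) (?h U s P)) P"
    proof (cases "P \<in> U")
      case True
      interpret graded_hom_at_prime r n M N P h
        by (rule graded_hom_at_openin) (use M N h U True in auto)
      obtain p g where p: "frac_valid r n (ring_gmodule r n) P p g" "a P = fraction r n (ring_gmodule r n) P p g"
        using section_germ[OF a True] .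
      obtain m f where m: "frac_valid r n M P m f" "s P = fraction r n M P m f"
        using section_germ[OF s True] .
      have "p \<in> carrier (cox_ring r n)"
        using p(1) hom_part_carrier unfolding frac_valid_def ring_gmodule_def by auto
      then have hp: "h (p \<odot>\<^bsub>M\<^esub> m) = p \<odot>\<^bsub>N\<^esub> h m"
        using graded_homD(3)[OF h] M.frac_validD[OF m(1)] by blast
      have as: "?as P = fraction r n M P (p \<odot>\<^bsub>M\<^esub> m) (g * f)"
        using True p m M.stalk_smult_fraction(2) by simp
      have "?h U ?as P = fraction r n N P (p \<odot>\<^bsub>N\<^esub> h m) (g * f)"
        using induced_map_germ[where s = ?as, OF M N h U True as M.stalk_smult_fraction(1)[OF p(1) m(1)]] hp by simp
      then show ?thesis
        using True p induced_map_germ[where s = s, OF M N h U True m(2,1)]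
          N.stalk_smult_fraction(2)[OF p(1) frac_valid_image[OF m(1)]] by simp
    qed (simp add: induced_map_def)
  qed
  show "?h V (restrict s V) = restrict (?h U s) V"
    if "openin (zariski r n) V" "V \<subseteq> U" "s \<in> sections r n M U" for V s
    using that(2) by (auto simp: induced_map_def restrict_def fun_eq_iff)
qed

text \<open>
  If \<open>u y\<close> lifts to \<open>x\<close>, then the section \<open>y/f = (u y)/(u f)\<close> lifts to \<open>x/(u f)\<close> wherever \<open>u\<close> does
  not vanish. Exactness and surjectivity of sheaf maps both reduce to this.
\<close>

lemma local_lift:
  assumes M: "graded_module r n M" and N: "graded_module r n N" and h: "h \<in> graded_hom r n M N"
    and V: "openin (zariski r n) V" "P \<in> V" "V \<subseteq> U" and d: "d \<in> multidegrees r"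
    and y: "y \<in> grade N d" and f: "f \<in> hom_part r n d" "\<And>Q. Q \<in> V \<Longrightarrow> f \<notin> Q"
    and t: "\<And>Q. Q \<in> V \<Longrightarrow> t Q = fraction r n N Q y f"
    and u: "u \<in> hom_part r n e - P" "e \<in> multidegrees r"
    and x: "x \<in> grade M (\<lambda>i. d i + e i)" "h x = u \<odot>\<^bsub>N\<^esub> y"
  shows "\<exists>V. openin (zariski r n) V \<and> P \<in> V \<and> V \<subseteq> U \<and>
      (\<exists>s\<in>sections r n M V. induced_map r n N h V s = restrict t V)"
proof -
  define W where "W = V \<inter> {Q \<in> multiproj r n. u \<notin> Q}"
  have W: "openin (zariski r n) W"
    unfolding W_def using V(1) u(1) openin_zariski_basic by (intro openin_Int) auto
  have PW: "P \<in> W" "W \<subseteq> V"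
    unfolding W_def using V u openin_subset[OF V(1)] by (auto simp: topspace_zariski)
  have de: "(\<lambda>i. d i + e i) \<in> multidegrees r"
    using d u(2) by (rule multidegrees_add)
  have uf: "u * f \<in> hom_part r n (\<lambda>i. d i + e i)"
    using hom_part_mult[OF f(1), of u e] u(1) by (simp add: mult.commute)
  have uf_notin: "u * f \<notin> Q" if "Q \<in> W" for Q
  proof -
    have "u \<in> hom_part r n e - Q" "f \<in> hom_part r n d - Q"
      using that u f unfolding W_def by auto
    then show ?thesis
      using hom_part_notin_mult[OF openin_zariski_prime[OF W that]] by blast
  qed
  let ?s = "\<lambda>Q\<in>W. fraction r n M Q x (u * f)"
  have "?s \<in> sections r n M W"
    by (rule fraction_section[OF W de x(1) uf uf_notin])
  moreover have "induced_map r n N h W ?s = restrict t W"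
  proof
    fix Q
    show "induced_map r n N h W ?s Q = restrict t W Q"
    proof (cases "Q \<in> W")
      case True
      interpret graded_hom_at_prime r n M N Q h
        by (rule graded_hom_at_openin) (use M N h W True in auto)
      have v: "frac_valid r n M Q x (u * f)"
        unfolding frac_valid_def using x(1) uf uf_notin[OF True] de by blast
      have vy: "frac_valid r n N Q y f"
        unfolding frac_valid_def using d y f True PW by blast
      have "induced_map r n N h W ?s Q = fraction r n N Q (u \<odot>\<^bsub>N\<^esub> y) (u * f)"
        using induced_map_germ[where s = ?s, OF M N h W True _ v] True x(2) by simp
      also have "\<dots> = fraction r n N Q y f"
        using u True unfolding W_def by (intro N.fraction_cancel(2)[OF vy]) auto
      finally show ?thesis
        using t True PW by auto
    qed (simp add: induced_map_def)
  qed
  ultimately show ?thesis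
    using W PW V(3) by blast
qed

text \<open>
  Localization is exact. A section that is locally \<open>y/f\<close> goes to zero at \<open>P\<close> only if \<open>u h(y) = 0\<close> for
  some \<open>u \<notin> P\<close>; then \<open>u y\<close> is a cycle, hence lifts.
\<close>

lemma sheaf_exact_induced_map:
  assumes M: "graded_module r n M" and N: "graded_module r n N" and L: "graded_module r n L"
    and g: "g \<in> graded_hom r n M N" and h: "h \<in> graded_hom r n N L"
    and complex: "\<And>x. x \<in> carrier M \<Longrightarrow> h (g x) = \<zero>\<^bsub>L\<^esub>"
    and exact: "\<And>d y. d \<in> multidegrees r \<Longrightarrow> y \<in> grade N d \<Longrightarrow> h y = \<zero>\<^bsub>L\<^esub> \<Longrightarrow> \<exists>x\<in>grade M d. g x = y"
  shows "sheaf_exact r n M N L (induced_map r n N g) (induced_map r n L h)"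
  unfolding sheaf_exact_def
proof (intro allI impI ballI iffI)
  fix U t assume U: "openin (zariski r n) U" and t: "t \<in> sections r n N U"
  {
    assume im: "in_sheaf_image r n M (induced_map r n N g) U t"
    show "induced_map r n L h U t = zero_section r n L U"
    proof
      fix P
      show "induced_map r n L h U t P = zero_section r n L U P"
      proof (cases "P \<in> U")
        case True
        obtain V s where V: "openin (zariski r n) V" "P \<in> V" "V \<subseteq> U" and s: "s \<in> sections r n M V"
          and st: "induced_map r n N g V s = restrict t V"
          using im True unfolding in_sheaf_image_def by blast
        obtain x f where x: "frac_valid r n M P x f" "s P = fraction r n M P x f"
          using section_germ[OF s V(2)] .
        interpret g: graded_hom_at_prime r n M N P g
          by (rule graded_hom_at_openin) (use M N g U True in auto)
        interpret h: graded_hom_at_prime r n N L P h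
          by (rule graded_hom_at_openin) (use N L h U True in auto)
        have "t P = fraction r n N P (g x) f"
          using fun_cong[OF st, of P] V(2) induced_map_germ[where s = s, OF M N g V(1,2) x(2,1)] by simp
        then have "induced_map r n L h U t P = fraction r n L P (h (g x)) f"
          using induced_map_germ[where s = t, OF N L h U True] g.frac_valid_image[OF x(1)] by blast
        also have "h (g x) = \<zero>\<^bsub>L\<^esub>"
          using complex g.M.frac_validD(1)[OF x(1)] .
        also have "fraction r n L P \<zero>\<^bsub>L\<^esub> f = fraction r n L P \<zero>\<^bsub>L\<^esub> 1"
          using x(1) h.N.zero_fraction(2) unfolding frac_valid_def by blast
        finally show ?thesis
          using True by (simp add: zero_section_def)
      qed (simp add: induced_map_def zero_section_def)
    qed
  next
    assume zero: "induced_map r n L h U t = zero_section r n L U"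
    show "in_sheaf_image r n M (induced_map r n N g) U t"
      unfolding in_sheaf_image_def
    proof
      fix P assume P: "P \<in> U"
      interpret h: graded_hom_at_prime r n N L P h
        by (rule graded_hom_at_openin) (use N L h U P in auto)
      obtain V d y f where V: "openin (zariski r n) V" "P \<in> V" "V \<subseteq> U" and d: "d \<in> multidegrees r"
        and y: "y \<in> grade N d" and f: "f \<in> hom_part r n d" "\<And>Q. Q \<in> V \<Longrightarrow> f \<notin> Q"
        and ty: "\<And>Q. Q \<in> V \<Longrightarrow> t Q = fraction r n N Q y f"
        using section_local[OF t P] by metis
      have v: "frac_valid r n N P y f"
        unfolding frac_valid_def using d y f V(2) by blast
      have v1: "frac_valid r n L P \<zero>\<^bsub>L\<^esub> 1"
        using h.N.zero_fraction(1)[OF h.N.one_in_hom_part_minus multidegrees_zero] .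
      have "fraction r n L P (h y) f = fraction r n L P \<zero>\<^bsub>L\<^esub> 1"
        using fun_cong[OF zero, of P] P induced_map_germ[where s = t, OF N L h U P ty[OF V(2)] v]
        by (simp add: zero_section_def)
      then have "frac_eq r n L P (h y) f \<zero>\<^bsub>L\<^esub> 1"
        using h.N.fraction_eq_iff[OF h.frac_valid_image[OF v] v1] by blast
      then obtain u e where u: "u \<in> hom_part r n e - P" "e \<in> multidegrees r"
        "u \<in> carrier (cox_ring r n)" and "(u * 1) \<odot>\<^bsub>L\<^esub> h y = (u * f) \<odot>\<^bsub>L\<^esub> \<zero>\<^bsub>L\<^esub>"
        using h.N.frac_eqE h.frac_valid_image[OF v] v1 by metis
      then have "u \<odot>\<^bsub>L\<^esub> h y = \<zero>\<^bsub>L\<^esub>"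
        using h.N.smult_r_null[OF cox_mult_closed[OF u(3) h.M.frac_validD(2)[OF v]]] by simp
      then have "h (u \<odot>\<^bsub>N\<^esub> y) = \<zero>\<^bsub>L\<^esub>"
        using graded_homD(3)[OF h u(3) h.M.frac_validD(1)[OF v]] by simp
      moreover have "u \<odot>\<^bsub>N\<^esub> y \<in> grade N (\<lambda>i. d i + e i)"
        using h.M.smult_grade u(1) y by blast
      ultimately obtain x where x: "x \<in> grade M (\<lambda>i. d i + e i)" "g x = u \<odot>\<^bsub>N\<^esub> y"
        using exact[OF multidegrees_add[OF d u(2)]] by blast
      show "\<exists>V. openin (zariski r n) V \<and> P \<in> V \<and> V \<subseteq> U \<and>
          (\<exists>s\<in>sections r n M V. induced_map r n N g V s = restrict t V)"
        by (rule local_lift[OF M N g V d y f(1) _ _ u(1,2) x]) (use f(2) ty in blast)+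
    qed
  }
qed

text \<open>
  The homogeneous elements of \<open>N\<close> need only lift after multiplication by some \<open>u\<close> that does not
  vanish at the point under consideration, so a cokernel supported on the irrelevant ideal does no
  harm.
\<close>

lemma sheaf_surjective_induced_map:
  assumes M: "graded_module r n M" and N: "graded_module r n N" and h: "h \<in> graded_hom r n M N"
    and surj: "\<And>P. P \<in> multiproj r n \<Longrightarrow> \<exists>e\<in>multidegrees r. \<exists>u\<in>hom_part r n e - P.
      \<forall>d\<in>multidegrees r. \<forall>y\<in>grade N d. \<exists>x\<in>grade M (\<lambda>i. d i + e i). h x = u \<odot>\<^bsub>N\<^esub> y"
  shows "sheaf_surjective r n M N (induced_map r n N h)"
  unfolding sheaf_surjective_def in_sheaf_image_def
proof (intro allI impI ballI)
  fix U t P assume U: "openin (zariski r n) U" and t: "t \<in> sections r n N U" and P: "P \<in> U"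
  have "P \<in> multiproj r n"
    using openin_subset[OF U] P by (auto simp: topspace_zariski)
  then obtain e u where u: "u \<in> hom_part r n e - P" "e \<in> multidegrees r"
    and lift: "\<And>d y. d \<in> multidegrees r \<Longrightarrow> y \<in> grade N d \<Longrightarrow> \<exists>x\<in>grade M (\<lambda>i. d i + e i). h x = u \<odot>\<^bsub>N\<^esub> y"
    using surj by meson
  obtain V d y f where V: "openin (zariski r n) V" "P \<in> V" "V \<subseteq> U" and d: "d \<in> multidegrees r"
    and y: "y \<in> grade N d" and f: "f \<in> hom_part r n d" "\<And>Q. Q \<in> V \<Longrightarrow> f \<notin> Q"
    and ty: "\<And>Q. Q \<in> V \<Longrightarrow> t Q = fraction r n N Q y f"
    using section_local[OF t P] by metis
  obtain x where x: "x \<in> grade M (\<lambda>i. d i + e i)" "h x = u \<odot>\<^bsub>N\<^esub> y"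
    using lift[OF d y] by blast
  show "\<exists>V. openin (zariski r n) V \<and> P \<in> V \<and> V \<subseteq> U \<and>
      (\<exists>s\<in>sections r n M V. induced_map r n N h V s = restrict t V)"
    by (rule local_lift[OF M N h V d y f(1) _ _ u(1,2) x]) (use f(2) ty in blast)+
qed


section \<open>Free and cyclic graded modules\<close>

lemma free_gmodule_simps:
  "carrier (free_gmodule r n a) =
    {v. (\<forall>j<length a. v j \<in> carrier (cox_ring r n)) \<and> (\<forall>j\<ge>length a. v j = 0)}"
  "zero (free_gmodule r n a) = (\<lambda>j. 0)"
  "add (free_gmodule r n a) = (\<lambda>v w j. v j + w j)"
  "smult (free_gmodule r n a) = (\<lambda>p v j. p * v j)"
  "grade (free_gmodule r n a) d =
    {v. (\<forall>j<length a. v j \<in> hom_part r n (\<lambda>i. d i - (a ! j) i)) \<and> (\<forall>j\<ge>length a. v j = 0)}"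
  by (auto simp: free_gmodule_def Let_def hom_part_carrier)

lemma graded_module_free:
  "graded_module r n (free_gmodule r n a :: ('k::field cox_poly, nat \<Rightarrow> 'k cox_poly) gmodule)"
proof -
  let ?F = "free_gmodule r n a :: ('k cox_poly, nat \<Rightarrow> 'k cox_poly) gmodule"
  have "module (cox_ring r n) ?F"
  proof (rule moduleI[OF cring_cox_ring])
    show "abelian_group ?F"
    proof (rule abelian_groupI)
      show "\<exists>y\<in>carrier ?F. y \<oplus>\<^bsub>?F\<^esub> x = \<zero>\<^bsub>?F\<^esub>" if "x \<in> carrier ?F" for x
        using that by (intro bexI[of _ "\<lambda>j. - x j"]) (simp_all add: free_gmodule_simps cox_uminus_closed)
    qed (simp_all add: free_gmodule_simps cox_add_closed cox_zero_closed add_ac)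
  qed (simp_all add: free_gmodule_simps cox_mult_closed distrib_right distrib_left mult_ac)
  moreover have "p * x \<in> hom_part r n (\<lambda>i. d i + e i - (a ! j) i)"
    if "p \<in> hom_part r n e" "x \<in> hom_part r n (\<lambda>i. d i - (a ! j) i)" for p x :: "'k cox_poly" and d e j
    using hom_part_mult[OF that] by (simp add: algebra_simps)
  ultimately show ?thesis
    by (intro graded_module.intro graded_module_axioms.intro)
      (auto simp: free_gmodule_simps hom_part_add intro: hom_part_carrier)
qed

text \<open>
  The basis of a free module is numbered, while the bases below are naturally labelled by pairs of
  sets. A list \<open>xs\<close> of labels translates between families \<open>c\<close> indexed by labels and coordinate
  vectors.
\<close>

definition vec_of :: "'i list \<Rightarrow> ('i \<Rightarrow> 'a::zero) \<Rightarrow> nat \<Rightarrow> 'a"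
  where "vec_of xs c = (\<lambda>j. if j < length xs then c (xs ! j) else 0)"

definition coord :: "'i list \<Rightarrow> (nat \<Rightarrow> 'a::zero) \<Rightarrow> 'i \<Rightarrow> 'a"
  where "coord xs v x = (if x \<in> set xs then v (THE j. j < length xs \<and> xs ! j = x) else 0)"

lemma coord_nth: "distinct xs \<Longrightarrow> j < length xs \<Longrightarrow> coord xs v (xs ! j) = v j"
proof -
  assume "distinct xs" "j < length xs"
  moreover from this have "(THE j'. j' < length xs \<and> xs ! j' = xs ! j) = j"
    by (intro the_equality) (auto simp: nth_eq_iff_index_eq)
  ultimately show ?thesis
    by (simp add: coord_def)
qed

lemma coord_vec_of: "distinct xs \<Longrightarrow> x \<in> set xs \<Longrightarrow> coord xs (vec_of xs c) x = c x"
  by (metis coord_nth in_set_conv_nth vec_of_def)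

lemma vec_of_coord: "distinct xs \<Longrightarrow> (\<And>j. length xs \<le> j \<Longrightarrow> v j = 0) \<Longrightarrow> vec_of xs (coord xs v) = v"
  by (auto simp: vec_of_def fun_eq_iff coord_nth)

lemma vec_of_cong: "(\<And>x. x \<in> set xs \<Longrightarrow> c x = c' x) \<Longrightarrow> vec_of xs c = vec_of xs c'"
  by (auto simp: vec_of_def fun_eq_iff)

lemma coord_add: "coord xs (\<lambda>j. v j + w j) x = coord xs v x + (coord xs w x :: 'a::monoid_add)"
  by (simp add: coord_def)

lemma coord_smult: "coord xs (\<lambda>j. p * v j) x = p * (coord xs v x :: 'a::semiring_0)"
  by (simp add: coord_def)

lemma coord_carrier:
  assumes "v \<in> carrier (free_gmodule r n (map dg xs))" "distinct xs"
  shows "coord xs v x \<in> carrier (cox_ring r n)"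
proof (cases "x \<in> set xs")
  case True
  then obtain j where "j < length xs" "x = xs ! j"
    by (metis in_set_conv_nth)
  with assms show ?thesis
    by (simp add: free_gmodule_simps coord_nth)
qed (simp add: coord_def cox_zero_closed)

lemma coord_grade:
  assumes "v \<in> grade (free_gmodule r n (map dg xs)) d" "distinct xs"
  shows "coord xs v x \<in> hom_part r n (\<lambda>i. d i - dg x i)"
proof (cases "x \<in> set xs")
  case True
  then obtain j where "j < length xs" "x = xs ! j"
    by (metis in_set_conv_nth)
  with assms show ?thesis
    by (simp add: free_gmodule_simps coord_nth)
qed (simp add: coord_def)

lemma vec_of_carrier:
  "(\<And>x. x \<in> set xs \<Longrightarrow> c x \<in> carrier (cox_ring r n)) \<Longrightarrow>
    vec_of xs c \<in> carrier (free_gmodule r n (map dg xs))"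
  by (simp add: free_gmodule_simps vec_of_def)

lemma vec_of_grade:
  "(\<And>x. x \<in> set xs \<Longrightarrow> c x \<in> hom_part r n (\<lambda>i. d i - dg x i)) \<Longrightarrow>
    vec_of xs c \<in> grade (free_gmodule r n (map dg xs)) d"
  by (simp add: free_gmodule_simps vec_of_def)

lemma quotient_gmodule_simps:
  assumes "ideal I (cox_ring r n)"
  shows "carrier (quotient_gmodule r n I) = (\<lambda>p. I +>\<^bsub>cox_ring r n\<^esub> p) ` carrier (cox_ring r n)"
    and "grade (quotient_gmodule r n I) d = (\<lambda>p. I +>\<^bsub>cox_ring r n\<^esub> p) ` hom_part r n d"
    and "p \<in> carrier (cox_ring r n) \<Longrightarrow> q \<in> carrier (cox_ring r n) \<Longrightarrow>
      add (quotient_gmodule r n I) (I +>\<^bsub>cox_ring r n\<^esub> p) (I +>\<^bsub>cox_ring r n\<^esub> q)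
        = I +>\<^bsub>cox_ring r n\<^esub> (p + q)"
    and "p \<in> carrier (cox_ring r n) \<Longrightarrow> q \<in> carrier (cox_ring r n) \<Longrightarrow>
      smult (quotient_gmodule r n I) p (I +>\<^bsub>cox_ring r n\<^esub> q) = I +>\<^bsub>cox_ring r n\<^esub> (p * q)"
    and "zero (quotient_gmodule r n I) = I +>\<^bsub>cox_ring r n\<^esub> 0"
    and "p \<in> carrier (cox_ring r n) \<Longrightarrow>
      I +>\<^bsub>cox_ring r n\<^esub> p = zero (quotient_gmodule r n I) \<longleftrightarrow> p \<in> I"
proof -
  interpret ideal I "cox_ring r n" by fact
  note defs = quotient_gmodule_def Let_def FactRing_def
  show "carrier (quotient_gmodule r n I) = (\<lambda>p. I +>\<^bsub>cox_ring r n\<^esub> p) ` carrier (cox_ring r n)"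
    by (auto simp: defs A_RCOSETS_def')
  show "grade (quotient_gmodule r n I) d = (\<lambda>p. I +>\<^bsub>cox_ring r n\<^esub> p) ` hom_part r n d"
    by (simp add: defs)
  show "add (quotient_gmodule r n I) (I +>\<^bsub>cox_ring r n\<^esub> p) (I +>\<^bsub>cox_ring r n\<^esub> q)
        = I +>\<^bsub>cox_ring r n\<^esub> (p + q)"
    if "p \<in> carrier (cox_ring r n)" "q \<in> carrier (cox_ring r n)"
    using a_rcos_sum[OF that] by (simp add: defs)
  show "smult (quotient_gmodule r n I) p (I +>\<^bsub>cox_ring r n\<^esub> q) = I +>\<^bsub>cox_ring r n\<^esub> (p * q)"
    if "p \<in> carrier (cox_ring r n)" "q \<in> carrier (cox_ring r n)"
    using rcoset_mult_add[OF that] by (simp add: defs)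
  have zero: "I +>\<^bsub>cox_ring r n\<^esub> 0 = I"
    using cox.a_coset_add_zero[OF a_subset] by simp
  then show "zero (quotient_gmodule r n I) = I +>\<^bsub>cox_ring r n\<^esub> 0"
    by (simp add: defs)
  have "zero (quotient_gmodule r n I) = I"
    by (simp add: defs)
  then show "I +>\<^bsub>cox_ring r n\<^esub> p = zero (quotient_gmodule r n I) \<longleftrightarrow> p \<in> I"
    if "p \<in> carrier (cox_ring r n)"
    using rcos_const_imp_mem[of p] a_rcos_const[of p] that by auto
qed

lemma graded_module_quotient:
  fixes I :: "'k::field cox_poly set"
  assumes I: "ideal I (cox_ring r n)"
  shows "graded_module r n (quotient_gmodule r n I)"
proof -
  let ?Q = "quotient_gmodule r n I"
  note s = quotient_gmodule_simps[OF I]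
  let ?pi = "\<lambda>p. I +>\<^bsub>cox_ring r n\<^esub> p"
  have repr: "\<exists>p\<in>carrier (cox_ring r n). x = ?pi p" if "x \<in> carrier ?Q" for x
    using that unfolding s(1) by blast
  have pi: "?pi p \<in> carrier ?Q" if "p \<in> carrier (cox_ring r n)" for p
    using that unfolding s(1) by blast
  note closed = pi cox_add_closed cox_mult_closed cox_zero_closed cox_one_closed
  have "module (cox_ring r n) ?Q"
  proof (rule moduleI[OF cring_cox_ring])
    show "abelian_group ?Q"
    proof (rule abelian_groupI)
      show "\<exists>y\<in>carrier ?Q. y \<oplus>\<^bsub>?Q\<^esub> x = \<zero>\<^bsub>?Q\<^esub>" if "x \<in> carrier ?Q" for x
      proof -
        obtain p where p: "p \<in> carrier (cox_ring r n)" "x = I +>\<^bsub>cox_ring r n\<^esub> p"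
          using repr \<open>x \<in> carrier ?Q\<close> by blast
        have "?pi (- p) \<oplus>\<^bsub>?Q\<^esub> x = \<zero>\<^bsub>?Q\<^esub>"
          unfolding p(2) s(3)[OF cox_uminus_closed[OF p(1)] p(1)] s(5) by simp
        with pi[OF cox_uminus_closed[OF p(1)]] show ?thesis
          by (rule rev_bexI)
      qed
    qed (auto dest!: repr simp: s(3,5) closed add_ac)
  qed (auto dest!: repr simp: s(3,4) closed distrib_right distrib_left mult_ac)
  moreover have "grade ?Q d \<subseteq> carrier ?Q" for d
    unfolding s(1,2) using hom_part_carrier by blast
  moreover have "\<zero>\<^bsub>?Q\<^esub> \<in> grade ?Q d" for d
    unfolding s(2,5) by (rule imageI) simp
  moreover have "x \<oplus>\<^bsub>?Q\<^esub> y \<in> grade ?Q d" if "x \<in> grade ?Q d" "y \<in> grade ?Q d" for x y d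
    using that unfolding s(2) by (auto simp: s(3) hom_part_carrier hom_part_add)
  moreover have "p \<odot>\<^bsub>?Q\<^esub> x \<in> grade ?Q (\<lambda>i. d i + e i)"
    if p: "p \<in> hom_part r n e" and x: "x \<in> grade ?Q d" for p x d e
  proof -
    obtain q where q: "q \<in> hom_part r n d" "x = I +>\<^bsub>cox_ring r n\<^esub> q"
      using x unfolding s(2) by blast
    have "p \<odot>\<^bsub>?Q\<^esub> x = I +>\<^bsub>cox_ring r n\<^esub> (q * p)"
      using p q by (simp add: s(4) hom_part_carrier mult.commute)
    then show ?thesis
      unfolding s(2) using hom_part_mult[OF q(1) p] by blast
  qed
  ultimately show ?thesis
    by (intro graded_module.intro graded_module_axioms.intro) auto
qed


section \<open>The Koszul complex on a set of variables\<close>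

definition koszul_sign :: "nat \<times> nat \<Rightarrow> (nat \<times> nat) set \<Rightarrow> 'k::field"
  where "koszul_sign w B = (- 1) ^ card {b \<in> B. b < w}"

text \<open>
  A chain of the Koszul complex on the variables in \<open>W\<close> is a family \<open>c\<close> of polynomials, standing
  for \<open>\<Sum>A. c A \<cdot> e\<^sub>A\<close> with \<open>A\<close> running over subsets of \<open>W\<close>. The differential is written by the
  coefficient that it gives to \<open>e\<^sub>B\<close>, which collects the contributions of the
  basis elements indexed by \<open>insert w B\<close>.
\<close>

definition koszul_d ::
    "(nat \<times> nat) set \<Rightarrow> ((nat \<times> nat) set \<Rightarrow> 'k::field cox_poly) \<Rightarrow> (nat \<times> nat) set \<Rightarrow> 'k cox_poly"
  where "koszul_d W c B = (\<Sum>w\<in>W - B. single (single w 1) (koszul_sign w B) * c (insert w B))"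

text \<open>
  A contracting homotopy, linear over the field but not over the polynomial ring. The complex splits
  into strands by the support \<open>T = keys m \<inter> W \<union> A\<close> of a basis element \<open>x\<^sup>m e\<^sub>A\<close>, and for nonempty \<open>T\<close>
  the strand contracts by moving the least variable \<open>v\<close> of \<open>T\<close> from the monomial into the exterior
  factor: \<open>x\<^sup>m e\<^sub>A\<close> goes to \<open>x\<^sup>m/x\<^sub>v \<cdot> e\<close> indexed by \<open>insert v A\<close> if \<open>v \<notin> A\<close>, and to 0 otherwise. Since \<open>v\<close> is
  minimal, no sign appears.
\<close>

definition koszul_lift ::
    "(nat \<times> nat) set \<Rightarrow> ((nat \<times> nat) set \<Rightarrow> 'k::field cox_poly) \<Rightarrow> (nat \<times> nat) set \<Rightarrow> 'k cox_poly"
  where "koszul_lift W c A = Abs_poly_mapping (\<lambda>m. let v = Min (keys m \<inter> W \<union> A) in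
    if v \<in> A then lookup (c (A - {v})) (m + single v 1) else 0)"

lemma koszul_d_cong:
  "(\<And>w. w \<in> W - B \<Longrightarrow> c (insert w B) = c' (insert w B)) \<Longrightarrow> koszul_d W c B = koszul_d W c' B"
  unfolding koszul_d_def by (rule sum.cong) auto

lemma koszul_d_add: "koszul_d W (\<lambda>A. c A + c' A) B = koszul_d W c B + koszul_d W c' B"
  by (simp add: koszul_d_def distrib_left sum.distrib)

lemma koszul_d_smult: "koszul_d W (\<lambda>A. p * c A) B = p * koszul_d W c B"
  by (simp add: koszul_d_def sum_distrib_left mult_ac)

lemma koszul_sign_insert_less:
  assumes "finite B" "v \<notin> B" "v < w"
  shows "koszul_sign w (insert v B) = - (koszul_sign w B :: 'k::field)"
proof -
  have "{b \<in> insert v B. b < w} = insert v {b \<in> B. b < w}"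
    using assms(3) by blast
  then show ?thesis
    using assms by (simp add: koszul_sign_def)
qed

lemma koszul_sign_insert_greater:
  assumes "w < v"
  shows "koszul_sign w (insert v B) = koszul_sign w B"
proof -
  have "{b \<in> insert v B. b < w} = {b \<in> B. b < w}"
    using assms by auto
  then show ?thesis
    by (simp add: koszul_sign_def)
qed

lemma koszul_sign_minimal: "(\<And>b. b \<in> B \<Longrightarrow> w \<le> b) \<Longrightarrow> koszul_sign w B = 1"
proof -
  assume "\<And>b. b \<in> B \<Longrightarrow> w \<le> b"
  then have "{b \<in> B. b < w} = {}"
    by (auto simp: not_less)
  then show ?thesis
    unfolding koszul_sign_def by (metis card.empty power_0)
qed

text \<open>
  The terms for \<open>(w, w')\<close> and \<open>(w', w)\<close> cancel. The pairs are divided by \<open>w < w'\<close> and \<open>w' < w\<close>,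
  because in characteristic 2 a sum that equals its own negative need not vanish.
\<close>

lemma koszul_d_koszul_d:
  fixes c :: "(nat \<times> nat) set \<Rightarrow> 'k::field cox_poly"
  assumes "finite W" "finite B"
  shows "koszul_d W (koszul_d W c) B = 0"
proof -
  define t where "t w B = (single (single w 1) (koszul_sign w B) :: 'k cox_poly)" for w B
  define f where "f = (\<lambda>(w, w'). t w B * (t w' (insert w B) * c (insert w' (insert w B))))"
  define L where "L = {(w, w'). w \<in> W - B \<and> w' \<in> W - B \<and> w < w'}"
  define G where "G = {(w, w'). w \<in> W - B \<and> w' \<in> W - B \<and> w' < w}"
  have "L \<subseteq> W \<times> W" "G \<subseteq> W \<times> W"
    by (auto simp: L_def G_def)
  then have fin: "finite L" "finite G"
    using assms(1) by (meson finite_SigmaI finite_subset)+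
  have "koszul_d W (koszul_d W c) B = (\<Sum>w\<in>W - B. \<Sum>w'\<in>W - insert w B. f (w, w'))"
    by (simp add: koszul_d_def f_def t_def sum_distrib_left)
  also have "\<dots> = sum f (Sigma (W - B) (\<lambda>w. W - insert w B))"
    using assms by (subst sum.Sigma) auto
  also have "Sigma (W - B) (\<lambda>w. W - insert w B) = L \<union> G"
    by (auto simp: L_def G_def)
  also have "sum f (L \<union> G) = sum f L + sum f G"
    using fin by (intro sum.union_disjoint) (auto simp: L_def G_def)
  also have "sum f G = (\<Sum>x\<in>L. f (prod.swap x))"
    by (rule sum.reindex_bij_witness[of _ prod.swap prod.swap]) (auto simp: L_def G_def)
  also have "\<dots> = (\<Sum>x\<in>L. - f x)"
  proof (rule sum.cong[OF refl])
    fix x assume "x \<in> L"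
    then obtain w w' where x: "x = (w, w')" and w: "w \<notin> B" "w' \<notin> B" "w < w'"
      by (auto simp: L_def)
    have "koszul_sign w' (insert w B) = - (koszul_sign w' B :: 'k)"
      using koszul_sign_insert_less[OF assms(2) w(1,3)] .
    moreover have "koszul_sign w (insert w' B) = (koszul_sign w B :: 'k)"
      using koszul_sign_insert_greater[OF w(3)] .
    ultimately have "t w' B * t w (insert w' B) = - (t w B * t w' (insert w B))"
      by (simp add: t_def mult_single add.commute mult.commute flip: single_uminus)
    moreover have "insert w (insert w' B) = insert w' (insert w B)"
      by blast
    ultimately show "f (prod.swap x) = - f x"
      by (simp add: f_def x flip: mult.assoc)
  qed
  finally show ?thesis
    by (simp add: sum_negf)
qed

lemma lookup_koszul_d:
  fixes c :: "(nat \<times> nat) set \<Rightarrow> 'k::field cox_poly"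
  assumes "finite W"
  shows "lookup (koszul_d W c B) m =
    (\<Sum>w\<in>(W - B) \<inter> keys m. koszul_sign w B * lookup (c (insert w B)) (m - single w 1))"
proof -
  have le: "(\<forall>v. lookup (single w 1) v \<le> lookup m v) \<longleftrightarrow> w \<in> keys m" for w
  proof
    assume "\<forall>v. lookup (single w 1) v \<le> lookup m v"
    then have "lookup (single w 1) w \<le> lookup m w"
      by blast
    then show "w \<in> keys m"
      by (simp add: in_keys_iff)
  qed (auto simp: lookup_single when_def in_keys_iff)
  have "lookup (koszul_d W c B) m = (\<Sum>w\<in>W - B. if w \<in> keys m
      then koszul_sign w B * lookup (c (insert w B)) (m - single w 1) else 0)"
    unfolding koszul_d_def lookup_sum lookup_single_mult le ..
  also have "\<dots> = (\<Sum>w\<in>(W - B) \<inter> keys m. koszul_sign w B * lookup (c (insert w B)) (m - single w 1))"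
    by (rule sum.inter_restrict[symmetric]) (use assms in simp)
  finally show ?thesis .
qed

lemma monom_diff_single_add: "w \<in> keys m \<Longrightarrow> single w 1 + (m - single w 1) = (m :: monom)"
  by (rule monom_diff_add) (auto simp: lookup_single when_def in_keys_iff)

lemma lookup_koszul_lift:
  fixes c :: "(nat \<times> nat) set \<Rightarrow> 'k::field cox_poly"
  assumes "finite A"
  shows "lookup (koszul_lift W c A) m = (let v = Min (keys m \<inter> W \<union> A) in
    if v \<in> A then lookup (c (A - {v})) (m + single v 1) else 0)"
proof -
  let ?f = "\<lambda>m. let v = Min (keys m \<inter> W \<union> A) in
    if v \<in> A then lookup (c (A - {v})) (m + single v 1) else 0"
  have "{m. ?f m \<noteq> 0} \<subseteq> (\<Union>v\<in>A. (\<lambda>k. k - single v 1) ` keys (c (A - {v})))"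
  proof
    fix m assume "m \<in> {m. ?f m \<noteq> 0}"
    then obtain v where "v \<in> A" "m + single v 1 \<in> keys (c (A - {v}))"
      by (auto simp: Let_def in_keys_iff split: if_splits)
    moreover have "m = (m + single v 1) - single v 1"
      by simp
    ultimately show "m \<in> (\<Union>v\<in>A. (\<lambda>k. k - single v 1) ` keys (c (A - {v})))"
      by blast
  qed
  then have "finite {m. ?f m \<noteq> 0}"
    by (rule finite_subset) (use assms in auto)
  then show ?thesis
    unfolding koszul_lift_def by (simp add: lookup_Abs_poly_mapping)
qed

text \<open>
  For a cycle \<open>c\<close> the formula \<open>d \<sigma> + \<sigma> d = id\<close> of the homotopy reads \<open>d (\<sigma> c) = c\<close>. It holds at each
  coefficient \<open>x\<^sup>m e\<^sub>B\<close> whose strand \<open>T\<close> is nonempty. The strand is empty only for \<open>B = {}\<close> and a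
  monomial \<open>m\<close> without variables in \<open>W\<close>, so in homological degree 0 the formula yields preimages for
  exactly the elements of the ideal generated by the variables in \<open>W\<close>.
\<close>

lemma koszul_d_koszul_lift:
  fixes c :: "(nat \<times> nat) set \<Rightarrow> 'k::field cox_poly"
  assumes W: "finite W" and B: "B \<subseteq> W"
    and cycle: "\<And>v. v \<in> B \<Longrightarrow> koszul_d W c (B - {v}) = 0"
    and augmentation: "\<And>m. B = {} \<Longrightarrow> lookup (c B) m \<noteq> 0 \<Longrightarrow> keys m \<inter> W \<noteq> {}"
  shows "koszul_d W (koszul_lift W c) B = c B"
proof (rule poly_mapping_eqI)
  fix m :: monom
  have finB: "finite B"
    using W B finite_subset by blast
  let ?J = "(W - B) \<inter> keys m"
  let ?T = "keys m \<inter> W \<union> B"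
  let ?d = "koszul_d W (koszul_lift W c) B"
  have d: "lookup ?d m =
      (\<Sum>w\<in>?J. koszul_sign w B * lookup (koszul_lift W c (insert w B)) (m - single w 1))"
    by (rule lookup_koszul_d[OF W])
  show "lookup ?d m = lookup (c B) m"
  proof (cases "?T = {}")
    case True
    then have empty: "?J = {}" "B = {}" "keys m \<inter> W = {}"
      by auto
    have "lookup (c B) m = 0"
      using augmentation[of m] empty by blast
    then show ?thesis
      unfolding d empty(1) by simp
  next
    case False
    define v where "v = Min ?T"
    have finT: "finite ?T"
      using finB by simp
    have vT: "v \<in> ?T" and v_le: "\<And>b. b \<in> ?T \<Longrightarrow> v \<le> b"
      unfolding v_def using Min_in[OF finT False] Min_le[OF finT] by auto
    have lift: "lookup (koszul_lift W c (insert w B)) (m - single w 1) =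
        (if v \<in> insert w B then lookup (c (insert w B - {v})) ((m - single w 1) + single v 1) else 0)"
      if w: "w \<in> ?J" for w
    proof -
      have "keys m = {w} \<union> keys (m - single w 1)"
        using monom_diff_single_add[of w m] keys_monom_add[of "single w 1" "m - single w 1"] w by simp
      then have "keys (m - single w 1) \<inter> W \<union> insert w B = ?T"
        using w by blast
      then show ?thesis
        using finB by (simp add: lookup_koszul_lift v_def Let_def)
    qed
    show ?thesis
    proof (cases "v \<in> B")
      case False
      then have vJ: "v \<in> ?J"
        using vT by blast
      \<comment> \<open>Only the summand \<open>w = v\<close> has the minimal variable in its exterior factor.\<close>
      have "lookup ?d m = (\<Sum>w\<in>?J. if w = v then lookup (c B) m else 0)"
        unfolding d
      proof (rule sum.cong[OF refl])
        fix w assume w: "w \<in> ?J"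
        have "koszul_sign v B = (1 :: 'k)"
          by (rule koszul_sign_minimal) (use v_le in blast)
        moreover have "(m - single v 1) + single v 1 = m"
          using monom_diff_single_add[of v m] vJ by (simp add: add.commute)
        moreover have "insert v B - {v} = B"
          using False by blast
        ultimately show "koszul_sign w B * lookup (koszul_lift W c (insert w B)) (m - single w 1)
            = (if w = v then lookup (c B) m else 0)"
          using False unfolding lift[OF w] by auto
      qed
      also have "\<dots> = lookup (c B) m"
        using vJ W by (simp add: sum.delta)
      finally show ?thesis .
    next
      case True
      let ?g = "\<lambda>w. lookup (c (insert w (B - {v}))) ((m + single v 1) - single w 1)"
      have J': "(W - (B - {v})) \<inter> keys (m + single v 1) = insert v ?J"
        using True B by (auto simp: keys_monom_add)
      \<comment> \<open>The cycle condition at \<open>x\<^sub>v x\<^sup>m\<close> and \<open>B - {v}\<close> expresses the coefficient of \<open>x\<^sup>m e\<^sub>B\<close> by the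
      summands of \<open>d (\<sigma> c)\<close>: passing from \<open>B - {v}\<close> to \<open>B\<close> reverses their signs, as \<open>v < w\<close>.\<close>
      have "lookup (koszul_d W c (B - {v})) (m + single v 1) = 0"
        using cycle[OF True] by simp
      then have "(\<Sum>w\<in>insert v ?J. koszul_sign w (B - {v}) * ?g w) = 0"
        unfolding lookup_koszul_d[OF W] J' .
      moreover have "v \<notin> ?J" "finite ?J"
        using True W by auto
      ultimately have "koszul_sign v (B - {v}) * ?g v + (\<Sum>w\<in>?J. koszul_sign w (B - {v}) * ?g w) = 0"
        by simp
      moreover have "koszul_sign v (B - {v}) = (1 :: 'k)"
        by (rule koszul_sign_minimal) (use v_le in blast)
      moreover have "?g v = lookup (c B) m"
        using True by (simp add: insert_absorb)
      ultimately have "lookup (c B) m = (\<Sum>w\<in>?J. - (koszul_sign w (B - {v}) * ?g w))"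
        by (simp add: sum_negf eq_neg_iff_add_eq_0)
      also have "\<dots> = (\<Sum>w\<in>?J. koszul_sign w B * lookup (koszul_lift W c (insert w B)) (m - single w 1))"
      proof (rule sum.cong[OF refl])
        fix w assume w: "w \<in> ?J"
        then have "v < w"
          using v_le[of w] True by (auto simp: less_le)
        then have "koszul_sign w B = - (koszul_sign w (B - {v}) :: 'k)"
          using koszul_sign_insert_less[of "B - {v}" v w] finB True by (simp add: insert_absorb)
        moreover have "insert w B - {v} = insert w (B - {v})"
          using w True by auto
        moreover have "(m - single w 1) + single v 1 = (m + single v 1) - single w 1"
        proof (rule poly_mapping_eqI)
          fix x
          show "lookup ((m - single w 1) + single v 1) x = lookup ((m + single v 1) - single w 1) x"
            using w by (auto simp: lookup_add lookup_minus lookup_single when_def in_keys_iff)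
        qed
        ultimately show "- (koszul_sign w (B - {v}) * ?g w)
            = koszul_sign w B * lookup (koszul_lift W c (insert w B)) (m - single w 1)"
          unfolding lift[OF w] using True by simp
      qed
      finally show ?thesis
        unfolding d ..
    qed
  qed
qed


section \<open>The sum of the Koszul complexes of the facets\<close>

context balanced_simplicial_complex
begin

text \<open>
  The pair \<open>(F, A)\<close> labels the Koszul basis element \<open>e\<^sub>A\<close> in the summand of the facet \<open>F\<close>, on the
  variables outside \<open>F\<close>.
\<close>

definition cells :: "nat \<Rightarrow> ((nat \<times> nat) set \<times> (nat \<times> nat) set) set"
  where "cells i = {(F, A). F \<in> facets \<Delta> \<and> A \<subseteq> vertices r n - F \<and> card A = i}"

definition basis :: "nat \<Rightarrow> ((nat \<times> nat) set \<times> (nat \<times> nat) set) list"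
  where "basis i = (SOME xs. distinct xs \<and> set xs = cells i)"

text \<open>
  Including \<open>F\<close> in the degree is the twist that makes the augmentation degree-preserving: the
  generator of the summand of \<open>F\<close> is sent to the class of \<open>x\<^sup>F\<close>.
\<close>

definition cell_degree :: "(nat \<times> nat) set \<times> (nat \<times> nat) set \<Rightarrow> nat \<Rightarrow> int"
  where "cell_degree x = monom_degree (sqfree_monom (fst x \<union> snd x))"

abbreviation degrees :: "nat \<Rightarrow> (nat \<Rightarrow> int) list"
  where "degrees i \<equiv> map cell_degree (basis i)"

definition component ::
    "nat \<Rightarrow> (nat \<Rightarrow> 'k::field cox_poly) \<Rightarrow> (nat \<times> nat) set \<Rightarrow> (nat \<times> nat) set \<Rightarrow> 'k cox_poly"
  where "component i v F A = coord (basis i) v (F, A)"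

definition boundary :: "nat \<Rightarrow> (nat \<Rightarrow> 'k::field cox_poly) \<Rightarrow> nat \<Rightarrow> 'k cox_poly"
  where "boundary i v =
    vec_of (basis i) (\<lambda>(F, B). koszul_d (vertices r n - F) (component (Suc i) v F) B)"

definition facet_sum :: "(nat \<Rightarrow> 'k::field cox_poly) \<Rightarrow> 'k cox_poly"
  where "facet_sum v = (\<Sum>F\<in>facets \<Delta>. component 0 v F {} * single (sqfree_monom F) 1)"

definition augmentation :: "(nat \<Rightarrow> 'k::field cox_poly) \<Rightarrow> 'k cox_poly set"
  where "augmentation v = nonface_ideal r n \<Delta> +>\<^bsub>cox_ring r n\<^esub> facet_sum v"

lemma basis: "distinct (basis i)" "set (basis i) = cells i"
proof -
  have "cells i \<subseteq> facets \<Delta> \<times> Pow (vertices r n)"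
    by (auto simp: cells_def)
  then have "finite (cells i)"
    by (rule finite_subset) (simp add: finite_facets)
  then have "\<exists>xs. distinct xs \<and> set xs = cells i"
    using finite_distinct_list by blast
  then show "distinct (basis i)" "set (basis i) = cells i"
    unfolding basis_def by (metis (mono_tags, lifting) someI_ex)+
qed

lemma facet_subset: "F \<in> facets \<Delta> \<Longrightarrow> F \<subseteq> vertices r n"
  using facet_transversal unfolding transversal_def by blast

lemma facet_finite: "F \<in> facets \<Delta> \<Longrightarrow> finite F"
  using facet_transversal transversal_finite by blast

lemma cellD:
  assumes "(F, A) \<in> cells i"
  shows "F \<in> facets \<Delta>" "A \<subseteq> vertices r n - F" "card A = i" "finite A" "finite F"
  using assms facet_finite finite_subset[of A "vertices r n"] by (auto simp: cells_def)

lemma cell_insert: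
  assumes "(F, B) \<in> cells i" "w \<in> vertices r n - F - B"
  shows "(F, insert w B) \<in> cells (Suc i)"
  using cellD[OF assms(1)] assms(2) by (auto simp: cells_def)

lemma cell_remove:
  assumes "(F, B) \<in> cells (Suc i)" "v \<in> B"
  shows "(F, B - {v}) \<in> cells i"
  using cellD[OF assms(1)] assms(2) by (auto simp: cells_def)

lemma facet_cell: "F \<in> facets \<Delta> \<Longrightarrow> (F, {}) \<in> cells 0"
  by (simp add: cells_def)

lemma cells_0D: "(F, A) \<in> cells 0 \<Longrightarrow> A = {}"
  using cellD by (metis card_0_eq)

lemma cell_degree_insert:
  assumes "(F, B) \<in> cells i" "w \<in> vertices r n - F - B"
  shows "cell_degree (F, insert w B) = (\<lambda>j. monom_degree (single w 1) j + cell_degree (F, B) j)"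
  using cellD[OF assms(1)] assms(2)
  by (simp add: cell_degree_def sqfree_monom_insert monom_degree_add)

lemma cell_degree_remove:
  assumes "(F, B) \<in> cells (Suc i)" "v \<in> B"
  shows "cell_degree (F, B) = (\<lambda>j. monom_degree (single v 1) j + cell_degree (F, B - {v}) j)"
proof -
  have "v \<in> vertices r n - F - (B - {v})"
    using cellD[OF assms(1)] assms(2) by blast
  from cell_degree_insert[OF cell_remove[OF assms] this] show ?thesis
    using assms(2) by (simp add: insert_absorb)
qed

lemma cell_degree_multidegree:
  assumes "x \<in> cells i"
  shows "cell_degree x \<in> multidegrees r"
proof -
  obtain F A where x: "x = (F, A)"
    by (cases x)
  have "keys (sqfree_monom (F \<union> A)) \<subseteq> vertices r n"
    using cellD[of F A i] facet_subset[of F] assms x by auto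
  then show ?thesis
    unfolding cell_degree_def x using monom_degree_in_multidegrees by simp
qed

text \<open>
  Outside a facet there are \<open>n\<^sub>1 + \<cdots> + n\<^sub>r\<close> variables, one fewer than all in each component.
\<close>

lemma basis_empty:
  assumes "(\<Sum>i=1..r. n i) < i"
  shows "basis i = []"
proof -
  have "card (vertices r n) = (\<Sum>i=1..r. n i) + r"
    by (simp add: vertices_def sum_Suc)
  have False if "(F, A) \<in> cells i" for F A
  proof -
    have "card (vertices r n - F) = (\<Sum>i=1..r. n i)"
      using cellD(1,5)[OF that] card_transversal[OF facet_transversal] facet_subset
        \<open>card (vertices r n) = _\<close> by (simp add: card_Diff_subset)
    moreover have "card A \<le> card (vertices r n - F)"
      using cellD(2)[OF that] by (intro card_mono) auto
    ultimately show False
      using cellD(3)[OF that] assms by simp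
  qed
  then have "cells i = {}"
    by auto
  then show ?thesis
    using basis(2)[of i] by simp
qed

lemma component_vec_of: "(F, A) \<in> cells i \<Longrightarrow> component i (vec_of (basis i) c) F A = c (F, A)"
  unfolding component_def by (rule coord_vec_of) (simp_all add: basis)

lemma component_add:
  "component i (\<lambda>j. v j + w j) F = (\<lambda>A. component i v F A + component i w F A)"
  unfolding component_def by (rule ext) (rule coord_add)

lemma component_smult: "component i (\<lambda>j. p * v j) F = (\<lambda>A. p * component i v F A)"
  unfolding component_def by (rule ext) (rule coord_smult)

lemma component_carrier:
  "v \<in> carrier (free_gmodule r n (degrees i)) \<Longrightarrow> component i v F A \<in> carrier (cox_ring r n)"
  unfolding component_def by (rule coord_carrier) (simp_all add: basis)

lemma component_grade:
  "v \<in> grade (free_gmodule r n (degrees i)) d \<Longrightarrow>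
    component i v F A \<in> hom_part r n (\<lambda>j. d j - cell_degree (F, A) j)"
  unfolding component_def by (rule coord_grade) (simp_all add: basis)

lemma vec_of_component:
  assumes "v \<in> carrier (free_gmodule r n (degrees i))"
  shows "vec_of (basis i) (\<lambda>(F, A). component i v F A) = v"
proof -
  have "(\<lambda>(F, A). component i v F A) = coord (basis i) v"
    by (auto simp: component_def)
  then show ?thesis
    using assms vec_of_coord[OF basis(1), where v = v] by (simp add: free_gmodule_simps)
qed

lemma koszul_d_carrier:
  assumes "\<And>A. c A \<in> carrier (cox_ring r n)"
  shows "koszul_d (vertices r n - F) c B \<in> carrier (cox_ring r n)"
  unfolding koszul_d_def
  by (intro cox_sum_closed cox_mult_closed single_in_carrier assms) auto

lemma boundary_graded_hom:
  "boundary i \<in> graded_hom r n (free_gmodule r n (degrees (Suc i)))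
    (free_gmodule r n (degrees i) :: ('k::field cox_poly, nat \<Rightarrow> 'k cox_poly) gmodule)"
proof -
  let ?M = "free_gmodule r n (degrees (Suc i)) :: ('k cox_poly, nat \<Rightarrow> 'k cox_poly) gmodule"
  let ?N = "free_gmodule r n (degrees i) :: ('k cox_poly, nat \<Rightarrow> 'k cox_poly) gmodule"
  have "boundary i v \<in> carrier ?N" if "v \<in> carrier ?M" for v
    unfolding boundary_def
    by (rule vec_of_carrier) (auto intro!: koszul_d_carrier component_carrier that)
  moreover have "boundary i (v \<oplus>\<^bsub>?M\<^esub> w) = boundary i v \<oplus>\<^bsub>?N\<^esub> boundary i w" for v w
    by (rule ext) (simp add: boundary_def free_gmodule_simps vec_of_def component_add koszul_d_add
        split: prod.split)
  moreover have "boundary i (p \<odot>\<^bsub>?M\<^esub> v) = p \<odot>\<^bsub>?N\<^esub> boundary i v" for p v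
    by (rule ext) (simp add: boundary_def free_gmodule_simps vec_of_def component_smult koszul_d_smult
        split: prod.split)
  moreover have "boundary i v \<in> grade ?N d" if v: "v \<in> grade ?M d" for v d
    unfolding boundary_def
  proof (rule vec_of_grade)
    fix x assume "x \<in> set (basis i)"
    moreover obtain F B where x: "x = (F, B)"
      by (meson surj_pair)
    ultimately have cell: "(F, B) \<in> cells i"
      by (simp add: basis)
    have "single (single w 1) (koszul_sign w B) * component (Suc i) v F (insert w B)
        \<in> hom_part r n (\<lambda>j. d j - cell_degree x j)" if w: "w \<in> vertices r n - F - B" for w
    proof -
      have "single (single w 1) (koszul_sign w B :: 'k) \<in> hom_part r n (monom_degree (single w 1))"
        using w by (intro single_in_hom_part) auto
      from hom_part_mult[OF this component_grade[OF v, of F "insert w B"]] show ?thesis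
        by (simp add: x cell_degree_insert[OF cell w] algebra_simps)
    qed
    then show "(case x of (F, B) \<Rightarrow> koszul_d (vertices r n - F) (component (Suc i) v F) B)
        \<in> hom_part r n (\<lambda>j. d j - cell_degree x j)"
      unfolding x prod.case koszul_d_def by (rule hom_part_sum)
  qed
  ultimately show ?thesis
    unfolding graded_hom_def by blast
qed

lemma component_boundary:
  "(F, B) \<in> cells i \<Longrightarrow>
    component i (boundary i v) F B = koszul_d (vertices r n - F) (component (Suc i) v F) B"
  unfolding boundary_def by (simp add: component_vec_of)

lemma boundary_boundary: "boundary i (boundary (Suc i) v) = (\<lambda>j. 0)"
proof -
  have "koszul_d (vertices r n - F) (component (Suc i) (boundary (Suc i) v) F) B = 0"
    if cell: "(F, B) \<in> cells i" for F B
  proof -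
    have "koszul_d (vertices r n - F) (component (Suc i) (boundary (Suc i) v) F) B
        = koszul_d (vertices r n - F)
            (koszul_d (vertices r n - F) (component (Suc (Suc i)) v F)) B"
      by (rule koszul_d_cong) (rule component_boundary[OF cell_insert[OF cell]])
    also have "\<dots> = 0"
      using cellD[OF cell] by (intro koszul_d_koszul_d) auto
    finally show ?thesis .
  qed
  then have "boundary i (boundary (Suc i) v) = vec_of (basis i) (\<lambda>x. 0)"
    unfolding boundary_def[of i] by (intro vec_of_cong) (auto simp: basis)
  then show ?thesis
    by (simp add: vec_of_def)
qed

lemma koszul_lift_grade:
  assumes c: "\<And>A. c A \<in> hom_part r n (\<lambda>j. d j - cell_degree (F, A) j)"
    and cell: "(F, A) \<in> cells (Suc i)"
  shows "koszul_lift W c A \<in> hom_part r n (\<lambda>j. d j - cell_degree (F, A) j)"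
  unfolding hom_part_iff
proof (intro allI impI)
  fix m assume "lookup (koszul_lift W c A) m \<noteq> 0"
  then obtain v where v: "v \<in> A" "lookup (c (A - {v})) (m + single v 1) \<noteq> 0"
    unfolding lookup_koszul_lift[OF cellD(4)[OF cell]] by (auto simp: Let_def split: if_splits)
  then have "keys (m + single v 1) \<subseteq> vertices r n"
    and deg: "monom_degree (m + single v 1) = (\<lambda>j. d j - cell_degree (F, A - {v}) j)"
    using c[of "A - {v}"] unfolding hom_part_iff by blast+
  then have "keys m \<subseteq> vertices r n"
    by (simp add: keys_monom_add)
  moreover have "monom_degree m = (\<lambda>j. d j - cell_degree (F, A) j)"
  proof
    fix j
    show "monom_degree m j = d j - cell_degree (F, A) j"
      using fun_cong[OF deg, of j] fun_cong[OF cell_degree_remove[OF cell v(1)], of j]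
      by (simp add: monom_degree_add)
  qed
  ultimately show "keys m \<subseteq> vertices r n \<and> monom_degree m = (\<lambda>j. d j - cell_degree (F, A) j)"
    by blast
qed

text \<open>
  The homotopy applied in each summand, with the two conditions under which it inverts the
  differential.
\<close>

lemma boundary_preimage:
  fixes y :: "nat \<Rightarrow> 'k::field cox_poly"
  assumes y: "y \<in> grade (free_gmodule r n (degrees i)) d"
    and cycle: "\<And>F B v. (F, B) \<in> cells i \<Longrightarrow> v \<in> B \<Longrightarrow>
      koszul_d (vertices r n - F) (component i y F) (B - {v}) = 0"
    and augmented: "\<And>F m. (F, {}) \<in> cells i \<Longrightarrow> lookup (component i y F {}) m \<noteq> 0 \<Longrightarrow>
      keys m \<inter> (vertices r n - F) \<noteq> {}"
  shows "\<exists>x\<in>grade (free_gmodule r n (degrees (Suc i))) d. boundary i x = y"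
proof -
  let ?W = "\<lambda>F. vertices r n - F"
  define x where "x = vec_of (basis (Suc i)) (\<lambda>(F, A). koszul_lift (?W F) (component i y F) A)"
  have x_grade: "x \<in> grade (free_gmodule r n (degrees (Suc i))) d"
    unfolding x_def
  proof (rule vec_of_grade)
    fix z assume "z \<in> set (basis (Suc i))"
    moreover obtain F A where z: "z = (F, A)"
      by (meson surj_pair)
    ultimately have cell: "(F, A) \<in> cells (Suc i)"
      by (simp add: basis)
    show "(case z of (F, A) \<Rightarrow> koszul_lift (?W F) (component i y F) A)
        \<in> hom_part r n (\<lambda>j. d j - cell_degree z j)"
      using koszul_lift_grade[OF component_grade[OF y] cell] by (simp add: z)
  qed
  have "koszul_d (?W F) (component (Suc i) x F) B = component i y F B" if cell: "(F, B) \<in> cells i" for F B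
  proof -
    have "koszul_d (?W F) (component (Suc i) x F) B
        = koszul_d (?W F) (koszul_lift (?W F) (component i y F)) B"
      unfolding x_def by (intro koszul_d_cong) (simp add: component_vec_of[OF cell_insert[OF cell]])
    also have "\<dots> = component i y F B"
      using cellD[OF cell] cycle[OF cell] augmented cell by (intro koszul_d_koszul_lift) auto
    finally show ?thesis .
  qed
  then have "boundary i x = vec_of (basis i) (\<lambda>(F, B). component i y F B)"
    unfolding boundary_def by (intro vec_of_cong) (auto simp: basis)
  also have "\<dots> = y"
    using y graded_module.grade_carrier[OF graded_module_free] by (intro vec_of_component) blast
  finally show ?thesis
    using x_grade by blast
qed

lemma boundary_exact:
  assumes y: "y \<in> grade (free_gmodule r n (degrees (Suc i))) d" and zero: "boundary i y = (\<lambda>j. 0)"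
  shows "\<exists>x\<in>grade (free_gmodule r n (degrees (Suc (Suc i)))) d. boundary (Suc i) x = y"
proof (rule boundary_preimage[OF y])
  fix F B v assume cell: "(F, B) \<in> cells (Suc i)" and v: "v \<in> B"
  have "component i (boundary i y) F (B - {v}) = 0"
    unfolding zero by (simp add: component_def coord_def)
  then show "koszul_d (vertices r n - F) (component (Suc i) y F) (B - {v}) = 0"
    using component_boundary[OF cell_remove[OF cell v]] by metis
next
  fix F and m :: monom assume "(F, {}) \<in> cells (Suc i)"
  then show "keys m \<inter> (vertices r n - F) \<noteq> {}"
    using cellD(3) by fastforce
qed

lemma facet_sum_carrier:
  assumes "v \<in> carrier (free_gmodule r n (degrees 0))"
  shows "facet_sum v \<in> carrier (cox_ring r n)"
  unfolding facet_sum_def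
  by (intro cox_sum_closed cox_mult_closed single_in_carrier component_carrier assms)
    (simp add: facet_finite facet_subset)

lemma facet_sum_grade:
  assumes "v \<in> grade (free_gmodule r n (degrees 0)) d"
  shows "facet_sum v \<in> hom_part r n d"
  unfolding facet_sum_def
proof (rule hom_part_sum)
  fix F assume F: "F \<in> facets \<Delta>"
  have "single (sqfree_monom F) 1 \<in> hom_part r n (cell_degree (F, {}))"
    using F by (simp add: cell_degree_def single_in_hom_part facet_finite facet_subset)
  from hom_part_mult[OF component_grade[OF assms, of F "{}"] this]
  show "component 0 v F {} * single (sqfree_monom F) 1 \<in> hom_part r n d"
    by simp
qed

lemma augmentation_graded_hom:
  "augmentation \<in> graded_hom r n (free_gmodule r n (degrees 0))
    (quotient_gmodule r n (nonface_ideal r n \<Delta> :: 'k::field cox_poly set))"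
proof -
  let ?M = "free_gmodule r n (degrees 0) :: ('k cox_poly, nat \<Rightarrow> 'k cox_poly) gmodule"
  let ?I = "nonface_ideal r n \<Delta> :: 'k cox_poly set"
  let ?Q = "quotient_gmodule r n ?I"
  note s = quotient_gmodule_simps[OF ideal_nonface]
  have "augmentation v \<in> carrier ?Q" if "v \<in> carrier ?M" for v
    unfolding augmentation_def s(1) using facet_sum_carrier[OF that] by (rule imageI)
  moreover have "augmentation (v \<oplus>\<^bsub>?M\<^esub> w) = augmentation v \<oplus>\<^bsub>?Q\<^esub> augmentation w"
    if "v \<in> carrier ?M" "w \<in> carrier ?M" for v w
  proof -
    have "facet_sum (v \<oplus>\<^bsub>?M\<^esub> w) = facet_sum v + facet_sum w"
      by (simp add: facet_sum_def free_gmodule_simps component_add distrib_right sum.distrib)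
    then show ?thesis
      using s(3)[OF facet_sum_carrier facet_sum_carrier, OF that] by (simp add: augmentation_def)
  qed
  moreover have "augmentation (p \<odot>\<^bsub>?M\<^esub> v) = p \<odot>\<^bsub>?Q\<^esub> augmentation v"
    if "p \<in> carrier (cox_ring r n)" "v \<in> carrier ?M" for p v
  proof -
    have "facet_sum (p \<odot>\<^bsub>?M\<^esub> v) = p * facet_sum v"
      by (simp add: facet_sum_def free_gmodule_simps component_smult sum_distrib_left mult.assoc)
    then show ?thesis
      using s(4)[OF that(1) facet_sum_carrier[OF that(2)]] by (simp add: augmentation_def)
  qed
  moreover have "augmentation v \<in> grade ?Q d" if "v \<in> grade ?M d" for v d
    unfolding augmentation_def s(2) using facet_sum_grade[OF that] by (rule imageI)
  ultimately show ?thesis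
    unfolding graded_hom_def by blast
qed

lemma augmentation_zero_iff:
  fixes v :: "nat \<Rightarrow> 'k::field cox_poly"
  assumes "v \<in> carrier (free_gmodule r n (degrees 0))"
  shows "augmentation v = \<zero>\<^bsub>quotient_gmodule r n (nonface_ideal r n \<Delta>)\<^esub>
    \<longleftrightarrow> facet_sum v \<in> nonface_ideal r n \<Delta>"
  unfolding augmentation_def
  by (rule quotient_gmodule_simps(6)[OF ideal_nonface facet_sum_carrier[OF assms]])

text \<open>
  For \<open>w\<close> outside a facet \<open>F\<close> the set \<open>insert w F\<close> is a non-face, so \<open>x\<^sub>w x\<^sup>F\<close> vanishes modulo the
  Stanley--Reisner ideal.
\<close>

lemma augmentation_boundary:
  fixes v :: "nat \<Rightarrow> 'k::field cox_poly"
  assumes v: "v \<in> carrier (free_gmodule r n (degrees (Suc 0)))"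
  shows "augmentation (boundary 0 v) = \<zero>\<^bsub>quotient_gmodule r n (nonface_ideal r n \<Delta>)\<^esub>"
proof -
  let ?I = "nonface_ideal r n \<Delta> :: 'k cox_poly set"
  have "component 0 (boundary 0 v) F {} * single (sqfree_monom F) 1 \<in> ?I" if F: "F \<in> facets \<Delta>" for F
  proof -
    have "single (single w 1) (koszul_sign w {}) * component (Suc 0) v F {w} * single (sqfree_monom F) 1 \<in> ?I"
      if w: "w \<in> vertices r n - F" for w
    proof -
      have "insert w F \<notin> \<Delta>"
        using F w unfolding facets_def by blast
      then have "single (sqfree_monom (insert w F)) (koszul_sign w {} :: 'k) \<in> ?I"
        using facet_finite[OF F] facet_subset[OF F] w
        by (auto simp: nonface_ideal_def single_in_carrier lookup_single when_def)
      then have "component (Suc 0) v F {w} * single (sqfree_monom (insert w F)) (koszul_sign w {}) \<in> ?I"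
        using ideal.I_l_closed[OF ideal_nonface _ component_carrier[OF v]] by simp
      moreover have "single (single w 1) (koszul_sign w {}) * component (Suc 0) v F {w} * single (sqfree_monom F) 1
          = component (Suc 0) v F {w} * single (sqfree_monom (insert w F)) (koszul_sign w {})"
      proof -
        have "single (sqfree_monom (insert w F)) (koszul_sign w {} :: 'k)
            = single (single w 1) (koszul_sign w {}) * single (sqfree_monom F) 1"
          using w facet_finite[OF F] by (simp add: sqfree_monom_insert mult_single)
        then show ?thesis
          by (simp only: mult_ac)
      qed
      ultimately show ?thesis
        by (simp only:)
    qed
    then show ?thesis
      unfolding component_boundary[OF facet_cell[OF F]] koszul_d_def sum_distrib_right
      by (intro ideal_sum_closed[OF ideal_nonface]) simp
  qed
  then have "facet_sum (boundary 0 v) \<in> ?I"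
    unfolding facet_sum_def by (rule ideal_sum_closed[OF ideal_nonface])
  then show ?thesis
    using augmentation_zero_iff[OF graded_homD(1)[OF boundary_graded_hom v]] by blast
qed

text \<open>
  If a monomial \<open>m\<close> of the component at \<open>F\<close> only involved variables of \<open>F\<close>, then \<open>x\<^sup>m x\<^sup>F\<close> would be a
  monomial of the \<open>facet_sum\<close> with support \<open>F\<close>: no other facet \<open>G\<close> contributes to it, since \<open>x\<^sup>G\<close>
  does not divide it. But the monomials of an element of the Stanley--Reisner ideal have non-faces
  as supports.
\<close>

lemma augmentation_exact:
  fixes y :: "nat \<Rightarrow> 'k::field cox_poly"
  assumes y: "y \<in> grade (free_gmodule r n (degrees 0)) d"
    and zero: "augmentation y = \<zero>\<^bsub>quotient_gmodule r n (nonface_ideal r n \<Delta>)\<^esub>"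
  shows "\<exists>x\<in>grade (free_gmodule r n (degrees (Suc 0))) d. boundary 0 x = y"
proof (rule boundary_preimage[OF y])
  have y_carrier: "y \<in> carrier (free_gmodule r n (degrees 0))"
    using y graded_module.grade_carrier[OF graded_module_free] by blast
  have sum_in: "facet_sum y \<in> nonface_ideal r n \<Delta>"
    using zero augmentation_zero_iff[OF y_carrier] by blast
  fix F and m :: monom
  assume "(F, {}) \<in> cells 0" and m: "lookup (component 0 y F {}) m \<noteq> 0"
  then have F: "F \<in> facets \<Delta>"
    using cellD by blast
  show "keys m \<inter> (vertices r n - F) \<noteq> {}"
  proof
    assume "keys m \<inter> (vertices r n - F) = {}"
    moreover have "keys m \<subseteq> vertices r n"
      using component_carrier[OF y_carrier] m unfolding cox_carrier_iff by blast
    ultimately have mF: "keys m \<subseteq> F"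
      by blast
    let ?k = "sqfree_monom F + m"
    have k: "keys ?k = F"
      using mF facet_finite[OF F] by (auto simp: keys_monom_add)
    have "lookup (component 0 y G {} * single (sqfree_monom G) 1) ?k
        = (if G = F then lookup (component 0 y F {}) m else 0)" if G: "G \<in> facets \<Delta>" for G
    proof (cases "G = F")
      case True
      then show ?thesis
        by (simp add: mult.commute)
    next
      case False
      have "\<not> (\<forall>v. lookup (sqfree_monom G) v \<le> lookup ?k v)"
      proof
        assume le: "\<forall>v. lookup (sqfree_monom G) v \<le> lookup ?k v"
        have "G \<subseteq> keys ?k"
        proof
          fix v assume "v \<in> G"
          then have "1 \<le> lookup ?k v"
            using le[rule_format, of v] facet_finite[OF G] by (simp add: lookup_sqfree_monom)
          then show "v \<in> keys ?k"
            by (simp add: in_keys_iff)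
        qed
        then show False
          using k False transversal_subset_eq[OF facet_transversal[OF G] facet_transversal[OF F]] by simp
      qed
      then have "lookup (single (sqfree_monom G) 1 * component 0 y G {}) ?k = 0"
        unfolding lookup_single_mult by argo
      then show ?thesis
        using False by (simp add: mult.commute)
    qed
    then have "lookup (facet_sum y) ?k = (\<Sum>G\<in>facets \<Delta>. if G = F then lookup (component 0 y F {}) m else 0)"
      unfolding facet_sum_def lookup_sum by (intro sum.cong) auto
    also have "\<dots> = lookup (component 0 y F {}) m"
      using F finite_facets by simp
    finally have "lookup (facet_sum y) ?k \<noteq> 0"
      using m by simp
    then have "keys ?k \<notin> \<Delta>"
      using sum_in unfolding nonface_ideal_def by blast
    then show False
      using k facet_face[OF F] by simp
  qed
qed (use cells_0D in blast)

text \<open>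
  At every point \<open>x\<^sup>G\<close> is nonzero for some transversal \<open>G\<close>. If \<open>G\<close> is a facet, the multiples of
  \<open>x\<^sup>G\<close> are images of the generator of the summand of \<open>G\<close>; otherwise \<open>x\<^sup>G\<close> is zero in the
  quotient.
\<close>

lemma augmentation_locally_surjective:
  fixes P :: "'k::field cox_poly set"
  assumes "P \<in> multiproj r n"
  shows "\<exists>e\<in>multidegrees r. \<exists>u\<in>hom_part r n e - P. \<forall>d\<in>multidegrees r.
    \<forall>y\<in>grade (quotient_gmodule r n (nonface_ideal r n \<Delta>)) d.
      \<exists>x\<in>grade (free_gmodule r n (degrees 0)) (\<lambda>i. d i + e i).
        augmentation x = u \<odot>\<^bsub>quotient_gmodule r n (nonface_ideal r n \<Delta>)\<^esub> y"
proof -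
  let ?I = "nonface_ideal r n \<Delta> :: 'k cox_poly set"
  let ?Q = "quotient_gmodule r n ?I"
  note s = quotient_gmodule_simps[OF ideal_nonface]
  obtain G where tr: "transversal r n G" and notin: "single (sqfree_monom G) 1 \<notin> P"
    using multiproj_transversal[OF assms] by metis
  let ?u = "single (sqfree_monom G) 1 :: 'k cox_poly"
  let ?e = "monom_degree (sqfree_monom G)"
  have G: "finite G" "G \<subseteq> vertices r n"
    using tr transversal_finite by (auto simp: transversal_def)
  have e: "?e \<in> multidegrees r"
    using G monom_degree_in_multidegrees by simp
  have u: "?u \<in> hom_part r n ?e"
    using G by (intro single_in_hom_part) simp
  have "\<exists>x\<in>grade (free_gmodule r n (degrees 0)) (\<lambda>i. d i + ?e i). augmentation x = ?u \<odot>\<^bsub>?Q\<^esub> y"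
    if y: "y \<in> grade ?Q d" for d y
  proof -
    obtain p where p: "p \<in> hom_part r n d" "y = ?I +>\<^bsub>cox_ring r n\<^esub> p"
      using y unfolding s(2) by blast
    have uy: "?u \<odot>\<^bsub>?Q\<^esub> y = ?I +>\<^bsub>cox_ring r n\<^esub> (?u * p)"
      unfolding p(2) by (rule s(4)[OF hom_part_carrier[OF u] hom_part_carrier[OF p(1)]])
    show ?thesis
    proof (cases "G \<in> \<Delta>")
      case True
      then have facet: "G \<in> facets \<Delta>"
        using transversal_face_facet tr by blast
      define x where "x = vec_of (basis 0) (\<lambda>(F, A). if F = G then p else 0)"
      have "x \<in> grade (free_gmodule r n (degrees 0)) (\<lambda>i. d i + ?e i)"
        unfolding x_def
      proof (rule vec_of_grade)
        fix z assume "z \<in> set (basis 0)"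
        moreover obtain F A where "z = (F, A)"
          by (meson surj_pair)
        ultimately have z: "z = (F, {})"
          using cells_0D[of F A] by (simp add: basis)
        show "(case z of (F, A) \<Rightarrow> if F = G then p else 0)
            \<in> hom_part r n (\<lambda>i. d i + ?e i - cell_degree z i)"
          using p(1) by (simp add: z cell_degree_def)
      qed
      moreover have "facet_sum x = ?u * p"
      proof -
        have "facet_sum x = (\<Sum>F\<in>facets \<Delta>. if F = G then p * ?u else 0)"
          unfolding facet_sum_def x_def
          by (rule sum.cong[OF refl]) (simp add: component_vec_of[OF facet_cell])
        also have "\<dots> = ?u * p"
          using facet finite_facets by (simp add: mult.commute)
        finally show ?thesis .
      qed
      ultimately show ?thesis
        unfolding uy augmentation_def by - (rule bexI[of _ x], simp_all)
    next
      case False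
      have "?u \<in> ?I"
        using False G by (auto simp: nonface_ideal_def single_in_carrier lookup_single when_def)
      then have "?u * p \<in> ?I"
        using ideal.I_r_closed[OF ideal_nonface _ hom_part_carrier[OF p(1)]] by simp
      then have "?u \<odot>\<^bsub>?Q\<^esub> y = \<zero>\<^bsub>?Q\<^esub>"
        unfolding uy using s(6) cox_mult_closed[OF hom_part_carrier[OF u] hom_part_carrier[OF p(1)]]
        by blast
      moreover have "augmentation (\<lambda>j. 0) = \<zero>\<^bsub>?Q\<^esub>"
        unfolding s(5) by (simp add: augmentation_def facet_sum_def component_def coord_def)
      moreover have "(\<lambda>j. 0 :: 'k cox_poly) \<in> grade (free_gmodule r n (degrees 0)) (\<lambda>i. d i + ?e i)"
        by (simp add: free_gmodule_simps)
      ultimately show ?thesis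
        by - (rule bexI[of _ "\<lambda>j. 0"], simp_all only:)
    qed
  qed
  then show ?thesis
    using e u notin by blast
qed

theorem virtual_resolution_nonface_ideal:
  "virtual_resolution r n (nonface_ideal r n \<Delta> :: 'k::field cox_poly set)
    (\<Sum>i=1..r. n i) degrees boundary"
proof -
  let ?F = "\<lambda>i. free_gmodule r n (degrees i) :: ('k cox_poly, nat \<Rightarrow> 'k cox_poly) gmodule"
  let ?Q = "quotient_gmodule r n (nonface_ideal r n \<Delta> :: 'k cox_poly set)"
  have Q: "graded_module r n ?Q"
    by (rule graded_module_quotient[OF ideal_nonface])
  have exact: "sheaf_exact r n (?F (Suc (Suc i))) (?F (Suc i)) (?F i)
      (induced_map r n (?F (Suc i)) (boundary (Suc i))) (induced_map r n (?F i) (boundary i))" for i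
    by (rule sheaf_exact_induced_map[OF graded_module_free graded_module_free graded_module_free
          boundary_graded_hom boundary_graded_hom])
      (simp_all add: free_gmodule_simps(2) boundary_boundary boundary_exact)
  have exact0: "sheaf_exact r n (?F 1) (?F 0) ?Q (induced_map r n (?F 0) (boundary 0))
      (induced_map r n ?Q augmentation)"
    unfolding One_nat_def
    by (rule sheaf_exact_induced_map[OF graded_module_free graded_module_free Q
          boundary_graded_hom augmentation_graded_hom augmentation_boundary augmentation_exact])
  have "sheaf_surjective r n (?F 0) ?Q (induced_map r n ?Q augmentation)"
    by (rule sheaf_surjective_induced_map[OF graded_module_free Q augmentation_graded_hom
          augmentation_locally_surjective])
  with exact0 have "\<exists>\<epsilon>\<in>sheaf_hom r n (?F 0) ?Q.
      sheaf_exact r n (?F 1) (?F 0) ?Q (induced_map r n (?F 0) (boundary 0)) \<epsilon> \<and>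
      sheaf_surjective r n (?F 0) ?Q \<epsilon>"
    using induced_map_sheaf_hom[OF graded_module_free Q augmentation_graded_hom] by blast
  moreover have "set (degrees i) \<subseteq> multidegrees r" for i
    using cell_degree_multidegree by (auto simp: basis)
  moreover have "\<forall>i>(\<Sum>i=1..r. n i). degrees i = []"
    using basis_empty by simp
  ultimately show ?thesis
    unfolding virtual_resolution_def Let_def
    using exact by (simp add: free_gmodule_simps(2) boundary_graded_hom boundary_boundary)
qed

end

theorem theorem1p3:
  fixes r :: nat and n :: "nat \<Rightarrow> nat" and \<Delta> :: "(nat \<times> nat) set set"
  assumes "r \<ge> 1"
    and "simplicial_complex (vertices r n) \<Delta>"
    and "pure_complex \<Delta>"
    and "balanced_complex r \<Delta>"
  shows "virtually_Cohen_Macaulay TYPE('k::field) r n \<Delta>"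
proof -
  interpret balanced_simplicial_complex r n \<Delta>
    using assms by unfold_locales
  show ?thesis
    unfolding virtually_Cohen_Macaulay_def B_saturated_def Let_def stanley_reisner_eq
    using saturated codim_nonface_ideal virtual_resolution_nonface_ideal by metis
qed

end
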